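(* Let $d\ge 1$, let $\varepsilon>0$, let $\lambda\in L^2(\mathbb{R}^d)$ (complex-valued), and let $\omega\colon\mathbb{R}^d\to[0,\infty)$ be an unbounded and almost everywhere continuous function with $\inf_{k\in\mathbb{R}^d}\omega(k)=0$. For $\alpha>0$ let $H_\alpha$ be the two-photon spin-boson Hamiltonian defined in the context. Then there exists $\alpha_*>0$ such that for every $\alpha>\alpha_*$ the operator $H_\alpha$ has at most two bound state energies (counted with multiplicities).
   Context: Let $L^2_s(\mathbb{R}^d\times\mathbb{R}^d)$ be the subspace of symmetric functions in $L^2(\mathbb{R}^d\times\mathbb{R}^d)$, equipped with the inner product $(\phi,\psi)=\frac12\int\int \phi(k_1,k_2)\overline{\psi(k_1,k_2)}\,dk_1dk_2$. The truncated Fock space is $\mathcal{F}_s^2=\mathbb{C}\oplus L^2(\mathbb{R}^d)\oplus L^2_s(\mathbb{R}^d\times\mathbb{R}^d)$. The operator $H_\alpha$ acts in $\mathbb{C}^2\otimes\mathcal{F}_s^2$. Its elements are written $f=(f_0^{(\sigma)},f_1^{(\sigma)},f_2^{(\sigma)})$ with discrete variable $\sigma=\pm$ (identified with $\pm1$ in formulas), and $$(H_\alpha f)_0^{(\sigma)}=\sigma\varepsilon f_0^{(\sigma)}+\alpha\int\lambda(q)f_1^{(-\sigma)}(q)\,dq,$$ $$(H_\alpha f)_1^{(\sigma)}(k)=(\sigma\varepsilon+\omega(k))f_1^{(\sigma)}(k)+\alpha\overline{\lambda(k)}f_0^{(-\sigma)}+\alpha\int f_2^{(-\sigma)}(k,q)\lambda(q)\,dq,$$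 $$(H_\alpha f)_2^{(\sigma)}(k_1,k_2)=(\sigma\varepsilon+\omega(k_1)+\omega(k_2))f_2^{(\sigma)}(k_1,k_2)+\alpha\overline{\lambda(k_1)}f_1^{(-\sigma)}(k_2)+\alpha\overline{\lambda(k_2)}f_1^{(-\sigma)}(k_1).$$ Its domain is $\mathbb{C}^2\otimes(\mathbb{C}\oplus\mathcal{H}_1\oplus\mathcal{H}_2)$, where $\mathcal{H}_1=\{f\in L^2(\mathbb{R}^d):\int\omega(k)^2|f(k)|^2dk<\infty\}$ and $\mathcal{H}_2=\{g\in L^2_s(\mathbb{R}^d\times\mathbb{R}^d):\int\int(\omega(k_1)+\omega(k_2))^2|g(k_1,k_2)|^2dk_1dk_2<\infty\}$. On this domain $H_\alpha$ is self-adjoint, being a bounded symmetric perturbation of the self-adjoint operator $H_0$. The bound state energies of $H_\alpha$ are its discrete eigenvalues lying below the bottom $\min\sigma_{\rm ess}(H_\alpha)$ of its essential spectrum. Their number, counted with multiplicities, is the dimension of the spectral subspace of $H_\alpha$ for the interval $(-\infty,\min\sigma_{\rm ess}(H_\alpha))$. *)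

theory Defs
  imports "HOL-Analysis.Analysis" "HOL-Library.Extended_Nat"
begin

section \<open>Complex inner product spaces\<close>

text \<open>The inner product is linear in its \<^emph>\<open>first\<close> argument.\<close>

class complex_inner = ab_group_add +
  fixes scaleC :: "complex \<Rightarrow> 'a \<Rightarrow> 'a" (infixr "*\<^sub>C" 75)
    and cinner :: "'a \<Rightarrow> 'a \<Rightarrow> complex"
  assumes scaleC_add_right: "c *\<^sub>C (x + y) = c *\<^sub>C x + c *\<^sub>C y"
    and scaleC_add_left: "(b + c) *\<^sub>C x = b *\<^sub>C x + c *\<^sub>C x"
    and scaleC_scaleC: "b *\<^sub>C c *\<^sub>C x = (b * c) *\<^sub>C x"
    and scaleC_one: "1 *\<^sub>C x = x"
    and cinner_commute: "cinner x y = cnj (cinner y x)"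
    and cinner_add_left: "cinner (x + y) z = cinner x z + cinner y z"
    and cinner_scaleC_left: "cinner (c *\<^sub>C x) y = c * cinner x y"
    and cinner_ge_zero: "0 \<le> Re (cinner x x)"
    and cinner_eq_zero_iff: "cinner x x = 0 \<longleftrightarrow> x = 0"

global_interpretation complex_vector: vector_space "scaleC :: complex \<Rightarrow> 'h \<Rightarrow> 'h :: complex_inner"
  by unfold_locales (auto simp: scaleC_add_right scaleC_add_left scaleC_scaleC scaleC_one)

lemma Re_cinner_self_eq_0_iff: "Re (cinner u u) = 0 \<longleftrightarrow> u = 0" for u :: "'h :: complex_inner"
proof -
  have "Im (cinner u u) = 0"
    using cinner_commute[of u u] by (metis cnj.simps(2) neg_equal_zero)
  then show ?thesis
    using cinner_eq_zero_iff[of u] by (simp add: complex_eq_iff)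
qed

definition hnorm :: "'h :: complex_inner \<Rightarrow> real" where
  "hnorm x = sqrt (Re (cinner x x))"

text \<open>The library's \<open>dim\<close> is \<open>0\<close> on infinite-dimensional subspaces, hence this extended version.\<close>

definition cdim :: "'h :: complex_inner set \<Rightarrow> enat" where
  "cdim V = (if \<exists>B. finite B \<and> V \<subseteq> complex_vector.span B
             then enat (complex_vector.dim V) else \<infinity>)"

instantiation complex :: complex_inner
begin
definition scaleC_complex :: "complex \<Rightarrow> complex \<Rightarrow> complex" where
  "scaleC_complex c x = c * x"
definition cinner_complex :: "complex \<Rightarrow> complex \<Rightarrow> complex" where
  "cinner_complex x y = x * cnj y"
instance
  by standard
    (auto simp: scaleC_complex_def cinner_complex_def algebra_simps)
end

instantiation prod :: (complex_inner, complex_inner) complex_inner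
begin
definition scaleC_prod :: "complex \<Rightarrow> 'a \<times> 'b \<Rightarrow> 'a \<times> 'b" where
  "scaleC_prod c x = (c *\<^sub>C fst x, c *\<^sub>C snd x)"
definition cinner_prod :: "'a \<times> 'b \<Rightarrow> 'a \<times> 'b \<Rightarrow> complex" where
  "cinner_prod x y = cinner (fst x) (fst y) + cinner (snd x) (snd y)"
instance
proof
  fix x y z :: "'a \<times> 'b" and b c :: complex
  show "cinner x y = cnj (cinner y x)"
    unfolding cinner_prod_def complex_cnj_add by (metis cinner_commute)
  show "cinner x x = 0 \<longleftrightarrow> x = 0"
  proof
    assume "cinner x x = 0"
    then have "Re (cinner (fst x) (fst x)) + Re (cinner (snd x) (snd x)) = 0"
      unfolding cinner_prod_def by (metis plus_complex.simps(1) zero_complex.simps(1))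
    then have "Re (cinner (fst x) (fst x)) = 0" "Re (cinner (snd x) (snd x)) = 0"
      using cinner_ge_zero[of "fst x"] cinner_ge_zero[of "snd x"] by linarith+
    then show "x = 0"
      by (simp add: prod_eq_iff Re_cinner_self_eq_0_iff)
  next
    assume "x = 0"
    then show "cinner x x = 0"
      by (simp add: cinner_prod_def cinner_eq_zero_iff[THEN iffD2, OF refl])
  qed
qed (auto simp: scaleC_prod_def cinner_prod_def scaleC_add_right scaleC_add_left scaleC_scaleC
    scaleC_one cinner_add_left cinner_scaleC_left cinner_ge_zero distrib_left)
end


section \<open>Linear operators and their spectra\<close>

text \<open>An (in general unbounded) operator is a pair of its domain and its action; the action is
  irrelevant outside of the domain.\<close>

type_synonym 'h operator = "'h set \<times> ('h \<Rightarrow> 'h)"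

definition dom_op :: "'h operator \<Rightarrow> 'h set" where
  "dom_op A = fst A"

definition app_op :: "'h operator \<Rightarrow> 'h \<Rightarrow> 'h" where
  "app_op A = snd A"

definition resolvent_set :: "'h :: complex_inner operator \<Rightarrow> complex set" where
  "resolvent_set A = {z. bij_betw (\<lambda>f. app_op A f - z *\<^sub>C f) (dom_op A) UNIV \<and>
     (\<exists>C. \<forall>f \<in> dom_op A. hnorm f \<le> C * hnorm (app_op A f - z *\<^sub>C f))}"

definition op_spectrum :: "'h :: complex_inner operator \<Rightarrow> complex set" where
  "op_spectrum A = - resolvent_set A"

definition eigenspace :: "'h :: complex_inner operator \<Rightarrow> complex \<Rightarrow> 'h set" where
  "eigenspace A z = {f \<in> dom_op A. app_op A f = z *\<^sub>C f}"

definition discrete_spectrum :: "'h :: complex_inner operator \<Rightarrow> complex set" where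
  "discrete_spectrum A = {z. z isolated_in op_spectrum A \<and>
     eigenspace A z \<noteq> {0} \<and> cdim (eigenspace A z) < \<infinity>}"

definition essential_spectrum :: "'h :: complex_inner operator \<Rightarrow> complex set" where
  "essential_spectrum A = op_spectrum A - discrete_spectrum A"

text \<open>For a self-adjoint operator the essential spectrum is a closed subset of the real line, so
  whenever it is nonempty and bounded below this infimum is its minimum.\<close>

definition ess_bottom :: "'h :: complex_inner operator \<Rightarrow> ereal" where
  "ess_bottom A = (INF x \<in> {x. complex_of_real x \<in> essential_spectrum A}. ereal x)"

definition bound_state_energies :: "'h :: complex_inner operator \<Rightarrow> real set" where
  "bound_state_energies A =
     {x. complex_of_real x \<in> discrete_spectrum A \<and> ereal x < ess_bottom A}"

text \<open>The supremum over finite subsets is the sum of the multiplicities over the possibly infinite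
  set of bound state energies.\<close>

definition num_bound_states :: "'h :: complex_inner operator \<Rightarrow> enat" where
  "num_bound_states A = (SUP X \<in> {X. finite X \<and> X \<subseteq> bound_state_energies A}.
     \<Sum>x\<in>X. cdim (eigenspace A (complex_of_real x)))"


section \<open>Spectral measures\<close>

definition orthogonal_projection :: "('h :: complex_inner \<Rightarrow> 'h) \<Rightarrow> bool" where
  "orthogonal_projection P \<longleftrightarrow> Vector_Spaces.linear scaleC scaleC P \<and>
     (\<forall>f. P (P f) = P f) \<and> (\<forall>f g. cinner (P f) g = cinner f (P g))"

text \<open>Weak countable additivity is equivalent to strong countable additivity for projections.\<close>

definition projection_valued_measure :: "(real set \<Rightarrow> 'h :: complex_inner \<Rightarrow> 'h) \<Rightarrow> bool" where
  "projection_valued_measure E \<longleftrightarrow>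
     (\<forall>S \<in> sets borel. orthogonal_projection (E S)) \<and>
     E UNIV = id \<and>
     (\<forall>S \<in> sets borel. \<forall>T \<in> sets borel. E (S \<inter> T) = E S \<circ> E T) \<and>
     (\<forall>S :: nat \<Rightarrow> real set. range S \<subseteq> sets borel \<longrightarrow> disjoint_family S \<longrightarrow>
        (\<forall>f. (\<lambda>n. cinner (E (S n) f) f) sums cinner (E (\<Union>n. S n) f) f))"

definition scalar_measure :: "(real set \<Rightarrow> 'h :: complex_inner \<Rightarrow> 'h) \<Rightarrow> 'h \<Rightarrow> real measure" where
  "scalar_measure E f = measure_of UNIV (sets borel) (\<lambda>S. ennreal (Re (cinner (E S f) f)))"

text \<open>The relation between a self-adjoint operator and its spectral measure, i.e. the operator is
  the integral of the identity function against the measure; by polarization its quadratic form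
  determines the operator on the domain. By the spectral theorem every self-adjoint operator in a
  Hilbert space has exactly one spectral measure on the Borel sets.\<close>

definition spectral_measure_of ::
    "'h :: complex_inner operator \<Rightarrow> (real set \<Rightarrow> 'h \<Rightarrow> 'h) \<Rightarrow> bool" where
  "spectral_measure_of A E \<longleftrightarrow> projection_valued_measure E \<and>
     dom_op A = {f. (\<integral>\<^sup>+ x. ennreal (x\<^sup>2) \<partial>scalar_measure E f) < \<infinity>} \<and>
     (\<forall>f \<in> dom_op A. cinner (app_op A f) f = complex_of_real (\<integral> x. x \<partial>scalar_measure E f))"


section \<open>Spaces of square-integrable functions\<close>

text \<open>Measurability is with respect to the completed Lebesgue measure, since a function that is
  continuous almost everywhere need not be Borel measurable.\<close>

definition square_integrable :: "('a :: euclidean_space \<Rightarrow> complex) \<Rightarrow> bool" where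
  "square_integrable f \<longleftrightarrow>
     f \<in> borel_measurable lebesgue \<and> integrable lebesgue (\<lambda>x. (cmod (f x))\<^sup>2)"

definition ae_symmetric :: "('a :: euclidean_space \<times> 'a \<Rightarrow> complex) \<Rightarrow> bool" where
  "ae_symmetric f \<longleftrightarrow> (AE x in lebesgue. f (snd x, fst x) = f x)"

lemma square_integrable_zero: "square_integrable (\<lambda>x. 0)"
  by (simp add: square_integrable_def)

lemma square_integrable_scale: "square_integrable f \<Longrightarrow> square_integrable (\<lambda>x. c * f x)"
  by (auto simp: square_integrable_def norm_mult power_mult_distrib)

lemma square_integrable_add:
  assumes "square_integrable f" "square_integrable g"
  shows "square_integrable (\<lambda>x. f x + g x)"
proof -
  have [measurable]: "f \<in> borel_measurable lebesgue" "g \<in> borel_measurable lebesgue"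
    using assms by (auto simp: square_integrable_def)
  have "integrable lebesgue (\<lambda>x. 2 * (cmod (f x))\<^sup>2 + 2 * (cmod (g x))\<^sup>2)"
    using assms by (auto simp: square_integrable_def)
  moreover have "(cmod (a + b))\<^sup>2 \<le> 2 * (cmod a)\<^sup>2 + 2 * (cmod b)\<^sup>2" for a b :: complex
  proof -
    have "(cmod (a + b))\<^sup>2 \<le> (cmod a + cmod b)\<^sup>2"
      by (intro power_mono norm_triangle_ineq) auto
    also have "\<dots> \<le> 2 * (cmod a)\<^sup>2 + 2 * (cmod b)\<^sup>2"
      using zero_le_power2[of "cmod a - cmod b"] by (simp add: power2_eq_square algebra_simps)
    finally show ?thesis .
  qed
  ultimately have "integrable lebesgue (\<lambda>x. (cmod (f x + g x))\<^sup>2)"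
    by (elim Bochner_Integration.integrable_bound) auto
  then show ?thesis
    by (simp add: square_integrable_def)
qed

lemma square_integrable_uminus: "square_integrable f \<Longrightarrow> square_integrable (\<lambda>x. - f x)"
  using square_integrable_scale[of f "-1"] by simp

lemma square_integrable_diff:
  "square_integrable f \<Longrightarrow> square_integrable g \<Longrightarrow> square_integrable (\<lambda>x. f x - g x)"
  using square_integrable_add[of f "\<lambda>x. - g x"] square_integrable_uminus[of g] by simp

lemma integrable_mult_cnj:
  assumes "square_integrable f" "square_integrable g"
  shows "integrable lebesgue (\<lambda>x. f x * cnj (g x))"
proof -
  have [measurable]: "f \<in> borel_measurable lebesgue" "g \<in> borel_measurable lebesgue"
    using assms by (auto simp: square_integrable_def)
  have "integrable lebesgue (\<lambda>x. (cmod (f x))\<^sup>2 + (cmod (g x))\<^sup>2)"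
    using assms by (auto simp: square_integrable_def)
  moreover have "cmod a * cmod b \<le> (cmod a)\<^sup>2 + (cmod b)\<^sup>2" for a b :: complex
  proof -
    have "2 * (cmod a * cmod b) \<le> (cmod a)\<^sup>2 + (cmod b)\<^sup>2"
      using zero_le_power2[of "cmod a - cmod b"] by (simp add: power2_eq_square algebra_simps)
    moreover have "0 \<le> cmod a * cmod b" by simp
    ultimately show ?thesis by linarith
  qed
  moreover have "(\<lambda>x. f x * cnj (g x)) \<in> borel_measurable lebesgue"
  proof -
    have [measurable]: "cnj \<in> borel_measurable borel"
      by (intro borel_measurable_continuous_onI continuous_intros)
    show ?thesis by measurable
  qed
  ultimately show ?thesis
    by (elim Bochner_Integration.integrable_bound) (auto simp: norm_mult)
qed

lemma integral_mult_cnj_commute: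
  "(\<integral>x. f x * cnj (g x) \<partial>M) = cnj (\<integral>x. g x * cnj (f x) \<partial>M)"
  by (subst Bochner_Integration.integral_cnj[symmetric]) (simp add: mult.commute)

lemma integral_mult_cnj_self:
  "(\<integral>x. f x * cnj (f x) \<partial>M) = complex_of_real (\<integral>x. (cmod (f x))\<^sup>2 \<partial>M)"
  unfolding complex_norm_square[symmetric] by (rule integral_complex_of_real)

lemma integral_mult_cnj_eq_0_iff:
  assumes "square_integrable f"
  shows "(\<integral>x. f x * cnj (f x) \<partial>lebesgue) = 0 \<longleftrightarrow> (AE x in lebesgue. f x = 0)"
  using assms unfolding integral_mult_cnj_self square_integrable_def
  by (subst of_real_eq_0_iff, subst integral_nonneg_eq_0_iff_AE) auto

lemma integral_mult_cnj_cong: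
  assumes "square_integrable f" "square_integrable f'" "square_integrable g" "square_integrable g'"
    and "AE x in lebesgue. f x = f' x" "AE x in lebesgue. g x = g' x"
  shows "(\<integral>x. f x * cnj (g x) \<partial>lebesgue) = (\<integral>x. f' x * cnj (g' x) \<partial>lebesgue)"
proof (rule integral_cong_AE)
  show "(\<lambda>x. f x * cnj (g x)) \<in> borel_measurable lebesgue"
    "(\<lambda>x. f' x * cnj (g' x)) \<in> borel_measurable lebesgue"
    using assms by (auto intro!: borel_measurable_integrable integrable_mult_cnj)
  show "AE x in lebesgue. f x * cnj (g x) = f' x * cnj (g' x)"
    using assms(5,6) by eventually_elim simp
qed

lemma ae_eq_trans: "AE x in M. f x = g x \<Longrightarrow> AE x in M. g x = h x \<Longrightarrow> AE x in M. f x = h x"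
  by (erule (1) eventually_elim2) simp

lemma ae_eq_add:
  fixes f g :: "'a \<Rightarrow> complex"
  shows "AE x in M. f x = f' x \<Longrightarrow> AE x in M. g x = g' x \<Longrightarrow> AE x in M. f x + g x = f' x + g' x"
  by (erule (1) eventually_elim2) simp

lemma ae_eq_diff:
  fixes f g :: "'a \<Rightarrow> complex"
  shows "AE x in M. f x = f' x \<Longrightarrow> AE x in M. g x = g' x \<Longrightarrow> AE x in M. f x - g x = f' x - g' x"
  by (erule (1) eventually_elim2) simp

lemma ae_eq_scale:
  fixes f :: "'a \<Rightarrow> complex"
  shows "AE x in M. f x = f' x \<Longrightarrow> AE x in M. c * f x = c * f' x"
  by (erule eventually_mono) simp

lemma ae_eq_uminus:
  fixes f :: "'a \<Rightarrow> complex"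
  shows "AE x in M. f x = f' x \<Longrightarrow> AE x in M. - f x = - f' x"
  by (erule eventually_mono) simp

lemma ae_symmetric_add:
  "ae_symmetric f \<Longrightarrow> ae_symmetric g \<Longrightarrow> ae_symmetric (\<lambda>x. f x + g x)"
  unfolding ae_symmetric_def by (erule (1) eventually_elim2) simp

lemma ae_symmetric_scale: "ae_symmetric f \<Longrightarrow> ae_symmetric (\<lambda>x. c * f x)"
  unfolding ae_symmetric_def by (erule eventually_mono) simp

lemma ae_symmetric_uminus: "ae_symmetric f \<Longrightarrow> ae_symmetric (\<lambda>x. - f x)"
  using ae_symmetric_scale[of f "-1"] by simp

lemma ae_symmetric_diff:
  "ae_symmetric f \<Longrightarrow> ae_symmetric g \<Longrightarrow> ae_symmetric (\<lambda>x. f x - g x)"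
  using ae_symmetric_add[of f "\<lambda>x. - g x"] ae_symmetric_uminus[of g] by simp


subsection \<open>The space of square-integrable functions\<close>

definition L2_rel :: "('a :: euclidean_space \<Rightarrow> complex) \<Rightarrow> ('a \<Rightarrow> complex) \<Rightarrow> bool" where
  "L2_rel f g \<longleftrightarrow> square_integrable f \<and> square_integrable g \<and> (AE x in lebesgue. f x = g x)"

quotient_type (overloaded) 'a L2 = "'a :: euclidean_space \<Rightarrow> complex" / partial: L2_rel
proof (rule part_equivpI)
  show "\<exists>f :: 'a \<Rightarrow> complex. L2_rel f f"
    using square_integrable_zero by (auto simp: L2_rel_def)
  show "symp (L2_rel :: ('a \<Rightarrow> complex) \<Rightarrow> _)"
    by (rule sympI) (auto simp: L2_rel_def eq_commute)
  show "transp (L2_rel :: ('a \<Rightarrow> complex) \<Rightarrow> _)"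
    by (rule transpI) (simp add: L2_rel_def, blast intro: ae_eq_trans)
qed

instantiation L2 :: (euclidean_space) complex_inner
begin

lift_definition zero_L2 :: "'a L2" is "\<lambda>x. 0"
  by (simp add: L2_rel_def square_integrable_zero)

lift_definition plus_L2 :: "'a L2 \<Rightarrow> 'a L2 \<Rightarrow> 'a L2" is "\<lambda>f g x. f x + g x"
  by (auto simp: L2_rel_def square_integrable_add intro: ae_eq_add)

lift_definition uminus_L2 :: "'a L2 \<Rightarrow> 'a L2" is "\<lambda>f x. - f x"
  by (auto simp: L2_rel_def square_integrable_uminus intro: ae_eq_uminus)

lift_definition minus_L2 :: "'a L2 \<Rightarrow> 'a L2 \<Rightarrow> 'a L2" is "\<lambda>f g x. f x - g x"
  by (auto simp: L2_rel_def square_integrable_diff intro: ae_eq_diff)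

lift_definition scaleC_L2 :: "complex \<Rightarrow> 'a L2 \<Rightarrow> 'a L2" is "\<lambda>c f x. c * f x"
  by (auto simp: L2_rel_def square_integrable_scale intro: ae_eq_scale)

lift_definition cinner_L2 :: "'a L2 \<Rightarrow> 'a L2 \<Rightarrow> complex"
  is "\<lambda>f g. \<integral>x. f x * cnj (g x) \<partial>lebesgue"
  by (auto simp: L2_rel_def intro: integral_mult_cnj_cong)

instance
proof
  fix a b c :: "'a L2" and s t :: complex
  show "a + b + c = a + (b + c)"
    by transfer (auto simp: L2_rel_def add.assoc square_integrable_add)
  show "a + b = b + a"
    by transfer (auto simp: L2_rel_def add.commute square_integrable_add)
  show "0 + a = a"
    by transfer (auto simp: L2_rel_def)
  show "- a + a = 0"
    by transfer (auto simp: L2_rel_def square_integrable_zero)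
  show "a - b = a + - b"
    by transfer (auto simp: L2_rel_def square_integrable_diff)
  show "s *\<^sub>C (a + b) = s *\<^sub>C a + s *\<^sub>C b"
    by transfer (auto simp: L2_rel_def distrib_left square_integrable_add square_integrable_scale)
  show "(s + t) *\<^sub>C a = s *\<^sub>C a + t *\<^sub>C a"
    by transfer (auto simp: L2_rel_def distrib_right square_integrable_add square_integrable_scale)
  show "s *\<^sub>C t *\<^sub>C a = (s * t) *\<^sub>C a"
    by transfer (auto simp: L2_rel_def mult.assoc square_integrable_scale)
  show "1 *\<^sub>C a = a"
    by transfer (auto simp: L2_rel_def)
  show "cinner a b = cnj (cinner b a)"
    by transfer (rule integral_mult_cnj_commute)
  show "cinner (a + b) c = cinner a c + cinner b c"
    by transfer (auto simp: L2_rel_def distrib_right integrable_mult_cnj)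
  show "cinner (s *\<^sub>C a) b = s * cinner a b"
    by transfer (auto simp: L2_rel_def mult.assoc integrable_mult_cnj)
  show "0 \<le> Re (cinner a a)"
    by transfer (simp add: integral_mult_cnj_self)
  show "cinner a a = 0 \<longleftrightarrow> a = 0"
    by transfer (auto simp: L2_rel_def integral_mult_cnj_eq_0_iff square_integrable_zero)
qed

end


subsection \<open>The space of symmetric square-integrable functions of two variables\<close>

definition L2_sym_rel ::
    "('a :: euclidean_space \<times> 'a \<Rightarrow> complex) \<Rightarrow> ('a \<times> 'a \<Rightarrow> complex) \<Rightarrow> bool" where
  "L2_sym_rel f g \<longleftrightarrow> ae_symmetric f \<and> ae_symmetric g \<and> L2_rel f g"

quotient_type (overloaded) 'a L2_sym =
    "'a :: euclidean_space \<times> 'a \<Rightarrow> complex" / partial: L2_sym_rel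
proof (rule part_equivpI)
  show "\<exists>f :: 'a \<times> 'a \<Rightarrow> complex. L2_sym_rel f f"
    by (rule exI[of _ "\<lambda>x. 0"])
      (auto simp: L2_sym_rel_def L2_rel_def ae_symmetric_def square_integrable_zero)
  show "symp (L2_sym_rel :: ('a \<times> 'a \<Rightarrow> complex) \<Rightarrow> _)"
    by (rule sympI) (auto simp: L2_sym_rel_def L2_rel_def eq_commute)
  show "transp (L2_sym_rel :: ('a \<times> 'a \<Rightarrow> complex) \<Rightarrow> _)"
    by (rule transpI) (simp add: L2_sym_rel_def L2_rel_def, blast intro: ae_eq_trans)
qed

instantiation L2_sym :: (euclidean_space) complex_inner
begin

lift_definition zero_L2_sym :: "'a L2_sym" is "\<lambda>x. 0"
  by (simp add: L2_sym_rel_def L2_rel_def square_integrable_zero ae_symmetric_def)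

lift_definition plus_L2_sym :: "'a L2_sym \<Rightarrow> 'a L2_sym \<Rightarrow> 'a L2_sym" is "\<lambda>f g x. f x + g x"
  by (auto simp: L2_sym_rel_def L2_rel_def square_integrable_add ae_symmetric_add
      intro: ae_eq_add)

lift_definition uminus_L2_sym :: "'a L2_sym \<Rightarrow> 'a L2_sym" is "\<lambda>f x. - f x"
  by (auto simp: L2_sym_rel_def L2_rel_def square_integrable_uminus ae_symmetric_uminus
      intro: ae_eq_uminus)

lift_definition minus_L2_sym :: "'a L2_sym \<Rightarrow> 'a L2_sym \<Rightarrow> 'a L2_sym" is "\<lambda>f g x. f x - g x"
  by (auto simp: L2_sym_rel_def L2_rel_def square_integrable_diff ae_symmetric_diff
      intro: ae_eq_diff)

lift_definition scaleC_L2_sym :: "complex \<Rightarrow> 'a L2_sym \<Rightarrow> 'a L2_sym" is "\<lambda>c f x. c * f x"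
  by (auto simp: L2_sym_rel_def L2_rel_def square_integrable_scale ae_symmetric_scale
      intro: ae_eq_scale)

lift_definition cinner_L2_sym :: "'a L2_sym \<Rightarrow> 'a L2_sym \<Rightarrow> complex"
  is "\<lambda>f g. (1 / 2) * (\<integral>x. f x * cnj (g x) \<partial>lebesgue)"
  by (auto simp: L2_sym_rel_def L2_rel_def intro: integral_mult_cnj_cong)

instance
proof
  fix a b c :: "'a L2_sym" and s t :: complex
  note rels = L2_sym_rel_def L2_rel_def
  note sqi = square_integrable_zero square_integrable_add square_integrable_diff
    square_integrable_scale square_integrable_uminus
  note sym = ae_symmetric_add ae_symmetric_diff ae_symmetric_scale ae_symmetric_uminus
  have sym0: "ae_symmetric (\<lambda>x. 0)"
    by (simp add: ae_symmetric_def)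
  show "a + b + c = a + (b + c)"
    by transfer (auto simp: rels add.assoc sqi sym)
  show "a + b = b + a"
    by transfer (auto simp: rels add.commute sqi sym)
  show "0 + a = a"
    by transfer (auto simp: rels)
  show "- a + a = 0"
    by transfer (auto simp: rels sqi sym0)
  show "a - b = a + - b"
    by transfer (auto simp: rels sqi sym)
  show "s *\<^sub>C (a + b) = s *\<^sub>C a + s *\<^sub>C b"
    by transfer (auto simp: rels distrib_left sqi sym)
  show "(s + t) *\<^sub>C a = s *\<^sub>C a + t *\<^sub>C a"
    by transfer (auto simp: rels distrib_right sqi sym)
  show "s *\<^sub>C t *\<^sub>C a = (s * t) *\<^sub>C a"
    by transfer (auto simp: rels mult.assoc sqi sym)
  show "1 *\<^sub>C a = a"
    by transfer (auto simp: rels)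
  show "cinner a b = cnj (cinner b a)"
    by transfer (simp, rule integral_mult_cnj_commute)
  show "cinner (a + b) c = cinner a c + cinner b c"
    by transfer (auto simp: rels distrib_right integrable_mult_cnj)
  show "cinner (s *\<^sub>C a) b = s * cinner a b"
    by transfer (auto simp: rels mult.assoc integrable_mult_cnj)
  show "0 \<le> Re (cinner a a)"
    by transfer (simp add: integral_mult_cnj_self)
  show "cinner a a = 0 \<longleftrightarrow> a = 0"
    by transfer (auto simp: rels integral_mult_cnj_eq_0_iff sqi sym0)
qed

end


section \<open>The two-photon spin-boson Hamiltonian\<close>

type_synonym 'a fock2 = "complex \<times> 'a L2 \<times> 'a L2_sym"

text \<open>A state is the pair of its spin components for \<open>\<sigma> = +1\<close> and \<open>\<sigma> = -1\<close>, in this order.\<close>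

type_synonym 'a state = "'a fock2 \<times> 'a fock2"

text \<open>One spin component of the image: \<open>s\<close> is the sign \<open>\<sigma>\<close>, the first triple is the component
  of the argument at \<open>\<sigma>\<close>, the second one its component at \<open>-\<sigma>\<close>.\<close>

fun spin_boson_component ::
    "real \<Rightarrow> ('a :: euclidean_space \<Rightarrow> complex) \<Rightarrow> ('a \<Rightarrow> real) \<Rightarrow> real \<Rightarrow>
     real \<Rightarrow> 'a fock2 \<Rightarrow> 'a fock2 \<Rightarrow> 'a fock2" where
  "spin_boson_component \<epsilon> lam \<omega> \<alpha> s (f0, f1, f2) (g0, g1, g2) =
    (complex_of_real (s * \<epsilon>) * f0
       + complex_of_real \<alpha> * (\<integral>q. lam q * rep_L2 g1 q \<partial>lebesgue),
     abs_L2 (\<lambda>k. complex_of_real (s * \<epsilon> + \<omega> k) * rep_L2 f1 k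
       + complex_of_real \<alpha> * cnj (lam k) * g0
       + complex_of_real \<alpha> * (\<integral>q. rep_L2_sym g2 (k, q) * lam q \<partial>lebesgue)),
     abs_L2_sym (\<lambda>(k1, k2). complex_of_real (s * \<epsilon> + \<omega> k1 + \<omega> k2) * rep_L2_sym f2 (k1, k2)
       + complex_of_real \<alpha> * cnj (lam k1) * rep_L2 g1 k2
       + complex_of_real \<alpha> * cnj (lam k2) * rep_L2 g1 k1))"

definition fock2_domain :: "('a :: euclidean_space \<Rightarrow> real) \<Rightarrow> 'a fock2 set" where
  "fock2_domain \<omega> = {(f0, f1, f2).
     integrable lebesgue (\<lambda>k. (\<omega> k)\<^sup>2 * (cmod (rep_L2 f1 k))\<^sup>2) \<and>
     integrable lebesgue (\<lambda>(k1, k2). (\<omega> k1 + \<omega> k2)\<^sup>2 * (cmod (rep_L2_sym f2 (k1, k2)))\<^sup>2)}"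

definition spin_boson ::
    "real \<Rightarrow> ('a :: euclidean_space \<Rightarrow> complex) \<Rightarrow> ('a \<Rightarrow> real) \<Rightarrow> real \<Rightarrow> 'a state operator" where
  "spin_boson \<epsilon> lam \<omega> \<alpha> =
    (fock2_domain \<omega> \<times> fock2_domain \<omega>,
     \<lambda>(fp, fm). (spin_boson_component \<epsilon> lam \<omega> \<alpha> 1 fp fm,
                 spin_boson_component \<epsilon> lam \<omega> \<alpha> (-1) fm fp))"

end

theory Submission
  imports Defs
begin

text \<open>Let \<open>-y\<close> be the lowest eigenvalue of the one-photon Hamiltonian and \<open>m\<close> the essential infimum of
  \<open>\<omega>\<close>. Attaching a second photon with \<open>\<omega>\<close> close to \<open>m\<close> and orthogonal to \<open>\<lambda>\<close> to the one-photon ground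
  state intertwines \<open>H\<close> exactly with multiplication by \<open>\<omega> - y\<close>, so \<open>m - y\<close> belongs to the essential
  spectrum. It remains to show \<open>H \<ge> m - y\<close> on a subspace of codimension two. \<open>H\<close> is the sum of two blocks.
  In each of them, completing the square in \<open>f\<^sub>2\<close> leaves an exchange term with kernel
  \<open>1 / (c + w\<^sub>1 + w\<^sub>2)\<close>, where \<open>w = \<omega> - m\<close>; it differs from the rank one kernel
  \<open>c / ((c + w\<^sub>1) (c + w\<^sub>2))\<close> by a remainder which vanishes where \<open>w = 0\<close> and is dominated by \<open>w\<close> for large
  \<open>\<alpha>\<close>. Removing the rank one part, and with it the coupling to the vacuum up to a small error, costs one
  dimension per block.\<close>

section \<open>Lebesgue measure on products\<close>

text \<open>The estimate must be exact at the threshold \<open>m - y\<close>; any loss there would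
  leave room for further eigenvalues. In the block with vacuum energy \<open>\<epsilon>\<close> the
  form shifted by \<open>y - m\<close> has the one-photon diagonal
  \<open>y - \<epsilon> + w\<close>. With \<open>c = y + \<epsilon> + m\<close>, completing the
  square costs on this diagonal \<open>\<alpha>^2\<close> times the integral of
  \<open>|lam|^2 / (c + w)\<close>, and by the equation for \<open>y\<close> this is all of
  \<open>y - \<epsilon>\<close>. Only \<open>w\<close> is left to pay for the rest, so a small
  remainder does not suffice: it has to vanish together with \<open>w\<close>. As \<open>lam\<close>
  is merely square integrable, no decay rate is available. What must become small is
  \<open>\<alpha>^2 / c^2\<close> times the integral of \<open>|lam|^2 c w / (c + w)^2\<close>. The
  integral tends to \<open>0\<close> by dominated convergence, and the prefactor stays bounded
  because \<open>y\<close> grows at least linearly in \<open>\<alpha>\<close>. The two removed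
  vectors are built from \<open>cnj lam / (y + \<epsilon> + \<omega>)\<close> and
  \<open>cnj lam / (y - \<epsilon> + \<omega>)\<close>. They vanish if \<open>lam\<close> does; in
  that case the two vacua replace them.\<close>

lemma AE_lebesgue_iff: "(AE x in lebesgue. P x) \<longleftrightarrow> (AE x in lborel. P x)"
  by (rule AE_completion_iff)

text \<open>Subsets of null sets are measurable in the completion. This carries measurability from a
  Borel representative back to the original function.\<close>

lemma lebesgue_measurable_cong_AE:
  assumes "g \<in> borel_measurable lebesgue" "AE x in lebesgue. f x = g x"
  shows "f \<in> borel_measurable (lebesgue :: 'a :: euclidean_space measure)"
proof (rule measurableI)
  fix A :: "'b set" assume "A \<in> sets borel"
  then have "g -` A \<inter> space lebesgue \<in> sets lebesgue"
    using assms(1) by (rule measurable_sets[rotated])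
  moreover have ae: "AE x in lebesgue. x \<in> g -` A \<inter> space lebesgue \<longleftrightarrow> x \<in> f -` A \<inter> space lebesgue"
    using assms(2) by eventually_elim auto
  ultimately show "f -` A \<inter> space lebesgue \<in> sets lebesgue"
    by (intro completion.in_sets_AE[OF ae]) auto
qed auto

text \<open>This is how almost everywhere continuity of \<open>\<omega>\<close> enters: off the null
  set of discontinuities the restriction of the function is continuous, hence measurable.\<close>

lemma AE_isCont_imp_lebesgue_measurable:
  fixes f :: "'a :: euclidean_space \<Rightarrow> real"
  assumes "AE x in lebesgue. isCont f x"
  shows "f \<in> borel_measurable lebesgue"
proof -
  define N where "N = {x. \<not> isCont f x}"
  have N: "N \<in> null_sets lebesgue"
    using assms by (simp add: completion.AE_iff_null_sets N_def)
  have S: "- N \<in> sets lebesgue"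
    using N by (simp add: Compl_in_sets_lebesgue null_setsD2)
  have "continuous_on (- N) f"
    by (auto simp: N_def intro: continuous_at_imp_continuous_on)
  then have "f \<in> borel_measurable (lebesgue_on (- N))"
    using S by (rule continuous_imp_measurable_on_sets_lebesgue)
  then have "(\<lambda>x. if x \<in> - N then f x else 0) \<in> borel_measurable lebesgue"
    using S by (subst borel_measurable_if)
  moreover have "AE x in lebesgue. f x = (if x \<in> - N then f x else 0)"
    using AE_not_in[OF N] by eventually_elim simp
  ultimately show ?thesis
    by (rule lebesgue_measurable_cong_AE)
qed

text \<open>On a product space \<open>lebesgue\<close> is a completion and not itself a product
  measure, so Fubini does not apply to it directly. It is applied to such a Borel representative
  over \<open>lborel\<close>, and the result is carried back almost everywhere.\<close>

lemma lebesgue_measurable_imp_borel_AE_eq: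
  fixes f :: "'a :: euclidean_space \<Rightarrow> complex"
  assumes "f \<in> borel_measurable lebesgue"
  obtains g where "g \<in> borel_measurable borel" "AE x in lborel. f x = g x"
proof -
  have "(\<lambda>x. Re (f x)) \<in> borel_measurable lebesgue" "(\<lambda>x. Im (f x)) \<in> borel_measurable lebesgue"
    using assms by auto
  then obtain g h where "g \<in> borel_measurable lborel" "AE x in lborel. Re (f x) = g x"
    "h \<in> borel_measurable lborel" "AE x in lborel. Im (f x) = h x"
    by (metis completion_ex_borel_measurable_real)
  then show ?thesis
    by (intro that[of "\<lambda>x. Complex (g x) (h x)"])
      (auto simp: borel_measurable_complex_iff complex_eq_iff)
qed

lemma integrable_lebesgue_borel:
  fixes f :: "'a :: euclidean_space \<Rightarrow> complex"
  assumes "integrable lebesgue f"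
  obtains g where "g \<in> borel_measurable borel" "AE x in lborel. f x = g x" "integrable lborel g"
    "integral\<^sup>L lebesgue f = integral\<^sup>L lborel g"
proof -
  obtain g where g: "g \<in> borel_measurable borel" "AE x in lborel. f x = g x"
    using lebesgue_measurable_imp_borel_AE_eq[of f] assms by auto
  have gl: "g \<in> borel_measurable lebesgue"
    using g(1) by (simp add: measurable_completion)
  have ae: "AE x in lebesgue. f x = g x"
    using g(2) by (simp add: AE_lebesgue_iff)
  have "integrable lebesgue g"
    using assms ae gl by (subst integrable_cong_AE[symmetric]) auto
  then have "integrable lborel g"
    using g(1) by (subst (asm) integrable_completion) auto
  moreover have "integral\<^sup>L lebesgue f = integral\<^sup>L lborel g"
    using assms ae gl g(1) by (subst integral_cong_AE[of f _ g]) (auto simp: integral_completion)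
  ultimately show ?thesis
    using that g by blast
qed

lemma AE_lebesgue_slices:
  fixes P :: "'a :: euclidean_space \<times> 'b :: euclidean_space \<Rightarrow> bool"
  assumes "AE x in lebesgue. P x"
  shows "AE x in lebesgue. AE y in lebesgue. P (x, y)"
proof -
  have "AE x in lborel \<Otimes>\<^sub>M lborel. P x"
    using assms unfolding AE_lebesgue_iff lborel_prod .
  then show ?thesis
    unfolding AE_lebesgue_iff by (rule lborel_pair.AE_pair)
qed

lemma AE_lborel_swap:
  fixes P :: "'a :: euclidean_space \<times> 'b :: euclidean_space \<Rightarrow> bool"
  assumes "AE z in lborel. P z"
  shows "AE z in lborel. P (snd z, fst z)"
proof -
  have m: "(\<lambda>(x, y). (y, x)) \<in> measurable (lborel \<Otimes>\<^sub>M lborel) (lborel \<Otimes>\<^sub>M lborel :: ('a \<times> 'b) measure)"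
    by (rule measurable_pair_swap')
  obtain N where N: "N \<in> null_sets (lborel :: ('a \<times> 'b) measure)" "{x. \<not> P x} \<subseteq> N"
    using assms by (auto elim!: AE_E simp: null_sets_def)
  have "distr (lborel \<Otimes>\<^sub>M lborel) (lborel \<Otimes>\<^sub>M lborel) (\<lambda>(x, y). (y, x)) = (lborel :: ('a \<times> 'b) measure)"
    using lborel_pair.distr_pair_swap lborel_prod by metis
  then have "AE z in distr (lborel \<Otimes>\<^sub>M lborel) (lborel \<Otimes>\<^sub>M lborel) (\<lambda>(x, y). (y, x)). z \<notin> N"
    using AE_not_in[OF N(1)] by (simp only:)
  then have "AE z in lborel \<Otimes>\<^sub>M lborel. (case z of (x, y) \<Rightarrow> (y, x)) \<notin> N"
    by (rule AE_distrD[OF m])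
  then show ?thesis
    unfolding lborel_prod by eventually_elim (use N in \<open>auto simp: case_prod_unfold\<close>)
qed

lemma AE_lborel_fst_snd:
  fixes P :: "'a :: euclidean_space \<Rightarrow> bool"
  assumes "AE x in lborel. P x"
  shows "AE z in (lborel :: ('a \<times> 'b :: euclidean_space) measure). P (fst z)"
    and "AE z in (lborel :: ('b \<times> 'a) measure). P (snd z)"
proof -
  obtain N where N: "N \<in> null_sets lborel" "{x. \<not> P x} \<subseteq> N"
    using assms by (auto elim!: AE_E simp: null_sets_def)
  have [measurable]: "N \<in> sets borel"
    using N(1) by auto
  have "AE z in (lborel \<Otimes>\<^sub>M lborel :: ('a \<times> 'b) measure). fst z \<notin> N"
    by (rule lborel_pair.AE_pair_measure, measurable, simp, measurable) (use AE_not_in[OF N(1)] in auto)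
  then show fst: "AE z in (lborel :: ('a \<times> 'b) measure). P (fst z)"
    unfolding lborel_prod by eventually_elim (use N in auto)
  show "AE z in (lborel :: ('b \<times> 'a) measure). P (snd z)"
    using AE_lborel_swap[OF fst] by simp
qed

lemmas AE_lebesgue_fst_snd = AE_lborel_fst_snd[folded AE_lebesgue_iff]

text \<open>Sets of the completed target algebra are Borel up to null sets, so besides Borel
  measurability one needs that preimages of null sets are null.\<close>

lemma measurable_lebesgue_lebesgueI:
  fixes f :: "'a :: euclidean_space \<Rightarrow> 'b :: euclidean_space"
  assumes f: "f \<in> measurable lebesgue lborel"
    and "\<And>N. N \<in> null_sets lborel \<Longrightarrow> AE z in lebesgue. f z \<notin> N"
  shows "f \<in> measurable lebesgue lebesgue"
proof (rule completion.measurable_completion2[OF f], rule subsetI)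
  fix N assume "N \<in> null_sets (lborel :: 'b measure)"
  then show "N \<in> null_sets (distr lebesgue lborel f)"
    using assms(2)[of N] by (auto simp: null_sets_distr_iff[OF f] completion.AE_iff_null_sets vimage_def)
qed

lemma measurable_lebesgue_fst_snd [measurable]:
  "fst \<in> measurable (lebesgue :: ('a :: euclidean_space \<times> 'b :: euclidean_space) measure) lebesgue"
  "snd \<in> measurable (lebesgue :: ('a :: euclidean_space \<times> 'b :: euclidean_space) measure) lebesgue"
  by (rule measurable_lebesgue_lebesgueI; auto intro!: measurable_completion
      borel_measurable_continuous_onI continuous_intros AE_lborel_fst_snd AE_not_in simp: AE_lebesgue_iff)+

text \<open>Agreement of \<open>f\<close> with its Borel representative \<open>g\<close> on the
  product gives agreement almost everywhere on almost every slice, so the inner integrals can be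
  compared slice by slice.\<close>

lemma lebesgue_Fubini:
  fixes f :: "'a :: euclidean_space \<times> 'b :: euclidean_space \<Rightarrow> complex"
  assumes "integrable lebesgue f"
  shows "AE x in lebesgue. integrable lebesgue (\<lambda>y. f (x, y))"
    and "integrable lebesgue (\<lambda>x. \<integral>y. f (x, y) \<partial>lebesgue)"
    and "(\<integral>x. \<integral>y. f (x, y) \<partial>lebesgue \<partial>lebesgue) = (\<integral>z. f z \<partial>lebesgue)"
proof -
  obtain g where g: "g \<in> borel_measurable borel" "AE z in lborel. f z = g z" "integrable lborel g"
    and fg: "integral\<^sup>L lebesgue f = integral\<^sup>L lborel g"
    using integrable_lebesgue_borel[OF assms] by blast
  have g': "integrable (lborel \<Otimes>\<^sub>M lborel) g"
    using g(3) by (simp add: lborel_prod)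
  have [measurable]: "g \<in> borel_measurable (borel \<Otimes>\<^sub>M borel)"
    using g(1) by (simp add: borel_prod)
  have mg: "(\<lambda>y. g (x, y)) \<in> borel_measurable borel" for x
    by measurable
  have ae: "AE x in lebesgue. AE y in lebesgue. f (x, y) = g (x, y)"
    using g(2) by (intro AE_lebesgue_slices) (simp add: AE_lebesgue_iff)
  have slice: "integrable lebesgue (\<lambda>y. f (x, y))" "(\<integral>y. f (x, y) \<partial>lebesgue) = (\<integral>y. g (x, y) \<partial>lborel)"
    if "AE y in lebesgue. f (x, y) = g (x, y)" "integrable lborel (\<lambda>y. g (x, y))" for x
  proof -
    have m: "(\<lambda>y. g (x, y)) \<in> borel_measurable lebesgue"
      using mg by (simp add: measurable_completion)
    have mf: "(\<lambda>y. f (x, y)) \<in> borel_measurable lebesgue"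
      using m that(1) by (rule lebesgue_measurable_cong_AE)
    have ig: "integrable lebesgue (\<lambda>y. g (x, y))"
      using that(2) mg by (simp add: integrable_completion)
    show "integrable lebesgue (\<lambda>y. f (x, y))"
      using integrable_cong_AE[OF mf m that(1)] ig by simp
    show "(\<integral>y. f (x, y) \<partial>lebesgue) = (\<integral>y. g (x, y) \<partial>lborel)"
      using integral_cong_AE[OF mf m that(1)] mg by (simp add: integral_completion)
  qed
  have ig: "AE x in lebesgue. integrable lborel (\<lambda>y. g (x, y))"
    using lborel_pair.AE_integrable_fst'[OF g'] by (simp add: AE_lebesgue_iff)
  show "AE x in lebesgue. integrable lebesgue (\<lambda>y. f (x, y))"
    using ae ig by eventually_elim (rule slice)
  have eq: "AE x in lebesgue. (\<integral>y. f (x, y) \<partial>lebesgue) = (\<integral>y. g (x, y) \<partial>lborel)"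
    using ae ig by eventually_elim (rule slice)
  have iG: "integrable lborel (\<lambda>x. \<integral>y. g (x, y) \<partial>lborel)"
    by (rule lborel_pair.integrable_fst'[OF g'])
  then have mG: "(\<lambda>x. \<integral>y. g (x, y) \<partial>lborel) \<in> borel_measurable borel"
    by auto
  then have mG': "(\<lambda>x. \<integral>y. g (x, y) \<partial>lborel) \<in> borel_measurable lebesgue"
    by (simp add: measurable_completion)
  have mF: "(\<lambda>x. \<integral>y. f (x, y) \<partial>lebesgue) \<in> borel_measurable lebesgue"
    by (rule lebesgue_measurable_cong_AE[OF mG' eq])
  show "integrable lebesgue (\<lambda>x. \<integral>y. f (x, y) \<partial>lebesgue)"
    using integrable_cong_AE[OF mF mG' eq] iG mG by (simp add: integrable_completion)
  have "(\<integral>x. \<integral>y. f (x, y) \<partial>lebesgue \<partial>lebesgue) = (\<integral>x. \<integral>y. g (x, y) \<partial>lborel \<partial>lborel)"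
    using integral_cong_AE[OF mF mG' eq] mG by (simp add: integral_completion)
  also have "\<dots> = integral\<^sup>L lborel g"
    using lborel_pair.integral_fst'[OF g'] by (simp add: lborel_prod)
  finally show "(\<integral>x. \<integral>y. f (x, y) \<partial>lebesgue \<partial>lebesgue) = (\<integral>z. f z \<partial>lebesgue)"
    using fg by simp
qed

lemma lebesgue_integral_swap:
  fixes f :: "'a :: euclidean_space \<times> 'b :: euclidean_space \<Rightarrow> complex"
  assumes "integrable lebesgue f"
  shows "integrable lebesgue (\<lambda>z. f (snd z, fst z))"
    and "(\<integral>z. f (snd z, fst z) \<partial>lebesgue) = (\<integral>z. f z \<partial>lebesgue)"
proof -
  obtain g where g: "g \<in> borel_measurable borel" "AE z in lborel. f z = g z" "integrable lborel g"
    and fg: "integral\<^sup>L lebesgue f = integral\<^sup>L lborel g"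
    using integrable_lebesgue_borel[OF assms] by blast
  have g': "integrable (lborel \<Otimes>\<^sub>M lborel) g"
    using g(3) by (simp add: lborel_prod)
  let ?f = "\<lambda>z. f (snd z, fst z)" and ?g = "\<lambda>z. g (snd z, fst z)"
  have ae: "AE z in lebesgue. ?f z = ?g z"
    using AE_lborel_swap[OF g(2)] by (simp add: AE_lebesgue_iff)
  have i: "integrable lborel ?g"
    using lborel_pair.integrable_product_swap[OF g'] by (simp add: lborel_prod case_prod_unfold)
  then have m: "?g \<in> borel_measurable borel"
    by auto
  then have ml: "?g \<in> borel_measurable lebesgue"
    by (simp add: measurable_completion)
  have mf: "?f \<in> borel_measurable lebesgue"
    by (rule lebesgue_measurable_cong_AE[OF ml ae])
  show "integrable lebesgue ?f"
    using integrable_cong_AE[OF mf ml ae] i m by (simp add: integrable_completion)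
  have "integral\<^sup>L lebesgue ?f = integral\<^sup>L lborel ?g"
    using integral_cong_AE[OF mf ml ae] m by (simp add: integral_completion)
  also have "\<dots> = integral\<^sup>L lborel g"
    using lborel_pair.integral_product_swap[of g] g(1) by (simp add: lborel_prod case_prod_unfold borel_prod)
  finally show "integral\<^sup>L lebesgue ?f = integral\<^sup>L lebesgue f"
    using fg by simp
qed

lemma lebesgue_integral_tensor:
  fixes f :: "'a :: euclidean_space \<Rightarrow> complex" and g :: "'b :: euclidean_space \<Rightarrow> complex"
  assumes f: "integrable lebesgue f" and g: "integrable lebesgue g"
  shows "integrable lebesgue (\<lambda>z. f (fst z) * g (snd z))"
    and "(\<integral>z. f (fst z) * g (snd z) \<partial>lebesgue) = (\<integral>x. f x \<partial>lebesgue) * (\<integral>x. g x \<partial>lebesgue)"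
proof -
  obtain f' where f': "f' \<in> borel_measurable borel" "AE z in lborel. f z = f' z" "integrable lborel f'"
    using integrable_lebesgue_borel[OF f] by blast
  obtain g' where g': "g' \<in> borel_measurable borel" "AE z in lborel. g z = g' z" "integrable lborel g'"
    using integrable_lebesgue_borel[OF g] by blast
  note [measurable] = f'(1) g'(1)
  let ?h = "\<lambda>z. f (fst z) * g (snd z)" and ?h' = "\<lambda>z. f' (fst z) * g' (snd z)"
  have [measurable]: "?h' \<in> borel_measurable (borel \<Otimes>\<^sub>M borel)"
    by measurable
  have "integrable (lborel \<Otimes>\<^sub>M lborel) ?h'"
    using f'(3) g'(3) by (intro lborel_pair.Fubini_integrable) (auto simp: norm_mult)
  then have ih': "integrable lborel ?h'"
    by (simp add: lborel_prod)
  have ml: "?h' \<in> borel_measurable lebesgue"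
    using ih' by (intro measurable_completion) auto
  have ae: "AE z in lebesgue. ?h z = ?h' z"
    using AE_lborel_fst_snd(1)[OF f'(2)] AE_lborel_fst_snd(2)[OF g'(2)] unfolding AE_lebesgue_iff
    by eventually_elim simp
  have mf: "?h \<in> borel_measurable lebesgue"
    by (rule lebesgue_measurable_cong_AE[OF ml ae])
  show i: "integrable lebesgue ?h"
    using integrable_cong_AE[OF mf ml ae] ih' by (subst (asm) (2) integrable_completion) auto
  show "(\<integral>z. ?h z \<partial>lebesgue) = (\<integral>x. f x \<partial>lebesgue) * (\<integral>x. g x \<partial>lebesgue)"
    using lebesgue_Fubini(3)[OF i] by simp
qed

lemma lebesgue_integral_tensor_real:
  fixes f :: "'a :: euclidean_space \<Rightarrow> real" and g :: "'b :: euclidean_space \<Rightarrow> real"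
  assumes f: "integrable lebesgue f" and g: "integrable lebesgue g"
  shows "integrable lebesgue (\<lambda>z. f (fst z) * g (snd z))"
    and "(\<integral>z. f (fst z) * g (snd z) \<partial>lebesgue) = (\<integral>x. f x \<partial>lebesgue) * (\<integral>x. g x \<partial>lebesgue)"
proof -
  have c: "integrable lebesgue (\<lambda>x. complex_of_real (f x))" "integrable lebesgue (\<lambda>x. complex_of_real (g x))"
    using f g by auto
  show i: "integrable lebesgue (\<lambda>z. f (fst z) * g (snd z))"
    using integrable_Re[OF lebesgue_integral_tensor(1)[OF c]] by simp
  have "complex_of_real (\<integral>z. f (fst z) * g (snd z) \<partial>lebesgue) 
    = complex_of_real ((\<integral>x. f x \<partial>lebesgue) * (\<integral>x. g x \<partial>lebesgue))"
    using lebesgue_integral_tensor(2)[OF c] 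
    by (simp flip: of_real_mult)
  then show "(\<integral>z. f (fst z) * g (snd z) \<partial>lebesgue) = (\<integral>x. f x \<partial>lebesgue) * (\<integral>x. g x \<partial>lebesgue)"
    using of_real_eq_iff by blast
qed

section \<open>Square-integrable functions\<close>

lemma cinner_add_right: "cinner x (y + z) = cinner x y + cinner x z"
  for x :: "'h :: complex_inner"
  by (metis cinner_add_left cinner_commute complex_cnj_add)

lemma cinner_scaleC_right: "cinner x (c *\<^sub>C y) = cnj c * cinner x y"
  for x :: "'h :: complex_inner"
  by (metis cinner_commute cinner_scaleC_left complex_cnj_mult)

lemma cinner_zero_left [simp]: "cinner 0 x = 0" for x :: "'h :: complex_inner"
  using cinner_scaleC_left[of 0 0 x] by simp

lemma cinner_zero_right [simp]: "cinner x 0 = 0" for x :: "'h :: complex_inner"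
  using cinner_scaleC_right[of x 0 0] by simp

lemma cinner_minus_left: "cinner (- x) y = - cinner x y" for x :: "'h :: complex_inner"
  using cinner_scaleC_left[of "-1" x y] by (simp add: complex_vector.scale_minus_left scaleC_one)

lemma cinner_diff_left: "cinner (x - y) z = cinner x z - cinner y z" for x :: "'h :: complex_inner"
  using cinner_add_left[of x "- y" z] by (simp add: cinner_minus_left)

lemma cinner_diff_right: "cinner x (y - z) = cinner x y - cinner x z" for x :: "'h :: complex_inner"
  by (metis cinner_diff_left cinner_commute complex_cnj_diff)

lemma cinner_sum_left: "cinner (\<Sum>i\<in>I. f i) x = (\<Sum>i\<in>I. cinner (f i) x)"
  for x :: "'h :: complex_inner"
  by (induction I rule: infinite_finite_induct) (auto simp: cinner_add_left)

lemma cinner_sum_right: "cinner x (\<Sum>i\<in>I. f i) = (\<Sum>i\<in>I. cinner x (f i))"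
  for x :: "'h :: complex_inner"
  by (induction I rule: infinite_finite_induct) (auto simp: cinner_add_right)

lemma cinner_self_real: "cinner x x = of_real (Re (cinner x x))"
  for x :: "'h :: complex_inner"
  using cinner_commute[of x x] by (simp add: complex_eq_iff)

lemma Re_cinner_commute: "Re (cinner x y) = Re (cinner y x)" for x :: "'h :: complex_inner"
  by (metis cinner_commute cnj.simps(1))

lemma cinner_Cauchy_Schwarz:
  "(cmod (cinner x y))\<^sup>2 \<le> Re (cinner x x) * Re (cinner y y)" for x :: "'h :: complex_inner"
proof (cases "y = 0")
  case False
  define r where "r = Re (cinner y y)"
  define c where "c = cinner x y"
  have r: "r > 0"
    using False cinner_ge_zero[of y] Re_cinner_self_eq_0_iff[of y] by (simp add: r_def)
  have yy: "cinner y y = of_real r"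
    unfolding r_def by (rule cinner_self_real)
  have yx: "cinner y x = cnj c"
    unfolding c_def by (rule cinner_commute)
  have cc: "c * cnj c = of_real ((cmod c)\<^sup>2)"
    by (rule complex_norm_square[symmetric])
  have "cinner (x - (c / r) *\<^sub>C y) (x - (c / r) *\<^sub>C y) = cinner x x - (c * cnj c) / r"
    using r by (simp add: cinner_diff_left cinner_diff_right cinner_scaleC_left cinner_scaleC_right
        yy yx c_def[symmetric] field_simps)
  also have "\<dots> = cinner x x - of_real ((cmod c)\<^sup>2 / r)"
    by (simp add: cc)
  finally have "0 \<le> Re (cinner x x) - (cmod c)\<^sup>2 / r"
    using cinner_ge_zero[of "x - (c / r) *\<^sub>C y"] by simp
  then show ?thesis
    using r by (simp add: field_simps c_def r_def)
qed simp

text \<open>Linearity is verified later through the single combination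
  \<open>c *\<^sub>C f + g\<close>; sums and multiples are split off here.\<close>

lemma linear_on_subspace:
  fixes T :: "'h :: complex_inner \<Rightarrow> 'k :: complex_inner"
  assumes D: "0 \<in> D" "\<And>c f g. f \<in> D \<Longrightarrow> g \<in> D \<Longrightarrow> c *\<^sub>C f + g \<in> D"
    and T: "\<And>c f g. f \<in> D \<Longrightarrow> g \<in> D \<Longrightarrow> T (c *\<^sub>C f + g) = c *\<^sub>C T f + T g"
  shows "T 0 = 0"
    and "f \<in> D \<Longrightarrow> g \<in> D \<Longrightarrow> f + g \<in> D \<and> T (f + g) = T f + T g"
    and "f \<in> D \<Longrightarrow> c *\<^sub>C f \<in> D \<and> T (c *\<^sub>C f) = c *\<^sub>C T f"
proof -
  show T0: "T 0 = 0"
    using T[OF D(1) D(1), of 1] by (simp add: scaleC_one)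
  show "f + g \<in> D \<and> T (f + g) = T f + T g" if "f \<in> D" "g \<in> D"
    using D(2)[OF that, of 1] T[OF that, of 1] by (simp add: scaleC_one)
  show "c *\<^sub>C f \<in> D \<and> T (c *\<^sub>C f) = c *\<^sub>C T f" if "f \<in> D"
    using D(2)[OF that D(1), of c] T[OF that D(1), of c] T0 by simp
qed

lemma square_integrable_cong_AE:
  assumes "square_integrable g" "AE x in lebesgue. f x = g x"
  shows "square_integrable f"
proof -
  have m: "f \<in> borel_measurable lebesgue"
    using assms by (auto simp: square_integrable_def intro: lebesgue_measurable_cong_AE)
  moreover have "integrable lebesgue (\<lambda>x. (cmod (g x))\<^sup>2)"
    using assms by (auto simp: square_integrable_def)
  ultimately show ?thesis
    using assms unfolding square_integrable_def
    by (auto intro: integrable_cong_AE_imp elim: eventually_mono)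
qed

lemma square_integrable_bounded_mult:
  assumes "square_integrable f" "g \<in> borel_measurable lebesgue"
    and "AE x in lebesgue. cmod (g x) \<le> B"
  shows "square_integrable (\<lambda>x. g x * f x)"
proof -
  have [measurable]: "f \<in> borel_measurable lebesgue" "g \<in> borel_measurable lebesgue"
    using assms by (auto simp: square_integrable_def)
  have "integrable lebesgue (\<lambda>x. B\<^sup>2 * (cmod (f x))\<^sup>2)"
    using assms by (auto simp: square_integrable_def)
  moreover have "(\<lambda>x. (cmod (g x * f x))\<^sup>2) \<in> borel_measurable lebesgue"
    by measurable
  moreover have "AE x in lebesgue. norm ((cmod (g x * f x))\<^sup>2) \<le> norm (B\<^sup>2 * (cmod (f x))\<^sup>2)"
    using assms(3)
    by eventually_elim (auto simp: norm_mult power_mult_distrib intro!: mult_right_mono power_mono)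
  ultimately have "integrable lebesgue (\<lambda>x. (cmod (g x * f x))\<^sup>2)"
    by (rule Bochner_Integration.integrable_bound)
  then show ?thesis
    by (simp add: square_integrable_def)
qed

lemma square_integrable_cnj: "square_integrable f \<Longrightarrow> square_integrable (\<lambda>x. cnj (f x))"
  unfolding square_integrable_def by (auto intro!: borel_measurable_continuous_on[of cnj] continuous_intros)

lemma square_integrable_tensor:
  assumes "square_integrable f" "square_integrable g"
  shows "square_integrable (\<lambda>z. f (fst z) * g (snd z))"
proof -
  have [measurable]: "f \<in> borel_measurable lebesgue" "g \<in> borel_measurable lebesgue"
    using assms by (auto simp: square_integrable_def)
  have "integrable lebesgue (\<lambda>z. (cmod (f (fst z)))\<^sup>2 * (cmod (g (snd z)))\<^sup>2)"
    using assms by (intro lebesgue_integral_tensor_real(1)) (auto simp: square_integrable_def)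
  then show ?thesis
    by (simp add: square_integrable_def norm_mult power_mult_distrib)
qed

lemma square_integrable_tensor_swap:
  assumes "square_integrable f" "square_integrable g"
  shows "square_integrable (\<lambda>z. f (snd z) * g (fst z))"
  using square_integrable_tensor[OF assms(2,1)] by (simp add: mult.commute)

lemma integral_tensor_norm_square:
  assumes "square_integrable f" "square_integrable g"
  shows "(\<integral>z. (cmod (f (fst z) * g (snd z)))\<^sup>2 \<partial>lebesgue)
    = (\<integral>x. (cmod (f x))\<^sup>2 \<partial>lebesgue) * (\<integral>x. (cmod (g x))\<^sup>2 \<partial>lebesgue)"
  using assms lebesgue_integral_tensor_real(2)[of "\<lambda>x. (cmod (f x))\<^sup>2" "\<lambda>x. (cmod (g x))\<^sup>2"]
  by (simp add: square_integrable_def norm_mult power_mult_distrib)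


section \<open>Computing in \<open>L2\<close> through representatives\<close>

lemma square_integrable_rep_L2 [simp, intro]: "square_integrable (rep_L2 f)"
  using Quotient_rep_reflp[OF Quotient_L2, of f] by (simp add: L2_rel_def)

lemma rep_abs_L2: "square_integrable F \<Longrightarrow> AE x in lebesgue. rep_L2 (abs_L2 F) x = F x"
  using Quotient_rep_abs[OF Quotient_L2, of F] by (simp add: L2_rel_def)

lemma abs_rep_L2 [simp]: "abs_L2 (rep_L2 f) = f"
  by (rule Quotient_abs_rep[OF Quotient_L2])

lemma abs_L2_cong:
  "square_integrable G \<Longrightarrow> AE x in lebesgue. F x = G x \<Longrightarrow> abs_L2 F = abs_L2 G"
  using square_integrable_cong_AE[of G F]
  by (intro Quotient_rel_abs[OF Quotient_L2]) (simp add: L2_rel_def)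

lemma cinner_L2_rep: "cinner f g = (\<integral>x. rep_L2 f x * cnj (rep_L2 g x) \<partial>lebesgue)"
  by (simp add: cinner_L2_def)

lemma abs_L2_add:
  assumes "square_integrable F" "square_integrable G"
  shows "abs_L2 F + abs_L2 G = abs_L2 (\<lambda>x. F x + G x)"
  unfolding plus_L2_def map_fun_def comp_def id_def
  by (rule abs_L2_cong[OF square_integrable_add[OF assms] ae_eq_add])
    (use assms in \<open>auto intro: rep_abs_L2\<close>)

lemma abs_L2_scaleC:
  assumes "square_integrable F"
  shows "c *\<^sub>C abs_L2 F = abs_L2 (\<lambda>x. c * F x)"
  unfolding scaleC_L2_def map_fun_def comp_def id_def
  by (rule abs_L2_cong[OF square_integrable_scale[OF assms] ae_eq_scale])
    (use assms in \<open>auto intro: rep_abs_L2\<close>)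

lemma linear_rep_L2: "c *\<^sub>C f + g = abs_L2 (\<lambda>x. c * rep_L2 f x + rep_L2 g x)"
  using abs_L2_add[OF square_integrable_scale[of "rep_L2 f" c] square_integrable_rep_L2[of g]]
    abs_L2_scaleC[of "rep_L2 f" c] by simp

lemma abs_L2_zero: "abs_L2 (\<lambda>x. 0) = 0"
  by (simp add: zero_L2_def)

lemma cinner_abs_L2:
  assumes "square_integrable F" "square_integrable G"
  shows "cinner (abs_L2 F) (abs_L2 G) = (\<integral>x. F x * cnj (G x) \<partial>lebesgue)"
  unfolding cinner_L2_rep by (rule integral_mult_cnj_cong) (use assms in \<open>auto intro: rep_abs_L2\<close>)

lemma integral_Cauchy_Schwarz:
  fixes f g :: "'a :: euclidean_space \<Rightarrow> complex"
  assumes "square_integrable f" "square_integrable g"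
  shows "(cmod (\<integral>x. f x * g x \<partial>lebesgue))\<^sup>2
    \<le> (\<integral>x. (cmod (f x))\<^sup>2 \<partial>lebesgue) * (\<integral>x. (cmod (g x))\<^sup>2 \<partial>lebesgue)"
proof -
  note g = square_integrable_cnj[OF assms(2)]
  show ?thesis
    using cinner_Cauchy_Schwarz[of "abs_L2 f" "abs_L2 (\<lambda>x. cnj (g x))"]
    by (simp add: cinner_abs_L2 assms g integral_mult_cnj_self del: complex_cnj_cnj)
      (simp add: integral_mult_cnj_self[of _ "\<lambda>x. cnj (g x)", simplified])
qed

lemma integral_norm_Cauchy_Schwarz:
  fixes f g :: "'a :: euclidean_space \<Rightarrow> complex"
  assumes "square_integrable f" "square_integrable g"
  shows "(\<integral>x. cmod (f x) * cmod (g x) \<partial>lebesgue)\<^sup>2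
    \<le> (\<integral>x. (cmod (f x))\<^sup>2 \<partial>lebesgue) * (\<integral>x. (cmod (g x))\<^sup>2 \<partial>lebesgue)"
proof -
  have "square_integrable (\<lambda>x. of_real (cmod (f x)))"
    "square_integrable (\<lambda>x. of_real (cmod (g x)))"
    using assms by (auto simp: square_integrable_def)
  from integral_Cauchy_Schwarz[OF this] show ?thesis
    by (simp flip: of_real_mult)
qed


section \<open>Computing in \<open>L2_sym\<close> through representatives\<close>

lemma rep_L2_sym_rel: "L2_sym_rel (rep_L2_sym f) (rep_L2_sym f)"
  by (rule Quotient_rep_reflp[OF Quotient_L2_sym])

lemma square_integrable_rep_L2_sym [simp, intro]: "square_integrable (rep_L2_sym f)"
  using rep_L2_sym_rel[of f] by (simp add: L2_sym_rel_def L2_rel_def)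

lemma ae_symmetric_rep_L2_sym [simp, intro]: "ae_symmetric (rep_L2_sym f)"
  using rep_L2_sym_rel[of f] by (simp add: L2_sym_rel_def L2_rel_def)

lemma rep_abs_L2_sym:
  "square_integrable F \<Longrightarrow> ae_symmetric F \<Longrightarrow> AE x in lebesgue. rep_L2_sym (abs_L2_sym F) x = F x"
  using Quotient_rep_abs[OF Quotient_L2_sym, of F] by (simp add: L2_sym_rel_def L2_rel_def)

lemma abs_rep_L2_sym [simp]: "abs_L2_sym (rep_L2_sym f) = f"
  by (rule Quotient_abs_rep[OF Quotient_L2_sym])

lemma ae_symmetric_cong_AE:
  fixes F G :: "'a :: euclidean_space \<times> 'a \<Rightarrow> complex"
  assumes "ae_symmetric G" "AE x in lebesgue. F x = G x"
  shows "ae_symmetric F"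
proof -
  have "AE x in lebesgue. F (snd x, fst x) = G (snd x, fst x)"
    using AE_lborel_swap[of "\<lambda>x. F x = G x"] assms(2) by (simp add: AE_lebesgue_iff)
  then show ?thesis
    using assms unfolding ae_symmetric_def by eventually_elim simp
qed

lemma abs_L2_sym_cong:
  "square_integrable G \<Longrightarrow> ae_symmetric G \<Longrightarrow> AE x in lebesgue. F x = G x \<Longrightarrow> abs_L2_sym F = abs_L2_sym G"
  using square_integrable_cong_AE[of G F] ae_symmetric_cong_AE[of G F]
  by (intro Quotient_rel_abs[OF Quotient_L2_sym]) (simp add: L2_sym_rel_def L2_rel_def)

lemma cinner_L2_sym_rep:
  "cinner f g = (1 / 2) * (\<integral>x. rep_L2_sym f x * cnj (rep_L2_sym g x) \<partial>lebesgue)"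
  by (simp add: cinner_L2_sym_def)

lemma abs_L2_sym_add:
  assumes "square_integrable F" "square_integrable G" "ae_symmetric F" "ae_symmetric G"
  shows "abs_L2_sym F + abs_L2_sym G = abs_L2_sym (\<lambda>x. F x + G x)"
  unfolding plus_L2_sym_def map_fun_def comp_def id_def
  by (rule abs_L2_sym_cong[OF square_integrable_add[OF assms(1,2)] ae_symmetric_add[OF assms(3,4)] ae_eq_add])
    (use assms in \<open>auto intro: rep_abs_L2_sym\<close>)

lemma abs_L2_sym_scaleC:
  assumes "square_integrable F" "ae_symmetric F"
  shows "c *\<^sub>C abs_L2_sym F = abs_L2_sym (\<lambda>x. c * F x)"
  unfolding scaleC_L2_sym_def map_fun_def comp_def id_def
  by (rule abs_L2_sym_cong[OF square_integrable_scale[OF assms(1)] ae_symmetric_scale[OF assms(2)] ae_eq_scale])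
    (use assms in \<open>auto intro: rep_abs_L2_sym\<close>)

lemma linear_rep_L2_sym: "c *\<^sub>C f + g = abs_L2_sym (\<lambda>x. c * rep_L2_sym f x + rep_L2_sym g x)"
  using abs_L2_sym_add[OF square_integrable_scale[of "rep_L2_sym f" c] square_integrable_rep_L2_sym[of g]
      ae_symmetric_scale[of "rep_L2_sym f" c] ae_symmetric_rep_L2_sym[of g]]
    abs_L2_sym_scaleC[of "rep_L2_sym f" c] by simp

lemma abs_L2_sym_zero: "abs_L2_sym (\<lambda>x. 0) = 0"
  by (simp add: zero_L2_sym_def)

lemma ae_symmetric_zero: "ae_symmetric (\<lambda>x. 0)"
  by (simp add: ae_symmetric_def)

lemma cinner_abs_L2_sym:
  assumes "square_integrable F" "square_integrable G" "ae_symmetric F" "ae_symmetric G"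
  shows "cinner (abs_L2_sym F) (abs_L2_sym G) = (1 / 2) * (\<integral>x. F x * cnj (G x) \<partial>lebesgue)"
proof -
  have "(\<integral>x. rep_L2_sym (abs_L2_sym F) x * cnj (rep_L2_sym (abs_L2_sym G) x) \<partial>lebesgue)
    = (\<integral>x. F x * cnj (G x) \<partial>lebesgue)"
    by (rule integral_mult_cnj_cong) (use assms in \<open>auto intro: rep_abs_L2_sym\<close>)
  then show ?thesis
    by (simp add: cinner_L2_sym_rep)
qed

lemma cinner_L2_self: "cinner f f = of_real (\<integral>x. (cmod (rep_L2 f x))\<^sup>2 \<partial>lebesgue)"
  by (simp add: cinner_L2_rep integral_mult_cnj_self)

lemma cinner_L2_sym_self:
  "cinner f f = of_real ((1 / 2) * (\<integral>x. (cmod (rep_L2_sym f x))\<^sup>2 \<partial>lebesgue))"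
  by (simp add: cinner_L2_sym_rep integral_mult_cnj_self)

section \<open>Annihilation, creation and free energy\<close>

lemma integrable_mult_square_integrable:
  "square_integrable f \<Longrightarrow> square_integrable g \<Longrightarrow> integrable lebesgue (\<lambda>x. f x * g x)"
  using integrable_mult_cnj[of f "\<lambda>x. cnj (g x)"] square_integrable_cnj[of g] by simp

text \<open>Fubini for \<open>|H|^2\<close> gives finiteness on almost every slice. Measurability of
  a slice comes from the Borel representative, all of whose slices are Borel.\<close>

lemma square_integrable_slices:
  fixes H :: "'a :: euclidean_space \<times> 'b :: euclidean_space \<Rightarrow> complex"
  assumes "square_integrable H"
  shows "AE x in lebesgue. square_integrable (\<lambda>y. H (x, y))"
proof -
  obtain H' where H': "H' \<in> borel_measurable borel" "AE z in lborel. H z = H' z"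
    using lebesgue_measurable_imp_borel_AE_eq[of H] assms by (auto simp: square_integrable_def)
  have [measurable]: "H' \<in> borel_measurable (borel \<Otimes>\<^sub>M borel)"
    using H'(1) by (simp add: borel_prod)
  have m: "(\<lambda>y. H' (x, y)) \<in> borel_measurable lebesgue" for x
    by (intro measurable_completion) measurable
  have ae: "AE x in lebesgue. AE y in lebesgue. H (x, y) = H' (x, y)"
    using H'(2) by (intro AE_lebesgue_slices) (simp add: AE_lebesgue_iff)
  have "integrable lebesgue (\<lambda>z. complex_of_real ((cmod (H z))\<^sup>2))"
    using assms by (auto simp: square_integrable_def simp del: of_real_power)
  from lebesgue_Fubini(1)[OF this]
  have "AE x in lebesgue. integrable lebesgue (\<lambda>y. complex_of_real ((cmod (H (x, y)))\<^sup>2))" .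
  then show ?thesis
    using ae
  proof eventually_elim
    case (elim x)
    then have "(\<lambda>y. H (x, y)) \<in> borel_measurable lebesgue"
      using m by (intro lebesgue_measurable_cong_AE[OF m]) 
    then show ?case
      using integrable_Re[OF elim(1)] by (simp add: square_integrable_def)
  qed
qed

text \<open>Cauchy-Schwarz on each slice bounds the square of the inner integral by the slice norm
  of \<open>H\<close> times the norm of \<open>l\<close>, and Fubini integrates the slice norms.
  Thus the annihilation term of the Hamiltonian is an \<open>L2\<close> function.\<close>

lemma square_integrable_partial_integral:
  fixes H :: "'a :: euclidean_space \<times> 'b :: euclidean_space \<Rightarrow> complex"
  assumes H: "square_integrable H" and l: "square_integrable l"
  shows "square_integrable (\<lambda>x. \<integral>y. H (x, y) * l y \<partial>lebesgue)"
proof -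
  obtain H' where H': "H' \<in> borel_measurable borel" "AE z in lborel. H z = H' z"
    using lebesgue_measurable_imp_borel_AE_eq[of H] assms by (auto simp: square_integrable_def)
  obtain l' where l': "l' \<in> borel_measurable borel" "AE z in lborel. l z = l' z"
    using lebesgue_measurable_imp_borel_AE_eq[of l] assms by (auto simp: square_integrable_def)
  have [measurable]: "H' \<in> borel_measurable (borel \<Otimes>\<^sub>M borel)" "l' \<in> borel_measurable borel"
    using H'(1) l'(1) by (simp_all add: borel_prod)
  have ae: "AE x in lebesgue. AE y in lebesgue. H (x, y) = H' (x, y)"
    using H'(2) by (intro AE_lebesgue_slices) (simp add: AE_lebesgue_iff)
  define G where "G = (\<lambda>x. \<integral>y. H' (x, y) * l' y \<partial>lborel)"
  have "G \<in> borel_measurable borel"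
    unfolding G_def by (rule lborel.borel_measurable_lebesgue_integral) measurable
  then have mG: "G \<in> borel_measurable lebesgue"
    by (simp add: measurable_completion)
  have eq: "AE x in lebesgue. (\<integral>y. H (x, y) * l y \<partial>lebesgue) = G x"
    using ae square_integrable_slices[OF H]
  proof eventually_elim
    case (elim x)
    have m: "(\<lambda>y. H' (x, y) * l' y) \<in> borel_measurable borel"
      by measurable
    have "(\<integral>y. H (x, y) * l y \<partial>lebesgue) = (\<integral>y. H' (x, y) * l' y \<partial>lebesgue)"
    proof (rule integral_cong_AE)
      show "(\<lambda>y. H (x, y) * l y) \<in> borel_measurable lebesgue"
        using elim(2) l by (auto simp: square_integrable_def)
      show "(\<lambda>y. H' (x, y) * l' y) \<in> borel_measurable lebesgue"
        using m by (simp add: measurable_completion)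
      have "AE y in lebesgue. l y = l' y"
        using l'(2) by (simp add: AE_lebesgue_iff)
      then show "AE y in lebesgue. H (x, y) * l y = H' (x, y) * l' y"
        using elim(1) by eventually_elim simp
    qed
    then show ?case
      using m by (simp add: G_def integral_completion)
  qed
  have m: "(\<lambda>x. \<integral>y. H (x, y) * l y \<partial>lebesgue) \<in> borel_measurable lebesgue"
    by (rule lebesgue_measurable_cong_AE[OF mG eq])
  have "integrable lebesgue (\<lambda>z. complex_of_real ((cmod (H z))\<^sup>2))"
    using H by (auto simp: square_integrable_def simp del: of_real_power)
  from integrable_Re[OF lebesgue_Fubini(2)[OF this]]
  have "integrable lebesgue (\<lambda>x. (\<integral>y. (cmod (H (x, y)))\<^sup>2 \<partial>lebesgue))"
    by (simp only: integral_complex_of_real Re_complex_of_real)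
  then have "integrable lebesgue (\<lambda>x. (\<integral>y. (cmod (H (x, y)))\<^sup>2 \<partial>lebesgue) * (\<integral>y. (cmod (l y))\<^sup>2 \<partial>lebesgue))"
    by simp
  then have "integrable lebesgue (\<lambda>x. (cmod (\<integral>y. H (x, y) * l y \<partial>lebesgue))\<^sup>2)"
  proof (rule Bochner_Integration.integrable_bound)
    show "(\<lambda>x. (cmod (\<integral>y. H (x, y) * l y \<partial>lebesgue))\<^sup>2) \<in> borel_measurable lebesgue"
      using m by measurable
    show "AE x in lebesgue. norm ((cmod (\<integral>y. H (x, y) * l y \<partial>lebesgue))\<^sup>2)
      \<le> norm ((\<integral>y. (cmod (H (x, y)))\<^sup>2 \<partial>lebesgue) * (\<integral>y. (cmod (l y))\<^sup>2 \<partial>lebesgue))"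
      using square_integrable_slices[OF H]
      by eventually_elim (use l integral_Cauchy_Schwarz in auto)
  qed
  then show ?thesis
    using m by (simp add: square_integrable_def)
qed

definition domain1 :: "('a :: euclidean_space \<Rightarrow> real) \<Rightarrow> 'a L2 set" where
  "domain1 \<omega> = {f. square_integrable (\<lambda>k. of_real (\<omega> k) * rep_L2 f k)}"

definition domain2 :: "('a :: euclidean_space \<Rightarrow> real) \<Rightarrow> 'a L2_sym set" where
  "domain2 \<omega> = {f. square_integrable (\<lambda>z. of_real (\<omega> (fst z) + \<omega> (snd z)) * rep_L2_sym f z)}"

locale boson_field =
  fixes lam :: "'a :: euclidean_space \<Rightarrow> complex" and \<omega> :: "'a \<Rightarrow> real"
  assumes lam: "square_integrable lam"
    and omega_measurable [measurable]: "\<omega> \<in> borel_measurable lebesgue"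
    and omega_nonneg: "\<And>k. \<omega> k \<ge> 0"
begin

text \<open>The conjugate turns the integral of \<open>lam q * g q\<close> into
  \<open>cinner g coupling\<close>, as \<open>cinner\<close> is linear in its first
  argument.\<close>

definition coupling :: "'a L2" where
  "coupling = abs_L2 (\<lambda>k. cnj (lam k))"

abbreviation self_energy :: "real \<Rightarrow> real" where
  "self_energy c \<equiv> \<integral>k. (cmod (lam k))\<^sup>2 / (c + \<omega> k) \<partial>lebesgue"

definition annihilate :: "'a L2_sym \<Rightarrow> 'a L2" where
  "annihilate h = abs_L2 (\<lambda>k. \<integral>q. rep_L2_sym h (k, q) * lam q \<partial>lebesgue)"

definition symm :: "('a \<Rightarrow> complex) \<Rightarrow> ('a \<Rightarrow> complex) \<Rightarrow> 'a \<times> 'a \<Rightarrow> complex" where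
  "symm F G = (\<lambda>z. F (fst z) * G (snd z) + F (snd z) * G (fst z))"

text \<open>The creation operator in the normalisation of the Hamiltonian. Without any square root
  factor it is the adjoint of \<open>annihilate\<close>, thanks to the weight \<open>1 / 2\<close>
  in the inner product of \<open>L2_sym\<close>.\<close>

definition create :: "'a L2 \<Rightarrow> 'a L2_sym" where
  "create g = abs_L2_sym (symm (\<lambda>k. cnj (lam k)) (rep_L2 g))"

text \<open>Meaningful on \<open>domain1 \<omega>\<close>; outside of it the product is not square
  integrable and its class carries no information.\<close>

definition energy1 :: "real \<Rightarrow> 'a L2 \<Rightarrow> 'a L2" where
  "energy1 c f = abs_L2 (\<lambda>k. of_real (c + \<omega> k) * rep_L2 f k)"

definition energy2 :: "real \<Rightarrow> 'a L2_sym \<Rightarrow> 'a L2_sym" where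
  "energy2 c f = abs_L2_sym (\<lambda>z. of_real (c + \<omega> (fst z) + \<omega> (snd z)) * rep_L2_sym f z)"

lemma lam_measurable [measurable]: "lam \<in> borel_measurable lebesgue"
  using lam by (simp add: square_integrable_def)

lemma square_integrable_cnj_lam: "square_integrable (\<lambda>k. cnj (lam k))"
  by (rule square_integrable_cnj[OF lam])

lemma square_integrable_symm:
  "square_integrable F \<Longrightarrow> square_integrable G \<Longrightarrow> square_integrable (symm F G)"
  unfolding symm_def
  by (intro square_integrable_add square_integrable_tensor square_integrable_tensor_swap)

lemma ae_symmetric_symm: "ae_symmetric (symm F G)"
  by (simp add: ae_symmetric_def symm_def)

lemma symm_cong_AE:
  assumes "AE x in lebesgue. F x = F' x" "AE x in lebesgue. G x = G' x"
  shows "AE z in lebesgue. symm F G z = symm F' G' z"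
  using AE_lebesgue_fst_snd(1)[OF assms(1)] AE_lebesgue_fst_snd(2)[OF assms(1)]
    AE_lebesgue_fst_snd(1)[OF assms(2)] AE_lebesgue_fst_snd(2)[OF assms(2)]
  by eventually_elim (simp add: symm_def)

text \<open>Single slices are null in the product, so the choice of representative might seem to
  matter. Two representatives agree almost everywhere on almost every slice, which is enough after
  integration.\<close>

lemma annihilate_abs:
  assumes "square_integrable F" "ae_symmetric F"
  shows "annihilate (abs_L2_sym F) = abs_L2 (\<lambda>k. \<integral>q. F (k, q) * lam q \<partial>lebesgue)"
  unfolding annihilate_def
proof (rule abs_L2_cong)
  show "square_integrable (\<lambda>k. \<integral>q. F (k, q) * lam q \<partial>lebesgue)"
    by (rule square_integrable_partial_integral[OF assms(1) lam])
  have "square_integrable (rep_L2_sym (abs_L2_sym F))"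
    by simp
  from square_integrable_slices[OF this] square_integrable_slices[OF assms(1)]
    AE_lebesgue_slices[OF rep_abs_L2_sym[OF assms]]
  show "AE k in lebesgue. (\<integral>q. rep_L2_sym (abs_L2_sym F) (k, q) * lam q \<partial>lebesgue)
    = (\<integral>q. F (k, q) * lam q \<partial>lebesgue)"
  proof eventually_elim
    case (elim k)
    then show ?case
      by (intro integral_cong_AE) (auto simp: square_integrable_def)
  qed
qed

lemma annihilate_linear: "annihilate (c *\<^sub>C f + g) = c *\<^sub>C annihilate f + annihilate g"
proof -
  let ?I = "\<lambda>h k. \<integral>q. rep_L2_sym h (k, q) * lam q \<partial>lebesgue"
  have I: "square_integrable (?I h)" for h
    by (rule square_integrable_partial_integral[OF square_integrable_rep_L2_sym lam])
  have "annihilate (c *\<^sub>C f + g) = abs_L2 (\<lambda>k. \<integral>q. (c * rep_L2_sym f (k, q) + rep_L2_sym g (k, q)) * lam q \<partial>lebesgue)"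
    unfolding linear_rep_L2_sym
    by (rule annihilate_abs) (simp_all add: square_integrable_add square_integrable_scale ae_symmetric_add ae_symmetric_scale)
  also have "\<dots> = abs_L2 (\<lambda>k. c * ?I f k + ?I g k)"
  proof (rule abs_L2_cong)
    show "square_integrable (\<lambda>k. c * ?I f k + ?I g k)"
      by (intro square_integrable_add square_integrable_scale I)
    from square_integrable_slices[OF square_integrable_rep_L2_sym[of f]]
      square_integrable_slices[OF square_integrable_rep_L2_sym[of g]]
    show "AE k in lebesgue. (\<integral>q. (c * rep_L2_sym f (k, q) + rep_L2_sym g (k, q)) * lam q \<partial>lebesgue) = c * ?I f k + ?I g k"
      by eventually_elim (simp add: distrib_right mult.assoc integrable_mult_square_integrable lam)
  qed
  also have "\<dots> = c *\<^sub>C annihilate f + annihilate g"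
    unfolding annihilate_def by (simp add: abs_L2_scaleC abs_L2_add I square_integrable_scale)
  finally show ?thesis .
qed

lemma create_abs:
  assumes "square_integrable F"
  shows "create (abs_L2 F) = abs_L2_sym (symm (\<lambda>k. cnj (lam k)) F)"
  unfolding create_def
  by (rule abs_L2_sym_cong)
    (auto intro!: square_integrable_symm ae_symmetric_symm symm_cong_AE rep_abs_L2 assms square_integrable_cnj_lam)

lemma create_linear: "create (c *\<^sub>C f + g) = c *\<^sub>C create f + create g"
proof -
  let ?s = "symm (\<lambda>k. cnj (lam k))"
  have s: "square_integrable (?s (rep_L2 h))" for h
    by (intro square_integrable_symm square_integrable_cnj_lam) simp
  have "create (c *\<^sub>C f + g) = abs_L2_sym (?s (\<lambda>k. c * rep_L2 f k + rep_L2 g k))"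
    unfolding linear_rep_L2 by (rule create_abs) (simp add: square_integrable_add square_integrable_scale)
  also have "?s (\<lambda>k. c * rep_L2 f k + rep_L2 g k) = (\<lambda>z. c * ?s (rep_L2 f) z + ?s (rep_L2 g) z)"
    by (auto simp: symm_def algebra_simps)
  also have "abs_L2_sym \<dots> = c *\<^sub>C create f + create g"
    unfolding create_def
    by (simp add: abs_L2_sym_scaleC abs_L2_sym_add s square_integrable_scale ae_symmetric_symm ae_symmetric_scale)
  finally show ?thesis .
qed

text \<open>Exchanging the two variables and using the symmetry of \<open>h\<close> maps one summand
  of \<open>symm F G\<close> to the other.\<close>

lemma integral_mult_symm:
  assumes "square_integrable h" "ae_symmetric h" "square_integrable F" "square_integrable G"
  shows "(\<integral>z. h z * cnj (symm F G z) \<partial>lebesgue) = 2 * (\<integral>z. h z * cnj (G (fst z) * F (snd z)) \<partial>lebesgue)"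
proof -
  have i1: "integrable lebesgue (\<lambda>z. h z * cnj (G (fst z) * F (snd z)))"
    by (intro integrable_mult_cnj square_integrable_tensor assms)
  have i2: "integrable lebesgue (\<lambda>z. h z * cnj (F (fst z) * G (snd z)))"
    by (intro integrable_mult_cnj square_integrable_tensor assms)
  note sw = lebesgue_integral_swap[OF i2]
  have "(\<integral>z. h z * cnj (F (fst z) * G (snd z)) \<partial>lebesgue)
    = (\<integral>z. h (snd z, fst z) * cnj (F (snd z) * G (fst z)) \<partial>lebesgue)"
    using sw(2) by simp
  also have "\<dots> = (\<integral>z. h z * cnj (G (fst z) * F (snd z)) \<partial>lebesgue)"
  proof (rule integral_cong_AE)
    show "(\<lambda>z. h (snd z, fst z) * cnj (F (snd z) * G (fst z))) \<in> borel_measurable lebesgue"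
      using sw(1) by (intro borel_measurable_integrable) simp
    show "(\<lambda>z. h z * cnj (G (fst z) * F (snd z))) \<in> borel_measurable lebesgue"
      using i1 by (rule borel_measurable_integrable)
    show "AE z in lebesgue. h (snd z, fst z) * cnj (F (snd z) * G (fst z)) = h z * cnj (G (fst z) * F (snd z))"
      using assms(2) unfolding ae_symmetric_def by eventually_elim simp
  qed
  finally have "(\<integral>z. h z * cnj (F (fst z) * G (snd z)) \<partial>lebesgue)
    = (\<integral>z. h z * cnj (G (fst z) * F (snd z)) \<partial>lebesgue)" .
  moreover have "(\<integral>z. h z * cnj (symm F G z) \<partial>lebesgue) = (\<integral>z. h z * cnj (F (fst z) * G (snd z))
      + h z * cnj (G (fst z) * F (snd z)) \<partial>lebesgue)"
    by (intro Bochner_Integration.integral_cong) (auto simp: symm_def algebra_simps)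
  ultimately show ?thesis
    using i1 i2 by simp
qed

text \<open>Fubini turns the left side into an integral over pairs containing one summand of
  \<open>symm\<close>; \<open>integral_mult_symm\<close> adds the other one, and the weight
  \<open>1 / 2\<close> balances the doubling.\<close>

lemma cinner_annihilate: "cinner (annihilate h) g = cinner h (create g)"
proof -
  let ?h = "rep_L2_sym h" and ?g = "rep_L2 g"
  have h: "square_integrable ?h" "ae_symmetric ?h" and g: "square_integrable ?g"
    by auto
  have i: "integrable lebesgue (\<lambda>z. ?h z * cnj (?g (fst z) * cnj (lam (snd z))))"
    by (intro integrable_mult_cnj square_integrable_tensor h g square_integrable_cnj_lam)
  have "cinner (annihilate h) g = cinner (abs_L2 (\<lambda>k. \<integral>q. ?h (k, q) * lam q \<partial>lebesgue)) (abs_L2 ?g)"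
    by (simp add: annihilate_def)
  also have "\<dots> = (\<integral>k. (\<integral>q. ?h (k, q) * lam q \<partial>lebesgue) * cnj (?g k) \<partial>lebesgue)"
    by (rule cinner_abs_L2) (auto intro: square_integrable_partial_integral lam)
  also have "\<dots> = (\<integral>k. (\<integral>q. ?h (k, q) * cnj (?g (fst (k, q)) * cnj (lam (snd (k, q)))) \<partial>lebesgue) \<partial>lebesgue)"
    by (subst Bochner_Integration.integral_mult_left_zero[symmetric]) (simp add: ac_simps)
  also have "\<dots> = (\<integral>z. ?h z * cnj (?g (fst z) * cnj (lam (snd z))) \<partial>lebesgue)"
    by (rule lebesgue_Fubini(3)[OF i])
  also have "\<dots> = (1 / 2) * (\<integral>z. ?h z * cnj (symm (\<lambda>k. cnj (lam k)) ?g z) \<partial>lebesgue)"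
    by (subst integral_mult_symm[OF h square_integrable_cnj_lam g]) simp
  also have "\<dots> = cinner (abs_L2_sym ?h) (create g)"
    unfolding create_def
    by (rule cinner_abs_L2_sym[symmetric])
      (intro h g square_integrable_symm ae_symmetric_symm square_integrable_cnj_lam)+
  finally show ?thesis
    by simp
qed

lemma square_integrable_energy1:
  assumes "square_integrable F" "square_integrable (\<lambda>k. of_real (\<omega> k) * F k)"
  shows "square_integrable (\<lambda>k. of_real (c + \<omega> k) * F k)"
  using square_integrable_add[OF square_integrable_scale[OF assms(1), of "of_real c"] assms(2)]
  by (simp add: algebra_simps)

lemma square_integrable_energy2:
  assumes "square_integrable F" "square_integrable (\<lambda>z. of_real (\<omega> (fst z) + \<omega> (snd z)) * F z)"
  shows "square_integrable (\<lambda>z. of_real (c + \<omega> (fst z) + \<omega> (snd z)) * F z)"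
  using square_integrable_add[OF square_integrable_scale[OF assms(1), of "of_real c"] assms(2)]
  by (simp add: algebra_simps)

lemma ae_symmetric_energy2:
  assumes "ae_symmetric F"
  shows "ae_symmetric (\<lambda>z. of_real (c + \<omega> (fst z) + \<omega> (snd z)) * F z)"
  using assms unfolding ae_symmetric_def by eventually_elim (simp add: add_ac)

lemma abs_L2_in_domain1_iff:
  assumes "square_integrable F"
  shows "abs_L2 F \<in> domain1 \<omega> \<longleftrightarrow> square_integrable (\<lambda>k. of_real (\<omega> k) * F k)"
proof -
  have "AE k in lebesgue. of_real (\<omega> k) * rep_L2 (abs_L2 F) k = of_real (\<omega> k) * F k"
    using rep_abs_L2[OF assms] by eventually_elim simp
  moreover from this have "AE k in lebesgue. of_real (\<omega> k) * F k = of_real (\<omega> k) * rep_L2 (abs_L2 F) k"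
    by eventually_elim metis
  ultimately show ?thesis
    unfolding domain1_def mem_Collect_eq by (blast intro: square_integrable_cong_AE)
qed

lemma abs_L2_sym_in_domain2_iff:
  assumes "square_integrable F" "ae_symmetric F"
  shows "abs_L2_sym F \<in> domain2 \<omega> \<longleftrightarrow>
    square_integrable (\<lambda>z. of_real (\<omega> (fst z) + \<omega> (snd z)) * F z)"
proof -
  let ?w = "\<lambda>z. of_real (\<omega> (fst z) + \<omega> (snd z))"
  have "AE z in lebesgue. ?w z * rep_L2_sym (abs_L2_sym F) z = ?w z * F z"
    using rep_abs_L2_sym[OF assms] by eventually_elim simp
  moreover from this have "AE z in lebesgue. ?w z * F z = ?w z * rep_L2_sym (abs_L2_sym F) z"
    by eventually_elim metis
  ultimately show ?thesis
    unfolding domain2_def mem_Collect_eq by (blast intro: square_integrable_cong_AE)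
qed

lemma domain1_rep: "f \<in> domain1 \<omega> \<Longrightarrow> square_integrable (\<lambda>k. of_real (c + \<omega> k) * rep_L2 f k)"
  by (rule square_integrable_energy1) (auto simp: domain1_def)

lemma domain2_rep: "f \<in> domain2 \<omega> \<Longrightarrow>
    square_integrable (\<lambda>z. of_real (c + \<omega> (fst z) + \<omega> (snd z)) * rep_L2_sym f z)"
  by (rule square_integrable_energy2) (auto simp: domain2_def)

lemma energy1_abs:
  assumes "square_integrable F" "abs_L2 F \<in> domain1 \<omega>"
  shows "energy1 c (abs_L2 F) = abs_L2 (\<lambda>k. of_real (c + \<omega> k) * F k)"
  unfolding energy1_def
proof (rule abs_L2_cong)
  show "square_integrable (\<lambda>k. of_real (c + \<omega> k) * F k)"
    using assms by (intro square_integrable_energy1) (simp_all add: abs_L2_in_domain1_iff)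
  show "AE k in lebesgue. of_real (c + \<omega> k) * rep_L2 (abs_L2 F) k = of_real (c + \<omega> k) * F k"
    using rep_abs_L2[OF assms(1)] by eventually_elim simp
qed

lemma energy2_abs:
  assumes "square_integrable F" "ae_symmetric F" "abs_L2_sym F \<in> domain2 \<omega>"
  shows "energy2 c (abs_L2_sym F) = abs_L2_sym (\<lambda>z. of_real (c + \<omega> (fst z) + \<omega> (snd z)) * F z)"
  unfolding energy2_def
proof (rule abs_L2_sym_cong)
  show "square_integrable (\<lambda>z. of_real (c + \<omega> (fst z) + \<omega> (snd z)) * F z)"
    using assms by (intro square_integrable_energy2) (simp_all add: abs_L2_sym_in_domain2_iff)
  show "ae_symmetric (\<lambda>z. of_real (c + \<omega> (fst z) + \<omega> (snd z)) * F z)"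
    by (rule ae_symmetric_energy2[OF assms(2)])
  show "AE z in lebesgue. of_real (c + \<omega> (fst z) + \<omega> (snd z)) * rep_L2_sym (abs_L2_sym F) z
      = of_real (c + \<omega> (fst z) + \<omega> (snd z)) * F z"
    using rep_abs_L2_sym[OF assms(1,2)] by eventually_elim simp
qed

lemma zero_in_domains: "0 \<in> domain1 \<omega>" "0 \<in> domain2 \<omega>"
  using abs_L2_in_domain1_iff[OF square_integrable_zero]
    abs_L2_sym_in_domain2_iff[OF square_integrable_zero ae_symmetric_zero]
  by (simp_all add: abs_L2_zero abs_L2_sym_zero square_integrable_zero)

lemma energy1_linear:
  assumes "f \<in> domain1 \<omega>" "g \<in> domain1 \<omega>"
  shows "a *\<^sub>C f + g \<in> domain1 \<omega>" "energy1 c (a *\<^sub>C f + g) = a *\<^sub>C energy1 c f + energy1 c g"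
proof -
  let ?F = "\<lambda>k. a * rep_L2 f k + rep_L2 g k"
  have s: "square_integrable ?F"
    by (simp add: square_integrable_add square_integrable_scale)
  have eq: "of_real (c + \<omega> k) * ?F k
    = a * (of_real (c + \<omega> k) * rep_L2 f k) + of_real (c + \<omega> k) * rep_L2 g k" for c k
    by (simp add: algebra_simps)
  show d: "a *\<^sub>C f + g \<in> domain1 \<omega>"
    unfolding linear_rep_L2 abs_L2_in_domain1_iff[OF s]
    using square_integrable_add[OF square_integrable_scale[OF domain1_rep[OF assms(1), of 0], of a] domain1_rep[OF assms(2), of 0]]
    unfolding eq[symmetric] by simp
  show "energy1 c (a *\<^sub>C f + g) = a *\<^sub>C energy1 c f + energy1 c g"
    unfolding linear_rep_L2[of a f g] energy1_abs[OF s d[unfolded linear_rep_L2]] eq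
    unfolding energy1_def
    by (simp add: abs_L2_scaleC abs_L2_add square_integrable_scale domain1_rep assms del: of_real_add)
qed

lemma energy2_linear:
  assumes "f \<in> domain2 \<omega>" "g \<in> domain2 \<omega>"
  shows "a *\<^sub>C f + g \<in> domain2 \<omega>" "energy2 c (a *\<^sub>C f + g) = a *\<^sub>C energy2 c f + energy2 c g"
proof -
  let ?F = "\<lambda>z. a * rep_L2_sym f z + rep_L2_sym g z"
  let ?w = "\<lambda>c z. of_real (c + \<omega> (fst z) + \<omega> (snd z))"
  have s: "square_integrable ?F" "ae_symmetric ?F"
    by (simp_all add: square_integrable_add square_integrable_scale ae_symmetric_add ae_symmetric_scale)
  have eq: "?w c z * ?F z = a * (?w c z * rep_L2_sym f z) + ?w c z * rep_L2_sym g z" for c z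
    by (simp add: algebra_simps)
  show d: "a *\<^sub>C f + g \<in> domain2 \<omega>"
    unfolding linear_rep_L2_sym abs_L2_sym_in_domain2_iff[OF s]
    using square_integrable_add[OF square_integrable_scale[OF domain2_rep[OF assms(1), of 0], of a] domain2_rep[OF assms(2), of 0]]
    unfolding eq[symmetric] by simp
  show "energy2 c (a *\<^sub>C f + g) = a *\<^sub>C energy2 c f + energy2 c g"
    unfolding linear_rep_L2_sym[of a f g] energy2_abs[OF s d[unfolded linear_rep_L2_sym]] eq
    unfolding energy2_def
    by (simp add: abs_L2_sym_scaleC abs_L2_sym_add square_integrable_scale domain2_rep assms
        ae_symmetric_scale ae_symmetric_energy2 del: of_real_add)
qed

lemma cinner_energy1:
  assumes "f \<in> domain1 \<omega>"
  shows "cinner (energy1 c f) g = (\<integral>k. of_real (c + \<omega> k) * rep_L2 f k * cnj (rep_L2 g k) \<partial>lebesgue)"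
  using cinner_abs_L2[OF domain1_rep[OF assms, of c] square_integrable_rep_L2[of g]]
  by (simp add: energy1_def)

lemma cinner_energy2:
  assumes "f \<in> domain2 \<omega>"
  shows "cinner (energy2 c f) g = (1 / 2) * (\<integral>z. of_real (c + \<omega> (fst z) + \<omega> (snd z)) *
    rep_L2_sym f z * cnj (rep_L2_sym g z) \<partial>lebesgue)"
  using cinner_abs_L2_sym[OF domain2_rep[OF assms, of c] square_integrable_rep_L2_sym[of g]
      ae_symmetric_energy2 ae_symmetric_rep_L2_sym]
  by (simp add: energy2_def)

lemma energy1_symmetric:
  assumes "f \<in> domain1 \<omega>" "g \<in> domain1 \<omega>"
  shows "cinner (energy1 c f) g = cinner f (energy1 c g)"
proof -
  have "cinner (energy1 c f) g = cnj (cinner (energy1 c g) f)"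
    unfolding cinner_energy1[OF assms(1)] cinner_energy1[OF assms(2)]
    by (subst Bochner_Integration.integral_cnj[symmetric]) (simp add: ac_simps)
  then show ?thesis
    by (metis cinner_commute)
qed

lemma energy2_symmetric:
  assumes "f \<in> domain2 \<omega>" "g \<in> domain2 \<omega>"
  shows "cinner (energy2 c f) g = cinner f (energy2 c g)"
proof -
  have "cinner (energy2 c f) g = cnj (cinner (energy2 c g) f)"
    unfolding cinner_energy2[OF assms(1)] cinner_energy2[OF assms(2)] complex_cnj_mult
    by (subst Bochner_Integration.integral_cnj[symmetric]) (simp add: ac_simps)
  then show ?thesis
    by (metis cinner_commute)
qed

lemma in_fock2_domain_iff: "(f0, f1, f2) \<in> fock2_domain \<omega> \<longleftrightarrow> f1 \<in> domain1 \<omega> \<and> f2 \<in> domain2 \<omega>"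
proof -
  have [measurable]: "rep_L2 f1 \<in> borel_measurable lebesgue" "rep_L2_sym f2 \<in> borel_measurable lebesgue"
    using square_integrable_rep_L2[of f1] square_integrable_rep_L2_sym[of f2]
    by (auto simp: square_integrable_def)
  have "(\<lambda>z. of_real (\<omega> (fst z) + \<omega> (snd z)) * rep_L2_sym f2 z) \<in> borel_measurable lebesgue"
    "(\<lambda>k. of_real (\<omega> k) * rep_L2 f1 k) \<in> borel_measurable lebesgue"
    by measurable
  then show ?thesis
    by (simp add: fock2_domain_def domain1_def domain2_def square_integrable_def norm_mult
        power_mult_distrib case_prod_unfold del: of_real_add)
qed

lemma cinner_coupling: "cinner g coupling = (\<integral>q. lam q * rep_L2 g q \<partial>lebesgue)"
  using cinner_abs_L2[OF square_integrable_rep_L2[of g] square_integrable_cnj_lam]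
  by (simp add: coupling_def mult.commute)

lemma spin_boson_component_eq:
  assumes "f1 \<in> domain1 \<omega>" "f2 \<in> domain2 \<omega>"
  shows "spin_boson_component \<epsilon> lam \<omega> \<alpha> s (f0, f1, f2) (g0, g1, g2) =
    (of_real (s * \<epsilon>) * f0 + of_real \<alpha> * cinner g1 coupling,
     energy1 (s * \<epsilon>) f1 + (of_real \<alpha> * g0) *\<^sub>C coupling + of_real \<alpha> *\<^sub>C annihilate g2,
     energy2 (s * \<epsilon>) f2 + of_real \<alpha> *\<^sub>C create g1)"
proof -
  note sp = square_integrable_partial_integral[OF square_integrable_rep_L2_sym lam]
  have 1: "energy1 (s * \<epsilon>) f1 + (of_real \<alpha> * g0) *\<^sub>C coupling + of_real \<alpha> *\<^sub>C annihilate g2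
    = abs_L2 (\<lambda>k. of_real (s * \<epsilon> + \<omega> k) * rep_L2 f1 k
       + of_real \<alpha> * cnj (lam k) * g0
       + of_real \<alpha> * (\<integral>q. rep_L2_sym g2 (k, q) * lam q \<partial>lebesgue))"
    unfolding energy1_def coupling_def annihilate_def
    by (simp add: abs_L2_scaleC abs_L2_add sp square_integrable_scale square_integrable_add 
        square_integrable_cnj_lam domain1_rep assms del: of_real_add)
      (simp add: ac_simps)
  have sy: "square_integrable (symm (\<lambda>k. cnj (lam k)) (rep_L2 g1))"
    by (intro square_integrable_symm square_integrable_cnj_lam) simp
  have 2: "energy2 (s * \<epsilon>) f2 + of_real \<alpha> *\<^sub>C create g1
    = abs_L2_sym (\<lambda>(k1, k2). of_real (s * \<epsilon> + \<omega> k1 + \<omega> k2) * rep_L2_sym f2 (k1, k2)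
       + of_real \<alpha> * cnj (lam k1) * rep_L2 g1 k2
       + of_real \<alpha> * cnj (lam k2) * rep_L2 g1 k1)"
    unfolding energy2_def create_def
    by (simp add: abs_L2_sym_scaleC abs_L2_sym_add sy square_integrable_scale square_integrable_add 
        domain2_rep assms ae_symmetric_symm ae_symmetric_scale ae_symmetric_energy2 case_prod_unfold
        del: of_real_add)
      (simp add: symm_def algebra_simps)
  show ?thesis
    unfolding 1 2 by (simp add: cinner_coupling)
qed

end

section \<open>Counting eigenvalues and spectral subspaces\<close>

text \<open>The map sending \<open>f\<close> to \<open>(cinner f p, cinner f q)\<close> is injective
  on \<open>V\<close>, so it takes a basis of \<open>V\<close> to an independent set in a
  two-dimensional space. In particular the basis is finite, which \<open>cdim\<close> has to
  know.\<close>

lemma cdim_le_2_of_trivial_kernel: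
  fixes V :: "'h :: complex_inner set"
  assumes V: "complex_vector.subspace V"
    and kernel: "\<And>f. f \<in> V \<Longrightarrow> cinner f p = 0 \<Longrightarrow> cinner f q = 0 \<Longrightarrow> f = 0"
  shows "cdim V \<le> 2"
proof -
  define T where "T = (\<lambda>f. (cinner f p, cinner f q))"
  interpret T: Vector_Spaces.linear scaleC scaleC T
    by unfold_locales (auto simp: T_def cinner_add_left cinner_scaleC_left scaleC_prod_def scaleC_complex_def)
  obtain B where B: "B \<subseteq> V" "complex_vector.independent B" "V \<subseteq> complex_vector.span B"
    "card B = complex_vector.dim V"
    using complex_vector.basis_exists[of V] by blast
  have "complex_vector.span B \<subseteq> V"
    using B(1) V by (rule complex_vector.span_minimal)
  then have "inj_on T (complex_vector.span B)"
    unfolding T.inj_on_iff_eq_0[OF complex_vector.subspace_span]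
    using kernel by (auto simp: T_def zero_prod_def)
  then have indep: "complex_vector.independent (T ` B)" and inj: "inj_on T B"
    using T.independent_injective_image[OF B(2)]
    by (auto intro: inj_on_subset[OF _ complex_vector.span_superset])
  have "T ` B \<subseteq> complex_vector.span {(1, 0), (0, 1)}"
  proof
    fix x assume "x \<in> T ` B"
    obtain a b where x: "x = (a, b)" by (cases x)
    have "x = a *\<^sub>C (1, 0) + b *\<^sub>C (0, 1)"
      by (simp add: x scaleC_prod_def scaleC_complex_def)
    then show "x \<in> complex_vector.span {(1, 0), (0, 1)}"
      by (simp only:) (intro complex_vector.span_add complex_vector.span_scale complex_vector.span_base; simp)
  qed
  then have "finite (T ` B) \<and> card (T ` B) \<le> card {(1, 0) :: complex \<times> complex, (0, 1)}"
    using indep by (intro complex_vector.independent_span_bound) auto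
  then have "finite B" "card B \<le> 2"
    using inj by (auto simp: card_image dest: finite_imageD)
  then have "cdim V = enat (card B)"
    using B(3,4) unfolding cdim_def by auto
  then show ?thesis
    using \<open>card B \<le> 2\<close> by (metis enat_ord_simps(1) numeral_eq_enat)
qed

locale symmetric_operator =
  fixes A :: "'h :: complex_inner operator"
  assumes dom_zero: "0 \<in> dom_op A"
    and dom_linear: "\<And>c f g. f \<in> dom_op A \<Longrightarrow> g \<in> dom_op A \<Longrightarrow> c *\<^sub>C f + g \<in> dom_op A"
    and app_linear: "\<And>c f g. f \<in> dom_op A \<Longrightarrow> g \<in> dom_op A \<Longrightarrow>
      app_op A (c *\<^sub>C f + g) = c *\<^sub>C app_op A f + app_op A g"
    and symmetric: "\<And>f g. f \<in> dom_op A \<Longrightarrow> g \<in> dom_op A \<Longrightarrow> cinner (app_op A f) g = cinner f (app_op A g)"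
begin

lemmas op_linear = linear_on_subspace[of "dom_op A" "app_op A", OF dom_zero dom_linear app_linear]

lemma dom_sum: "(\<And>i. i \<in> I \<Longrightarrow> f i \<in> dom_op A) \<Longrightarrow> (\<Sum>i\<in>I. f i) \<in> dom_op A"
  by (induction I rule: infinite_finite_induct) (auto simp: dom_zero op_linear)

lemma app_sum:
  "(\<And>i. i \<in> I \<Longrightarrow> f i \<in> dom_op A) \<Longrightarrow> app_op A (\<Sum>i\<in>I. f i) = (\<Sum>i\<in>I. app_op A (f i))"
  by (induction I rule: infinite_finite_induct) (auto simp: op_linear dom_sum)

lemma subspace_eigenspace: "complex_vector.subspace (eigenspace A z)"
  unfolding complex_vector.subspace_def eigenspace_def
  by (auto simp: dom_zero op_linear scaleC_add_right
      complex_vector.scale_left_commute)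

lemma eigenspace_orthogonal:
  assumes "f \<in> eigenspace A (of_real x)" "g \<in> eigenspace A (of_real y)" "x \<noteq> y"
  shows "cinner f g = 0"
proof -
  have "of_real x * cinner f g = of_real y * cinner f g"
    using symmetric[of f g] assms by (auto simp: eigenspace_def cinner_scaleC_left cinner_scaleC_right)
  then show ?thesis
    using assms(3) by simp
qed

lemma sum_cinner_eigenvectors:
  assumes "finite X" "\<And>x. x \<in> X \<Longrightarrow> v x \<in> eigenspace A (of_real x)" "x \<in> X"
  shows "cinner (v x) (\<Sum>y\<in>X. v y) = cinner (v x) (v x)"
proof -
  have "cinner (v x) (\<Sum>y\<in>X. v y) = (\<Sum>y\<in>X. if y = x then cinner (v x) (v x) else 0)"
    unfolding cinner_sum_right
    by (rule sum.cong) (auto intro: eigenspace_orthogonal[OF assms(2)[OF assms(3)] assms(2)])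
  then show ?thesis
    using assms by simp
qed

text \<open>On the span of these eigenspaces the form lies strictly below \<open>\<tau>\<close>, and
  orthogonally to \<open>p\<close> and \<open>q\<close> it is at least \<open>\<tau>\<close>; both
  can hold only for the zero vector. Eigenspaces are mutually orthogonal, so their bases unite to
  one independent set, whose size is the sum of the multiplicities.\<close>

lemma sum_cdim_eigenspaces_le_2:
  assumes X: "finite X" "\<And>x. x \<in> X \<Longrightarrow> x < \<tau>"
    and fin: "\<And>x. x \<in> X \<Longrightarrow> cdim (eigenspace A (of_real x)) < \<infinity>"
    and bound: "\<And>f. f \<in> dom_op A \<Longrightarrow> cinner f p = 0 \<Longrightarrow> cinner f q = 0 \<Longrightarrow>
      \<tau> * Re (cinner f f) \<le> Re (cinner (app_op A f) f)"
  shows "(\<Sum>x\<in>X. cdim (eigenspace A (of_real x))) \<le> 2"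
proof -
  let ?E = "\<lambda>x. eigenspace A (of_real x)"
  have "\<exists>B. \<forall>x\<in>X. finite (B x) \<and> B x \<subseteq> ?E x \<and> complex_vector.independent (B x) \<and>
    cdim (?E x) = enat (card (B x))"
  proof (rule bchoice, rule ballI)
    fix x assume x: "x \<in> X"
    obtain C where C: "finite C" "?E x \<subseteq> complex_vector.span C"
      using fin[OF x] by (auto simp: cdim_def split: if_splits)
    then have dim: "cdim (?E x) = enat (complex_vector.dim (?E x))"
      by (auto simp: cdim_def)
    obtain B where B: "B \<subseteq> ?E x" "complex_vector.independent B" "?E x \<subseteq> complex_vector.span B"
      "card B = complex_vector.dim (?E x)"
      by (rule complex_vector.basis_exists)
    have "finite B"
      using complex_vector.independent_span_bound[OF C(1) B(2)] B(1) C(2) by auto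
    then show "\<exists>B. finite B \<and> B \<subseteq> ?E x \<and> complex_vector.independent B \<and> cdim (?E x) = enat (card B)"
      using B dim by auto
  qed
  then obtain B where BX: "\<forall>x\<in>X. finite (B x) \<and> B x \<subseteq> ?E x \<and> complex_vector.independent (B x) \<and>
    cdim (?E x) = enat (card (B x))" ..
  then have B: "\<And>x. x \<in> X \<Longrightarrow> finite (B x)" "\<And>x. x \<in> X \<Longrightarrow> B x \<subseteq> ?E x"
    "\<And>x. x \<in> X \<Longrightarrow> complex_vector.independent (B x)"
    "\<And>x. x \<in> X \<Longrightarrow> cdim (?E x) = enat (card (B x))"
    by blast+
  define U where "U = (\<Union>x\<in>X. B x)"
  have finU: "finite U"
    using X(1) B(1) by (simp add: U_def)
  \<comment> \<open>A vector common to two eigenspaces is orthogonal to itself, whereas basis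
    vectors are nonzero.\<close>
  have disj: "B x \<inter> B y = {}" if "x \<in> X" "y \<in> X" "x \<noteq> y" for x y
  proof -
    have "False" if "b \<in> B x" "b \<in> B y" for b
    proof -
      have "cinner b b = 0"
        using eigenspace_orthogonal[of b x b y] B(2) that \<open>x \<in> X\<close> \<open>y \<in> X\<close> \<open>x \<noteq> y\<close> by auto
      then have "b = 0"
        by (simp add: cinner_eq_zero_iff)
      then show False
        using B(3)[OF \<open>x \<in> X\<close>] that(1) complex_vector.dependent_zero by auto
    qed
    then show ?thesis
      by auto
  qed
  have decompose: "(\<Sum>b\<in>U. u b *\<^sub>C b) = (\<Sum>x\<in>X. \<Sum>b\<in>B x. u b *\<^sub>C b)" for u
    unfolding U_def by (rule sum.UNION_disjoint) (use X(1) B(1) disj in auto)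
  have comp: "(\<Sum>b\<in>B x. u b *\<^sub>C b) \<in> ?E x" if "x \<in> X" for u x
    using B(2)[OF that] by (intro complex_vector.subspace_sum[OF subspace_eigenspace]
        complex_vector.subspace_scale[OF subspace_eigenspace]) auto
  have indep: "complex_vector.independent U"
  proof (rule complex_vector.independent_if_scalars_zero[OF finU])
    fix u b assume s: "(\<Sum>b\<in>U. u b *\<^sub>C b) = 0" and b: "b \<in> U"
    obtain x where x: "x \<in> X" "b \<in> B x"
      using b by (auto simp: U_def)
    define v where "v = (\<lambda>x. \<Sum>b\<in>B x. u b *\<^sub>C b)"
    \<comment> \<open>Pairing the vanishing combination with one eigencomponent isolates that
      component; independence inside the eigenspace then kills its coefficients.\<close>
    have "cinner (v x) (\<Sum>y\<in>X. v y) = cinner (v x) (v x)"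
      by (rule sum_cinner_eigenvectors) (use X(1) x(1) comp in \<open>auto simp: v_def\<close>)
    moreover have "(\<Sum>y\<in>X. v y) = 0"
      using s by (simp add: v_def decompose)
    ultimately have "v x = 0"
      by (simp add: cinner_eq_zero_iff)
    then show "u b = 0"
      using complex_vector.independentD[OF B(3)[OF x(1)] B(1)[OF x(1)] order_refl, of u b] x(2)
      by (simp add: v_def)
  qed
  have "f = 0" if f: "f \<in> complex_vector.span U" "cinner f p = 0" "cinner f q = 0" for f
  proof -
    obtain u where u: "f = (\<Sum>b\<in>U. u b *\<^sub>C b)"
      using f(1) finU by (auto simp: complex_vector.span_finite)
    define v where "v = (\<lambda>x. \<Sum>b\<in>B x. u b *\<^sub>C b)"
    have v: "v x \<in> ?E x" if "x \<in> X" for x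
      unfolding v_def by (rule comp[OF that])
    have fv: "f = (\<Sum>x\<in>X. v x)"
      by (simp add: u decompose v_def)
    have vf: "cinner (v x) f = cinner (v x) (v x)" if "x \<in> X" for x
      unfolding fv by (rule sum_cinner_eigenvectors[OF X(1) v that])
    have dom: "f \<in> dom_op A"
      unfolding fv by (rule dom_sum) (use v in \<open>auto simp: eigenspace_def\<close>)
    have "app_op A f = (\<Sum>x\<in>X. app_op A (v x))"
      unfolding fv by (rule app_sum) (use v in \<open>auto simp: eigenspace_def\<close>)
    also have "\<dots> = (\<Sum>x\<in>X. of_real x *\<^sub>C v x)"
      by (rule sum.cong) (use v in \<open>auto simp: eigenspace_def\<close>)
    finally have "Re (cinner (app_op A f) f) = (\<Sum>x\<in>X. x * Re (cinner (v x) (v x)))"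
      by (simp add: cinner_sum_left cinner_scaleC_left vf)
    moreover have "Re (cinner f f) = (\<Sum>x\<in>X. Re (cinner (v x) (v x)))"
      by (subst (1) fv) (simp add: cinner_sum_left vf)
    \<comment> \<open>Every summand is nonnegative with a positive factor \<open>\<tau> - x\<close>,
      so this inequality forces all eigencomponents to vanish.\<close>
    ultimately have le: "(\<Sum>x\<in>X. (\<tau> - x) * Re (cinner (v x) (v x))) \<le> 0"
      using bound[OF dom f(2,3)] by (simp add: left_diff_distrib sum_subtractf sum_distrib_left)
    have nn: "0 \<le> (\<tau> - x) * Re (cinner (v x) (v x))" if "x \<in> X" for x
      using X(2)[OF that] cinner_ge_zero[of "v x"] by simp
    have "v x = 0" if "x \<in> X" for x
    proof -
      have "(\<Sum>x\<in>X. (\<tau> - x) * Re (cinner (v x) (v x))) = 0"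
        using le nn by (meson antisym sum_nonneg)
      then have "(\<tau> - x) * Re (cinner (v x) (v x)) = 0"
        using sum_nonneg_eq_0_iff[OF X(1), of "\<lambda>x. (\<tau> - x) * Re (cinner (v x) (v x))"] nn that by simp
      then show ?thesis
        using X(2)[OF that] by (simp add: Re_cinner_self_eq_0_iff)
    qed
    then show ?thesis
      by (simp add: fv)
  qed
  then have "cdim (complex_vector.span U) \<le> 2"
    by (intro cdim_le_2_of_trivial_kernel[of _ p q]) (auto simp: complex_vector.subspace_span)
  moreover have "cdim (complex_vector.span U) = enat (card U)"
    using finU complex_vector.dim_span_eq_card_independent[OF indep] by (auto simp: cdim_def)
  moreover have "card U = (\<Sum>x\<in>X. card (B x))"
    unfolding U_def by (rule card_UN_disjoint) (use X(1) B(1) disj in auto)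
  moreover have "(\<Sum>x\<in>X. cdim (?E x)) = (\<Sum>x\<in>X. enat (card (B x)))"
    using B(4) by simp
  moreover have "\<dots> = enat (\<Sum>x\<in>X. card (B x))"
    by (induction X rule: infinite_finite_induct) (auto simp: zero_enat_def)
  ultimately show ?thesis
    by simp
qed

lemma num_bound_states_le_2:
  assumes "ess_bottom A \<le> ereal \<tau>"
    and bound: "\<And>f. f \<in> dom_op A \<Longrightarrow> cinner f p = 0 \<Longrightarrow> cinner f q = 0 \<Longrightarrow>
      \<tau> * Re (cinner f f) \<le> Re (cinner (app_op A f) f)"
  shows "num_bound_states A \<le> 2"
  unfolding num_bound_states_def
proof (rule SUP_least, clarify)
  fix X assume X: "finite X" "X \<subseteq> bound_state_energies A"
  show "(\<Sum>x\<in>X. cdim (eigenspace A (of_real x))) \<le> 2"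
  proof (rule sum_cdim_eigenspaces_le_2[OF X(1) _ _ bound])
    fix x assume "x \<in> X"
    then have x: "of_real x \<in> discrete_spectrum A" "ereal x < ess_bottom A"
      using X(2) by (auto simp: bound_state_energies_def)
    show "cdim (eigenspace A (of_real x)) < \<infinity>"
      using x(1) by (auto simp: discrete_spectrum_def)
    show "x < \<tau>"
      using less_le_trans[OF x(2) assms(1)] by simp
  qed
qed

end


section \<open>Projection-valued measures and their scalar measures\<close>

context
  fixes E :: "real set \<Rightarrow> 'h :: complex_inner \<Rightarrow> 'h"
  assumes E: "projection_valued_measure E"
begin

lemma pvm_projection: "S \<in> sets borel \<Longrightarrow> orthogonal_projection (E S)"
  using E by (simp add: projection_valued_measure_def)

lemma pvm_Int: "S \<in> sets borel \<Longrightarrow> T \<in> sets borel \<Longrightarrow> E S (E T f) = E (S \<inter> T) f"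
  using E by (auto simp: projection_valued_measure_def)

lemma pvm_UNIV: "E UNIV f = f"
  using E by (simp add: projection_valued_measure_def)

lemma pvm_sums:
  "range S \<subseteq> sets borel \<Longrightarrow> disjoint_family S \<Longrightarrow>
    (\<lambda>n. cinner (E (S n) f) f) sums cinner (E (\<Union>n. S n) f) f"
  using E by (simp add: projection_valued_measure_def)

lemma pvm_cinner_self:
  assumes "S \<in> sets borel"
  shows "cinner (E S f) f = cinner (E S f) (E S f)"
  using pvm_projection[OF assms] by (metis orthogonal_projection_def)

lemma pvm_cinner_eq_0_iff: "S \<in> sets borel \<Longrightarrow> cinner (E S f) f = 0 \<longleftrightarrow> E S f = 0"
  by (simp add: pvm_cinner_self cinner_eq_zero_iff)

text \<open>The empty set repeated forever is a disjoint family, and a convergent series with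
  constant terms has zero terms.\<close>

lemma pvm_empty: "E {} f = 0"
proof -
  have "(\<lambda>n. cinner (E {} f) f) sums cinner (E (\<Union>n :: nat. {}) f) f"
    by (rule pvm_sums) (auto simp: disjoint_family_on_def)
  then have "cinner (E {} f) f = 0"
    by (simp add: sums_iff summable_const_iff)
  then show ?thesis
    by (subst (asm) pvm_cinner_eq_0_iff) auto
qed

lemma pvm_disjoint:
  "S \<in> sets borel \<Longrightarrow> T \<in> sets borel \<Longrightarrow> E T f = f \<Longrightarrow> S \<inter> T = {} \<Longrightarrow> E S f = 0"
  by (metis pvm_Int pvm_empty)

lemma space_scalar_measure: "space (scalar_measure E f) = UNIV"
  by (simp add: scalar_measure_def space_measure_of_conv)

lemma sets_scalar_measure [measurable_cong]: "sets (scalar_measure E f) = sets borel"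
  unfolding scalar_measure_def
  using sets.sigma_sets_eq[of "borel :: real measure"] by (simp add: sets_measure_of_conv)

text \<open>\<open>measure_of\<close> reproduces the given set function only if that is a measure.
  Nonnegativity comes from \<open>cinner (E S f) f\<close> being a squared norm, additivity from the
  weak additivity of \<open>E\<close>.\<close>

lemma emeasure_scalar_measure:
  assumes "S \<in> sets borel"
  shows "emeasure (scalar_measure E f) S = ennreal (Re (cinner (E S f) f))"
  unfolding scalar_measure_def
proof (rule emeasure_measure_of_sigma)
  show "sigma_algebra UNIV (sets (borel :: real measure))"
    using sets.sigma_algebra_axioms[of "borel :: real measure"] by simp
  show "positive (sets borel) (\<lambda>S. ennreal (Re (cinner (E S f) f)))"
    by (simp add: positive_def pvm_empty)
  show "countably_additive (sets borel) (\<lambda>S. ennreal (Re (cinner (E S f) f)))"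
    unfolding countably_additive_def
  proof clarify
    fix S :: "nat \<Rightarrow> real set" assume S: "range S \<subseteq> sets borel" "disjoint_family S"
    show "(\<Sum>i. ennreal (Re (cinner (E (S i) f) f))) = ennreal (Re (cinner (E (\<Union>i. S i) f) f))"
    proof (rule suminf_ennreal_eq)
      show "0 \<le> Re (cinner (E (S i) f) f)" for i
        using S(1) by (subst pvm_cinner_self) (auto simp: cinner_ge_zero)
      show "(\<lambda>i. Re (cinner (E (S i) f) f)) sums Re (cinner (E (\<Union>i. S i) f) f)"
        by (rule sums_Re[OF pvm_sums[OF S]])
    qed
  qed
qed (fact assms)

lemma finite_measure_scalar_measure: "finite_measure (scalar_measure E f)"
  by standard (simp add: space_scalar_measure emeasure_scalar_measure pvm_UNIV)

lemma measure_scalar_measure_UNIV: "measure (scalar_measure E f) UNIV = Re (cinner f f)"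
  by (simp add: measure_def emeasure_scalar_measure pvm_UNIV cinner_ge_zero)

lemma AE_scalar_measure:
  assumes "S \<in> sets borel" "E (- S) f = 0"
  shows "AE x in scalar_measure E f. x \<in> S"
proof (rule AE_I)
  show "emeasure (scalar_measure E f) (- S) = 0"
    using assms by (subst emeasure_scalar_measure) auto
  show "- S \<in> sets (scalar_measure E f)"
    using assms(1) by (simp add: sets_scalar_measure)
qed auto

end

section \<open>Spectral subspaces of a semibounded operator\<close>

context
  fixes A :: "'h :: complex_inner operator" and E :: "real set \<Rightarrow> 'h \<Rightarrow> 'h"
  assumes AE: "spectral_measure_of A E"
begin

lemma spectral_pvm: "projection_valued_measure E"
  using AE by (simp add: spectral_measure_of_def)

text \<open>Bounded support makes the second moment finite, which is the domain condition of
  \<open>spectral_measure_of\<close>; the quadratic form is then the first moment.\<close>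

lemma spectral_bounded_support:
  assumes S: "S \<in> sets borel" "E (- S) f = 0" "S \<subseteq> {-K..K}"
  shows "f \<in> dom_op A" "integrable (scalar_measure E f) (\<lambda>x. x)"
    "Re (cinner (app_op A f) f) = (\<integral>x. x \<partial>scalar_measure E f)"
proof -
  let ?M = "scalar_measure E f"
  interpret finite_measure ?M
    by (rule finite_measure_scalar_measure[OF spectral_pvm])
  note [measurable_cong] = sets_scalar_measure[OF spectral_pvm]
  have ae: "AE x in ?M. x \<in> S"
    by (rule AE_scalar_measure[OF spectral_pvm S(1,2)])
  have "AE x in ?M. norm x \<le> K"
    using ae by eventually_elim (use subsetD[OF S(3)] in fastforce)
  then show "integrable ?M (\<lambda>x. x)"
    by (rule integrable_const_bound) measurable
  have "AE x in ?M. norm (x\<^sup>2) \<le> K\<^sup>2"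
    using ae
  proof eventually_elim
    case (elim x)
    then have "\<bar>x\<bar> \<le> K" using subsetD[OF S(3)] by fastforce
    then show ?case using power_mono[of "\<bar>x\<bar>" K 2] by simp
  qed
  then have "integrable ?M (\<lambda>x. x\<^sup>2)"
    by (rule integrable_const_bound) measurable
  then have "(\<integral>\<^sup>+ x. ennreal (x\<^sup>2) \<partial>?M) < \<infinity>"
    by (simp add: integrable_iff_bounded)
  then show "f \<in> dom_op A"
    using AE by (simp add: spectral_measure_of_def)
  then show "Re (cinner (app_op A f) f) = (\<integral>x. x \<partial>?M)"
    using AE by (simp add: spectral_measure_of_def)
qed

text \<open>Spectral mass below \<open>- N\<close> would push the form under its lower bound
  \<open>C\<close>. Vectors belonging to the whole half-line need not lie in the domain, so it is
  cut into slabs of length one, where \<open>spectral_bounded_support\<close> applies; countable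
  additivity puts them together again.\<close>

lemma spectral_projection_below_zero:
  assumes semibounded: "\<And>f. f \<in> dom_op A \<Longrightarrow> C * Re (cinner f f) \<le> Re (cinner (app_op A f) f)"
    and N: "- real N < C"
  shows "E {..<- real N} f = 0"
proof -
  note pvm = spectral_pvm
  have slab: "E {- real (Suc n)..<- real n} g = 0" if "N \<le> n" for n g
  proof -
    let ?S = "{- real (Suc n)..<- real n}"
    define f where "f = E ?S g"
    let ?M = "scalar_measure E f"
    interpret finite_measure ?M
      by (rule finite_measure_scalar_measure[OF pvm])
    have "E ?S f = f"
      unfolding f_def by (subst pvm_Int[OF pvm]) auto
    then have 0: "E (- ?S) f = 0"
      by (intro pvm_disjoint[OF pvm, of "- ?S" ?S]) auto
    have S: "?S \<in> sets borel" "?S \<subseteq> {- real (Suc n)..real (Suc n)}"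
      by auto
    note sb = spectral_bounded_support[OF S(1) 0 S(2)]
    have "(\<integral>x. x \<partial>?M) \<le> (\<integral>x. - real n \<partial>?M)"
    proof (rule integral_mono_AE[OF sb(2)])
      show "AE x in ?M. x \<le> - real n"
        using AE_scalar_measure[OF pvm S(1) 0] by eventually_elim auto
    qed auto
    also have "\<dots> = - real n * Re (cinner f f)"
      by (simp add: space_scalar_measure[OF pvm] measure_scalar_measure_UNIV[OF pvm])
    finally have "C * Re (cinner f f) \<le> - real n * Re (cinner f f)"
      using semibounded[OF sb(1)] sb(3) by simp
    then have "(C + real n) * Re (cinner f f) \<le> 0"
      by (simp add: algebra_simps)
    moreover have "0 < C + real n"
      using N that by linarith
    ultimately have "Re (cinner f f) \<le> 0"
      by (simp add: mult_le_0_iff)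
    then have "f = 0"
      using cinner_ge_zero[of f] Re_cinner_self_eq_0_iff[of f] by linarith
    then show ?thesis
      by (simp add: f_def)
  qed
  define S where "S = (\<lambda>i. {- real (Suc (N + i))..<- real (N + i)})"
  have S_borel: "range S \<subseteq> sets borel"
    by (auto simp: S_def)
  have "{..<- real N} = (\<Union>i. S i)"
  proof (intro equalityI subsetI)
    fix x assume x: "x \<in> {..<- real N}"
    \<comment> \<open>Slab \<open>k\<close> consists of the \<open>x\<close> with
      \<open>k < - x \<le> k + 1\<close>, because it is closed on the left only; hence the ceiling
      minus one.\<close>
    define k where "k = nat (\<lceil>- x\<rceil> - 1)"
    have 1: "\<lceil>- x\<rceil> - 1 \<ge> int N"
      using x by (simp add: le_diff_eq ) linarith
    then have k: "real k = of_int \<lceil>- x\<rceil> - 1" "N \<le> k"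
      by (auto simp: k_def)
    have "x \<in> S (k - N)"
      using k x by (simp add: S_def) linarith
    then show "x \<in> (\<Union>i. S i)" by blast
  qed (auto simp: S_def)
  moreover have "disjoint_family S"
    unfolding disjoint_family_on_def S_def
  proof clarify
    fix m n :: nat assume "m \<noteq> n"
    then have "Suc m \<le> n \<or> Suc n \<le> m" by linarith
    then have "real (Suc m) \<le> real n \<or> real (Suc n) \<le> real m" by linarith
    then show "{- real (Suc (N + m))..<- real (N + m)} \<inter> {- real (Suc (N + n))..<- real (N + n)} = {}"
      by auto
  qed
  ultimately have "(\<lambda>i. cinner (E (S i) f) f) sums cinner (E {..<- real N} f) f"
    using pvm_sums[OF pvm, of S f] S_borel by simp
  moreover have "E (S i) f = 0" for i
    unfolding S_def by (rule slab) simp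
  ultimately have "cinner (E {..<- real N} f) f = 0"
    by (simp add: sums_iff)
  then show ?thesis
    by (subst (asm) pvm_cinner_eq_0_iff[OF pvm]) auto
qed

text \<open>The scalar measure of a vector \<open>f\<close> in this subspace lives in a bounded set
  below \<open>\<tau>\<close>, by semiboundedness and \<open>b \<le> \<tau>\<close>; so
  \<open>f\<close> is in the domain. If \<open>f\<close> is also orthogonal to \<open>p\<close> and
  \<open>q\<close>, the form bound makes the integral of the positive function
  \<open>\<tau> - x\<close> nonpositive. Then the measure, and with it \<open>f\<close>, is
  zero.\<close>

lemma cdim_spectral_subspace_le_2:
  assumes semibounded: "\<And>f. f \<in> dom_op A \<Longrightarrow> C * Re (cinner f f) \<le> Re (cinner (app_op A f) f)"
    and bound: "\<And>f. f \<in> dom_op A \<Longrightarrow> cinner f p = 0 \<Longrightarrow> cinner f q = 0 \<Longrightarrow>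
      \<tau> * Re (cinner f f) \<le> Re (cinner (app_op A f) f)"
    and b: "b \<le> ereal \<tau>"
  shows "cdim (range (E {x. ereal x < b})) \<le> 2"
proof (rule cdim_le_2_of_trivial_kernel[of _ p q])
  note pvm = spectral_pvm
  let ?S = "{x. ereal x < b}"
  have S: "?S \<in> sets borel"
    by (cases b) (auto simp: greaterThanLessThan_def lessThan_def[symmetric])
  interpret lin: Vector_Spaces.linear scaleC scaleC "E ?S"
    using pvm_projection[OF pvm S] by (simp add: orthogonal_projection_def)
  show "complex_vector.subspace (range (E ?S))"
    by (rule lin.subspace_image) simp
  obtain N :: nat where N: "- real N < C"
    using reals_Archimedean2[of "- C"] by (metis minus_less_iff)
  fix f assume f: "f \<in> range (E ?S)" "cinner f p = 0" "cinner f q = 0"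
  let ?M = "scalar_measure E f"
  interpret finite_measure ?M
    by (rule finite_measure_scalar_measure[OF pvm])
  have Ef: "E ?S f = f"
    using f(1) S by (auto simp: pvm_Int[OF pvm])
  let ?T = "?S \<inter> {- real N..}"
  have T: "?T \<in> sets borel"
    using S by auto
  have "E (- ?T) f = E (- ?T) (E ?S f)"
    by (simp only: Ef)
  also have "\<dots> = E (- ?T \<inter> ?S) f"
    using S T by (subst pvm_Int[OF pvm]) auto
  also have "- ?T \<inter> ?S = ?S \<inter> {..<- real N}"
    by auto
  also have "E \<dots> f = E ?S (E {..<- real N} f)"
    using S by (subst pvm_Int[OF pvm]) auto
  also have "\<dots> = 0"
    using spectral_projection_below_zero[OF semibounded N] lin.zero by simp
  finally have 0: "E (- ?T) f = 0" .
  have less: "x < \<tau>" if "x \<in> ?T" for x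
    using that less_le_trans[OF _ b, of "ereal x"] by simp
  have sub: "?T \<subseteq> {- (real N + \<bar>\<tau>\<bar>)..real N + \<bar>\<tau>\<bar>}"
    using less by force
  note sb = spectral_bounded_support[OF T 0 sub]
  have ae: "AE x in ?M. x < \<tau>"
    using AE_scalar_measure[OF pvm T 0] by eventually_elim (rule less)
  have "(\<integral>x. \<tau> - x \<partial>?M) = \<tau> * Re (cinner f f) - (\<integral>x. x \<partial>?M)"
    using sb(2) by (simp add: space_scalar_measure[OF pvm] measure_scalar_measure_UNIV[OF pvm])
  also have "\<dots> \<le> 0"
    using bound[OF sb(1) f(2,3)] sb(3) by simp
  finally have le: "(\<integral>x. \<tau> - x \<partial>?M) \<le> 0" .
  have nn: "AE x in ?M. 0 \<le> \<tau> - x"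
    using ae by eventually_elim simp
  have "(\<integral>x. \<tau> - x \<partial>?M) = 0"
    using le integral_nonneg_AE[OF nn] by linarith
  then have "AE x in ?M. \<tau> - x = 0"
    using integral_nonneg_eq_0_iff_AE[OF _ nn] sb(2) by simp
  then have "AE x in ?M. False"
    using ae by eventually_elim simp
  then have "emeasure ?M (space ?M) = 0"
    by (simp add: trivial_limit_def ae_filter_eq_bot_iff[symmetric])
  then have "Re (cinner f f) = 0"
    using measure_scalar_measure_UNIV[OF pvm, of f] by (simp add: space_scalar_measure[OF pvm] measure_def)
  then show "f = 0"
    by (simp add: Re_cinner_self_eq_0_iff)
qed

end

section \<open>Lower bound for one block\<close>

text \<open>Splits the exchange kernel into a product, which is a rank one kernel, and a remainder
  with the factor \<open>a * b\<close>, which vanishes as soon as one photon sits at the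
  threshold.\<close>

lemma exchange_kernel_identity:
  fixes c a b :: real
  assumes "c > 0" "a \<ge> 0" "b \<ge> 0"
  shows "1 / (c + a + b) = c / ((c + a) * (c + b)) + a * b / ((c + a + b) * ((c + a) * (c + b)))"
proof -
  have "c + a + b \<noteq> 0" "c + a \<noteq> 0" "c + b \<noteq> 0"
    using assms by linarith+
  then show ?thesis
    by (simp add: divide_simps) algebra
qed

text \<open>Completing the square in \<open>h\<close> costs
  \<open>\<alpha>^2 |\<beta>|^2 / D\<close> up to the factor \<open>1 / 2\<close>. In the two
  squares contained in \<open>|\<beta>|^2\<close> one photon energy is dropped from
  \<open>D\<close>, leaving self-energy densities. The cross term \<open>r\<close> has no sign: its
  rank one part is kept exactly, to be cancelled after integration, and only the remainder is
  estimated, with \<open>D \<ge> c\<close>.\<close>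

lemma two_particle_pointwise_bound:
  fixes c a b \<alpha> :: real and h l1 l2 g1 g2 :: complex
  assumes c: "c > 0" "a \<ge> 0" "b \<ge> 0"
  shows "0 \<le> 1 / 2 * ((c + a + b) * (cmod h)\<^sup>2) + \<alpha> * Re (h * cnj (cnj l1 * g2 + cnj l2 * g1))
    + \<alpha>\<^sup>2 * (1 / 2 * ((cmod l1)\<^sup>2 / (c + a) * (cmod g2)\<^sup>2 + (cmod g1)\<^sup>2 * ((cmod l2)\<^sup>2 / (c + b)))
      + c * Re (l1 * g1 / (c + a) * cnj (l2 * g2 / (c + b)))
      + 1 / c * (cmod l1 * cmod g1 * (a / (c + a)) * (cmod l2 * cmod g2 * (b / (c + b)))))"
proof -
  define D where "D = c + a + b"
  define \<beta> where "\<beta> = cnj l1 * g2 + cnj l2 * g1"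
  define r where "r = Re (l1 * g1 * cnj (l2 * g2))"
  have pos: "D > 0" "c + a > 0" "c + b > 0" "D \<ge> c + a" "D \<ge> c + b" "D \<ge> c"
    using c by (auto simp: D_def)
  have "0 \<le> (cmod (of_real (sqrt D) * h + of_real (\<alpha> / sqrt D) * \<beta>))\<^sup>2"
    by simp
  also have "\<dots> = D * (cmod h)\<^sup>2 + 2 * \<alpha> * Re (h * cnj \<beta>) + \<alpha>\<^sup>2 * (cmod \<beta>)\<^sup>2 / D"
    using pos(1) unfolding cmod_add_squared cmod_power2
    by (simp add: cmod_power2 power2_eq_square field_simps)
  finally have 1: "0 \<le> D * (cmod h)\<^sup>2 + 2 * \<alpha> * Re (h * cnj \<beta>) + \<alpha>\<^sup>2 * ((cmod \<beta>)\<^sup>2 / D)"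
    by simp
  have \<beta>: "(cmod \<beta>)\<^sup>2 = (cmod l1)\<^sup>2 * (cmod g2)\<^sup>2 + (cmod l2)\<^sup>2 * (cmod g1)\<^sup>2 + 2 * r"
    unfolding \<beta>_def r_def cmod_power2 by (simp add: power2_eq_square algebra_simps)
  have "(cmod l1)\<^sup>2 * (cmod g2)\<^sup>2 / D \<le> (cmod l1)\<^sup>2 * (cmod g2)\<^sup>2 / (c + a)"
    using pos by (intro divide_left_mono) auto
  moreover have "(cmod l2)\<^sup>2 * (cmod g1)\<^sup>2 / D \<le> (cmod l2)\<^sup>2 * (cmod g1)\<^sup>2 / (c + b)"
    using pos by (intro divide_left_mono) auto
  moreover have "r / D \<le> c * (r / ((c + a) * (c + b)))
    + 1 / c * (cmod l1 * cmod g1 * (cmod l2 * cmod g2) * (a * b / ((c + a) * (c + b))))"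
  proof -
    define k where "k = a * b / ((c + a) * (c + b))"
    have k: "k \<ge> 0"
      using c pos by (simp add: k_def)
    have "r / D = r * (1 / (c + a + b))"
      by (simp add: D_def)
    also have "1 / (c + a + b) = c / ((c + a) * (c + b)) + k / D"
      unfolding exchange_kernel_identity[OF c] by (simp add: D_def k_def)
    finally have "r / D = c * (r / ((c + a) * (c + b))) + r * k / D"
      by (simp add: algebra_simps)
    moreover have "r * k / D \<le> cmod l1 * cmod g1 * (cmod l2 * cmod g2) * k / c"
    proof (rule frac_le)
      have "\<bar>r\<bar> \<le> cmod l1 * cmod g1 * (cmod l2 * cmod g2)"
        unfolding r_def using abs_Re_le_cmod[of "l1 * g1 * cnj (l2 * g2)"] by (simp add: norm_mult)
      then show "r * k \<le> cmod l1 * cmod g1 * (cmod l2 * cmod g2) * k"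
        using k by (intro mult_right_mono) auto
    qed (use c pos k in auto)
    ultimately show ?thesis
      by (simp add: k_def[symmetric])
  qed
  ultimately have "(cmod \<beta>)\<^sup>2 / D \<le> (cmod l1)\<^sup>2 * (cmod g2)\<^sup>2 / (c + a) + (cmod l2)\<^sup>2 * (cmod g1)\<^sup>2 / (c + b)
    + 2 * (c * (r / ((c + a) * (c + b)))
    + 1 / c * (cmod l1 * cmod g1 * (cmod l2 * cmod g2) * (a * b / ((c + a) * (c + b)))))"
    unfolding \<beta> add_divide_distrib by simp
  then have "\<alpha>\<^sup>2 * ((cmod \<beta>)\<^sup>2 / D) \<le> \<alpha>\<^sup>2 * ((cmod l1)\<^sup>2 * (cmod g2)\<^sup>2 / (c + a) + (cmod l2)\<^sup>2 * (cmod g1)\<^sup>2 / (c + b)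
    + 2 * (c * (r / ((c + a) * (c + b)))
    + 1 / c * (cmod l1 * cmod g1 * (cmod l2 * cmod g2) * (a * b / ((c + a) * (c + b))))))"
    by (intro mult_left_mono) auto
  moreover have Re_eq: "Re (l1 * g1 / (c + a) * cnj (l2 * g2 / (c + b))) = r / ((c + a) * (c + b))"
  proof -
    have "l1 * g1 / of_real (c + a) * cnj (l2 * g2 / of_real (c + b))
      = (l1 * g1 * cnj (l2 * g2)) / of_real ((c + a) * (c + b))"
      by simp
    then show ?thesis
      unfolding r_def by (simp only: Re_divide_of_real)
  qed
  ultimately have "0 \<le> D * (cmod h)\<^sup>2 + 2 * \<alpha> * Re (h * cnj \<beta>)
    + \<alpha>\<^sup>2 * ((cmod l1)\<^sup>2 * (cmod g2)\<^sup>2 / (c + a) + (cmod l2)\<^sup>2 * (cmod g1)\<^sup>2 / (c + b)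
    + 2 * (c * Re (l1 * g1 / (c + a) * cnj (l2 * g2 / (c + b)))
    + 1 / c * (cmod l1 * cmod g1 * (cmod l2 * cmod g2) * (a * b / ((c + a) * (c + b))))))"
    unfolding Re_eq using 1 by linarith
  moreover have "(cmod l1)\<^sup>2 * (cmod g2)\<^sup>2 / (c + a) = (cmod l1)\<^sup>2 / (c + a) * (cmod g2)\<^sup>2"
    "(cmod l2)\<^sup>2 * (cmod g1)\<^sup>2 / (c + b) = (cmod g1)\<^sup>2 * ((cmod l2)\<^sup>2 / (c + b))"
    "cmod l1 * cmod g1 * (cmod l2 * cmod g2) * (a * b / ((c + a) * (c + b)))
      = cmod l1 * cmod g1 * (a / (c + a)) * (cmod l2 * cmod g2 * (b / (c + b)))"
    by simp_all
  moreover have "0 \<le> 1 / 2 * x + \<alpha> * Y + t * (1 / 2 * (P + Q) + c * Z + k * S)"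
    if "0 \<le> x + 2 * \<alpha> * Y + t * (P + Q + 2 * (c * Z + k * S))" for x Y t P Q Z k S :: real
    using that by (simp add: field_simps)
  ultimately show ?thesis
    unfolding D_def \<beta>_def by (simp only:)
qed

text \<open>The discriminant in \<open>x\<close> is nonpositive: \<open>t^2\<close> is at most
  \<open>2 / 8\<close> of \<open>c * W\<close>, while \<open>e * 3 / 4 * W\<close> is at least
  \<open>3 / 8\<close> of it.\<close>

lemma quadratic_form_nonneg:
  fixes c e x t W :: real
  assumes "c > 0" "e \<ge> c / 2" "t\<^sup>2 \<le> c / 4 * W"
  shows "0 \<le> e * x\<^sup>2 - 2 * x * t + 3 / 4 * W"
proof -
  have "0 \<le> (c / sqrt 3 * x - sqrt 3 * t)\<^sup>2"
    by simp
  also have "\<dots> = c\<^sup>2 / 3 * x\<^sup>2 - 2 * c * x * t + 3 * t\<^sup>2"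
    by (simp add: power2_diff power_mult_distrib power_divide)
  also have "\<dots> \<le> c * e * x\<^sup>2 - 2 * c * x * t + 3 * (c / 4 * W)"
  proof -
    have "c * (c / 2) \<le> c * e"
      using assms by (intro mult_left_mono) auto
    moreover have "c\<^sup>2 / 3 \<le> c * (c / 2)"
      by (simp add: power2_eq_square)
    ultimately have "c\<^sup>2 / 3 \<le> c * e"
      by linarith
    then have "c\<^sup>2 / 3 * x\<^sup>2 \<le> c * e * x\<^sup>2"
      by (rule mult_right_mono) simp
    then show ?thesis
      using assms(3) by linarith
  qed
  also have "\<dots> = c * (e * x\<^sup>2 - 2 * x * t + 3 / 4 * W)"
    by (simp add: algebra_simps)
  finally show ?thesis
    using assms(1) by (simp add: zero_le_mult_iff)
qed

context boson_field
begin

lemma cinner_create: "cinner (create g) h = cinner g (annihilate h)"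
  by (metis cinner_annihilate cinner_commute)

text \<open>The budget is as follows. \<open>d\<close> pays for the diagonal self-energy. The excess
  \<open>W\<close>, the integral of \<open>(\<omega> - m) |g|^2\<close>, pays with one quarter for
  the remainder of the exchange term and with three quarters, together with \<open>e\<close>, for
  the coupling to the vacuum. The hypothesis \<open>orth\<close> acts twice: it cancels the rank one
  part of the exchange term, and it reduces the vacuum coupling to its part that vanishes with
  \<open>\<omega> - m\<close>.\<close>

lemma block_form_nonneg:
  fixes f0 :: complex
  assumes g: "g \<in> domain1 \<omega>" and h: "h \<in> domain2 \<omega>"
    and m: "AE k in lebesgue. m \<le> \<omega> k" and c: "c > 0" and e: "e \<ge> c / 2"
    and d: "\<alpha>\<^sup>2 * (\<integral>k. (cmod (lam k))\<^sup>2 / (c + (\<omega> k - m)) \<partial>lebesgue) \<le> d"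
    and small: "\<alpha>\<^sup>2 * (\<integral>k. (cmod (lam k))\<^sup>2 * ((\<omega> k - m) / (c + (\<omega> k - m))\<^sup>2) \<partial>lebesgue) \<le> c / 4"
    and orth: "(\<integral>k. lam k * rep_L2 g k / of_real (c + (\<omega> k - m)) \<partial>lebesgue) = 0"
  shows "0 \<le> e * (cmod f0)\<^sup>2 + 2 * \<alpha> * Re (cinner g coupling * cnj f0) + Re (cinner (energy1 (d - m) g) g)
    + Re (cinner (energy2 (c - 2 * m) h) h) + 2 * \<alpha> * Re (cinner h (create g))"
proof -
  define w where "w = (\<lambda>k. \<omega> k - m)"
  have [measurable]: "w \<in> borel_measurable lebesgue"
    unfolding w_def by measurable
  have w: "AE k in lebesgue. 0 \<le> w k"
    using m by (simp add: w_def)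
  define G where "G = rep_L2 g"
  define H where "H = rep_L2_sym h"
  have G: "square_integrable G" and H: "square_integrable H" "ae_symmetric H"
    by (auto simp: G_def H_def)
  have [measurable]: "G \<in> borel_measurable lebesgue" "H \<in> borel_measurable lebesgue"
    using G H by (auto simp: square_integrable_def)
  have G2: "integrable lebesgue (\<lambda>k. (cmod (G k))\<^sup>2)"
    using G by (auto simp: square_integrable_def)
  have lam2: "integrable lebesgue (\<lambda>k. (cmod (lam k))\<^sup>2)"
    using lam by (auto simp: square_integrable_def)
  have wG2: "integrable lebesgue (\<lambda>k. w k * (cmod (G k))\<^sup>2)"
    using integrable_Re[OF integrable_mult_cnj[OF domain1_rep[OF g, of "- m"] G]]
    by (simp add: w_def G_def mult.assoc complex_norm_square[symmetric] del: of_real_add)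
  define W where "W = (\<integral>k. w k * (cmod (G k))\<^sup>2 \<partial>lebesgue)"
  define A1 where "A1 = (\<lambda>k. (cmod (lam k))\<^sup>2 / (c + w k))"
  define u where "u = (\<lambda>k. lam k * G k / of_real (c + w k))"
  define v where "v = (\<lambda>k. cmod (lam k) * cmod (G k) * (w k / (c + w k)))"
  have lamG: "integrable lebesgue (\<lambda>k. lam k * G k)"
    by (rule integrable_mult_square_integrable[OF lam G])
  have A1i: "integrable lebesgue A1"
  proof (rule Bochner_Integration.integrable_bound)
    show "integrable lebesgue (\<lambda>k. (cmod (lam k))\<^sup>2 / c)"
      using lam2 by simp
    show "AE k in lebesgue. norm (A1 k) \<le> norm ((cmod (lam k))\<^sup>2 / c)"
      using w by eventually_elim (use c in \<open>auto simp: A1_def intro!: divide_left_mono\<close>)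
  qed (simp add: A1_def)
  have ui: "integrable lebesgue u"
  proof (rule Bochner_Integration.integrable_bound)
    show "integrable lebesgue (\<lambda>k. (lam k * G k) / of_real c)"
      using lamG by simp
    show "AE k in lebesgue. norm (u k) \<le> norm ((lam k * G k) / of_real c)"
      using w by eventually_elim
        (use c in \<open>auto simp: u_def norm_divide norm_mult simp del: of_real_add intro!: divide_left_mono\<close>)
  qed (simp add: u_def)
  have vi: "integrable lebesgue v"
  proof (rule Bochner_Integration.integrable_bound[OF lamG])
    show "AE k in lebesgue. norm (v k) \<le> norm (lam k * G k)"
      using w
    proof eventually_elim
      case (elim k)
      then have "\<bar>w k / (c + w k)\<bar> \<le> 1"
        using c by simp
      then have "cmod (lam k) * cmod (G k) * \<bar>w k / (c + w k)\<bar> \<le> cmod (lam k) * cmod (G k) * 1"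
        by (intro mult_left_mono) auto
      then show ?case
        by (simp add: v_def norm_mult abs_mult)
    qed
  qed (simp add: v_def)
  have v_nonneg: "AE k in lebesgue. 0 \<le> v k"
    using w by eventually_elim (use c in \<open>auto simp: v_def\<close>)
  define V where "V = (\<integral>k. v k \<partial>lebesgue)"
  have V0: "0 \<le> V"
    unfolding V_def by (rule integral_nonneg_AE[OF v_nonneg])
  \<comment> \<open>Cauchy-Schwarz after writing \<open>w = sqrt w * sqrt w\<close>: one root goes
    with \<open>lam / (c + w)\<close> and yields the integral in \<open>small\<close>, the other
    goes with \<open>G\<close> and yields \<open>W\<close>.\<close>
  have V: "\<alpha>\<^sup>2 * V\<^sup>2 \<le> c / 4 * W"
  proof -
    define f1 where "f1 = (\<lambda>k. of_real (sqrt (w k) / (c + w k)) * lam k)"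
    define f2 where "f2 = (\<lambda>k. of_real (sqrt (w k)) * G k)"
    have "AE k in lebesgue. cmod (of_real (sqrt (w k) / (c + w k))) \<le> 1 / sqrt c"
      using w
    proof eventually_elim
      case (elim k)
      have "sqrt c * sqrt (w k) \<le> c + w k"
      proof (rule power2_le_imp_le)
        show "(sqrt c * sqrt (w k))\<^sup>2 \<le> (c + w k)\<^sup>2"
          using c elim by (simp add: power_mult_distrib power2_sum)
      qed (use c elim in auto)
      then have "sqrt (w k) / (c + w k) \<le> 1 / sqrt c"
        using c elim by (simp add: divide_simps mult.commute)
      moreover have "0 \<le> sqrt (w k) / (c + w k)"
        using c elim by simp
      ultimately show ?case
        unfolding norm_of_real by (simp only: real_norm_def abs_of_nonneg)
    qed
    then have f1: "square_integrable f1"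
      unfolding f1_def by (intro square_integrable_bounded_mult[OF lam]) measurable
    have f2m: "f2 \<in> borel_measurable lebesgue"
      unfolding f2_def by measurable
    have f2eq: "AE k in lebesgue. (cmod (f2 k))\<^sup>2 = w k * (cmod (G k))\<^sup>2"
      using w by eventually_elim (auto simp: f2_def norm_mult power_mult_distrib)
    have f2: "square_integrable f2"
      unfolding square_integrable_def
    proof
      show "integrable lebesgue (\<lambda>k. (cmod (f2 k))\<^sup>2)"
      proof (rule integrable_cong_AE_imp[OF wG2])
        show "AE k in lebesgue. w k * (cmod (G k))\<^sup>2 = (cmod (f2 k))\<^sup>2"
          using f2eq by eventually_elim simp
      qed (use f2m in measurable)
    qed (rule f2m)
    have f2W: "(\<integral>k. (cmod (f2 k))\<^sup>2 \<partial>lebesgue) = W"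
      unfolding W_def by (rule integral_cong_AE[OF _ _ f2eq]) (use f2m in measurable)
    have f1I: "(\<integral>k. (cmod (f1 k))\<^sup>2 \<partial>lebesgue) = (\<integral>k. (cmod (lam k))\<^sup>2 * (w k / (c + w k)\<^sup>2) \<partial>lebesgue)"
    proof (rule integral_cong_AE)
      show "AE k in lebesgue. (cmod (f1 k))\<^sup>2 = (cmod (lam k))\<^sup>2 * (w k / (c + w k)\<^sup>2)"
        using w by eventually_elim
          (auto simp: f1_def norm_mult norm_divide power_mult_distrib power_divide simp del: of_real_divide)
    qed (auto simp: f1_def)
    have "V = (\<integral>k. cmod (f1 k) * cmod (f2 k) \<partial>lebesgue)"
      unfolding V_def
    proof (rule integral_cong_AE)
      show "AE k in lebesgue. v k = cmod (f1 k) * cmod (f2 k)"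
        using w
      proof eventually_elim
        case (elim k)
        have "cmod (f1 k) * cmod (f2 k) = cmod (lam k) * cmod (G k) * ((sqrt (w k) * sqrt (w k)) / \<bar>c + w k\<bar>)"
          using elim by (simp add: f1_def f2_def norm_mult norm_divide del: of_real_add)
        then show ?case
          using elim c by (simp add: v_def)
      qed
    qed (auto simp: v_def f1_def f2_def)
    then have "V\<^sup>2 \<le> (\<integral>k. (cmod (lam k))\<^sup>2 * (w k / (c + w k)\<^sup>2) \<partial>lebesgue) * W"
      using integral_norm_Cauchy_Schwarz[OF f1 f2] by (simp add: f1I f2W)
    then have "\<alpha>\<^sup>2 * V\<^sup>2 \<le> (\<alpha>\<^sup>2 * (\<integral>k. (cmod (lam k))\<^sup>2 * (w k / (c + w k)\<^sup>2) \<partial>lebesgue)) * W"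
      unfolding mult.assoc by (rule mult_left_mono) simp
    also have "\<dots> \<le> c / 4 * W"
    proof (rule mult_right_mono)
      show "0 \<le> W"
        unfolding W_def by (rule integral_nonneg_AE) (use w in eventually_elim, simp)
    qed (use small in \<open>simp add: w_def\<close>)
    finally show ?thesis .
  qed
  have u0: "(\<integral>k. u k \<partial>lebesgue) = 0"
    using orth by (simp add: u_def G_def w_def)
  define D where "D = (\<lambda>z :: 'a \<times> 'a. c + w (fst z) + w (snd z))"
  define b where "b = symm (\<lambda>k. cnj (lam k)) G"
  have b: "square_integrable b"
    unfolding b_def by (intro square_integrable_symm square_integrable_cnj_lam G)
  have DH: "integrable lebesgue (\<lambda>z. D z * (cmod (H z))\<^sup>2)"
    and eH: "Re (cinner (energy2 (c - 2 * m) h) h) = 1 / 2 * (\<integral>z. D z * (cmod (H z))\<^sup>2 \<partial>lebesgue)"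
  proof -
    have eq: "of_real (c - 2 * m + \<omega> (fst z) + \<omega> (snd z)) * H z * cnj (H z)
      = of_real (D z * (cmod (H z))\<^sup>2)" for z
      by (simp add: D_def w_def mult.assoc complex_norm_square[symmetric] del: of_real_add)
        (simp add: algebra_simps)
    show "integrable lebesgue (\<lambda>z. D z * (cmod (H z))\<^sup>2)"
      using integrable_Re[OF integrable_mult_cnj[OF domain2_rep[OF h, of "c - 2 * m"] H(1)]]
      unfolding H_def[symmetric] eq by simp
    show "Re (cinner (energy2 (c - 2 * m) h) h) = 1 / 2 * (\<integral>z. D z * (cmod (H z))\<^sup>2 \<partial>lebesgue)"
      unfolding cinner_energy2[OF h] H_def[symmetric] eq integral_complex_of_real by simp
  qed
  have Hb: "integrable lebesgue (\<lambda>z. H z * cnj (b z))"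
    by (rule integrable_mult_cnj[OF H(1) b])
  have hc: "2 * \<alpha> * Re (cinner h (create g)) = \<alpha> * (\<integral>z. Re (H z * cnj (b z)) \<partial>lebesgue)"
  proof -
    have "cinner h (create g) = cinner (abs_L2_sym H) (abs_L2_sym b)"
      by (simp add: create_def b_def H_def G_def)
    also have "\<dots> = 1 / 2 * (\<integral>z. H z * cnj (b z) \<partial>lebesgue)"
      by (rule cinner_abs_L2_sym) (auto simp: H b_def ae_symmetric_symm b[unfolded b_def])
    finally have "2 * cinner h (create g) = (\<integral>z. H z * cnj (b z) \<partial>lebesgue)"
      by (simp add: mult.commute)
    then have "2 * Re (cinner h (create g)) = Re (\<integral>z. H z * cnj (b z) \<partial>lebesgue)"
      by (metis mult_2 plus_complex.simps(1))
    then show ?thesis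
      unfolding integral_Re[OF Hb] by simp
  qed
  \<comment> \<open>\<open>R1\<close> and \<open>R2\<close> are the diagonal self-energy terms,
    \<open>R3\<close> is the rank one part with integral zero by \<open>orth\<close>, and
    \<open>R4\<close> is the remainder with integral \<open>V^2\<close>.\<close>
  define R1 where "R1 = (\<lambda>z. A1 (fst z) * (cmod (G (snd z)))\<^sup>2)"
  define R2 where "R2 = (\<lambda>z. (cmod (G (fst z)))\<^sup>2 * A1 (snd z))"
  define R3 where "R3 = (\<lambda>z. u (fst z) * cnj (u (snd z)))"
  define R4 where "R4 = (\<lambda>z. v (fst z) * v (snd z))"
  have R1: "integrable lebesgue R1" "(\<integral>z. R1 z \<partial>lebesgue) = (\<integral>k. A1 k \<partial>lebesgue) * (\<integral>k. (cmod (G k))\<^sup>2 \<partial>lebesgue)"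
    unfolding R1_def using lebesgue_integral_tensor_real[OF A1i G2] by auto
  have R2: "integrable lebesgue R2" "(\<integral>z. R2 z \<partial>lebesgue) = (\<integral>k. A1 k \<partial>lebesgue) * (\<integral>k. (cmod (G k))\<^sup>2 \<partial>lebesgue)"
    unfolding R2_def using lebesgue_integral_tensor_real[OF G2 A1i] by (auto simp: mult.commute)
  have uc: "integrable lebesgue (\<lambda>k. cnj (u k))"
    using ui by simp
  have R3: "integrable lebesgue R3" "(\<integral>z. R3 z \<partial>lebesgue) = 0"
    unfolding R3_def using lebesgue_integral_tensor[OF ui uc] u0 by auto
  have R4: "integrable lebesgue R4" "(\<integral>z. R4 z \<partial>lebesgue) = V\<^sup>2"
    unfolding R4_def using lebesgue_integral_tensor_real[OF vi vi] by (auto simp: V_def power2_eq_square)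
  have "0 \<le> (\<integral>z. 1 / 2 * (D z * (cmod (H z))\<^sup>2) + \<alpha> * Re (H z * cnj (b z))
      + \<alpha>\<^sup>2 * (1 / 2 * (R1 z + R2 z) + c * Re (R3 z) + 1 / c * R4 z) \<partial>lebesgue)"
  proof (rule integral_nonneg_AE)
    show "AE z in lebesgue. 0 \<le> 1 / 2 * (D z * (cmod (H z))\<^sup>2) + \<alpha> * Re (H z * cnj (b z))
      + \<alpha>\<^sup>2 * (1 / 2 * (R1 z + R2 z) + c * Re (R3 z) + 1 / c * R4 z)"
      using AE_lebesgue_fst_snd(1)[OF w] AE_lebesgue_fst_snd(2)[OF w]
    proof eventually_elim
      case (elim z)
      show ?case
        using two_particle_pointwise_bound[OF c elim, of "H z" \<alpha> "lam (fst z)" "G (snd z)" "lam (snd z)" "G (fst z)"]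
        unfolding D_def b_def symm_def R1_def R2_def R3_def R4_def A1_def u_def v_def .
    qed
  qed
  also have "\<dots> = 1 / 2 * (\<integral>z. D z * (cmod (H z))\<^sup>2 \<partial>lebesgue) + \<alpha> * (\<integral>z. Re (H z * cnj (b z)) \<partial>lebesgue)
      + \<alpha>\<^sup>2 * ((\<integral>k. A1 k \<partial>lebesgue) * (\<integral>k. (cmod (G k))\<^sup>2 \<partial>lebesgue) + 1 / c * V\<^sup>2)"
  proof -
    note [simp del] = times_divide_eq_left divide_const_simps complex_cnj_mult times_complex.simps
      mult_eq_0_iff of_real_mult Re_complex_of_real
    have i: "integrable lebesgue (\<lambda>z. Re (H z * cnj (b z)))" "integrable lebesgue (\<lambda>z. Re (R3 z))"
      by (rule integrable_Re, fact)+
    have "(\<integral>z. Re (R3 z) \<partial>lebesgue) = 0"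
      using R3 by simp
    then show ?thesis
      using DH i R1 R2 R3 R4
      by (subst Bochner_Integration.integral_add Bochner_Integration.integral_mult_right_zero | simp)+
  qed
  finally have two: "0 \<le> Re (cinner (energy2 (c - 2 * m) h) h) + 2 * \<alpha> * Re (cinner h (create g))
    + \<alpha>\<^sup>2 * ((\<integral>k. A1 k \<partial>lebesgue) * (\<integral>k. (cmod (G k))\<^sup>2 \<partial>lebesgue) + 1 / c * V\<^sup>2)"
    by (simp only: eH hc)
  have one: "Re (cinner (energy1 (d - m) g) g) = d * (\<integral>k. (cmod (G k))\<^sup>2 \<partial>lebesgue) + W"
  proof -
    have eq: "of_real (d - m + \<omega> k) * G k * cnj (G k)
      = of_real (d * (cmod (G k))\<^sup>2 + w k * (cmod (G k))\<^sup>2)" for k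
      by (simp add: w_def mult.assoc complex_norm_square[symmetric] del: of_real_add)
        (simp add: algebra_simps)
    show ?thesis
      unfolding cinner_energy1[OF g] G_def[symmetric] eq integral_complex_of_real
      using G2 wG2 by (simp add: W_def)
  qed
  have "\<alpha>\<^sup>2 * (\<integral>k. A1 k \<partial>lebesgue) * (\<integral>k. (cmod (G k))\<^sup>2 \<partial>lebesgue) \<le> d * (\<integral>k. (cmod (G k))\<^sup>2 \<partial>lebesgue)"
    using d by (intro mult_right_mono) (auto simp: A1_def w_def)
  moreover have "\<alpha>\<^sup>2 * V\<^sup>2 / c \<le> W / 4"
    using V c by (simp add: field_simps)
  moreover have "- 2 * cmod f0 * (\<bar>\<alpha>\<bar> * V) \<le> 2 * \<alpha> * Re (cinner g coupling * cnj f0)"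
  proof -
    \<comment> \<open>Since \<open>u\<close> integrates to zero, \<open>c * u\<close> may be
      subtracted. This multiplies the integrand by \<open>w / (c + w)\<close>, so that
      \<open>V\<close> controls the vacuum coupling as well.\<close>
    have "cinner g coupling = (\<integral>k. lam k * G k - of_real c * u k \<partial>lebesgue)"
      using lamG ui u0 by (simp add: cinner_coupling G_def)
    also have "norm \<dots> \<le> (\<integral>k. norm (lam k * G k - of_real c * u k) \<partial>lebesgue)"
      by (rule integral_norm_bound)
    also have "\<dots> = V"
      unfolding V_def
    proof (rule integral_cong_AE)
      show "AE k in lebesgue. norm (lam k * G k - of_real c * u k) = v k"
        using w
      proof eventually_elim
        case (elim k)
        have nz: "complex_of_real (c + w k) \<noteq> 0"
          using c elim by (simp only: of_real_eq_0_iff)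
        have "lam k * G k - of_real c * u k = lam k * G k * (of_real (w k) / of_real (c + w k))"
          using nz by (simp add: u_def field_simps)
        also have "norm \<dots> = v k"
          using c elim by (simp add: v_def norm_mult norm_divide del: of_real_add)
        finally show ?case .
      qed
    qed (auto simp: v_def u_def)
    finally have "cmod (cinner g coupling) \<le> V" .
    then have "cmod (cinner g coupling * cnj f0) \<le> V * cmod f0"
      by (simp add: norm_mult mult_right_mono)
    then have "\<bar>Re (cinner g coupling * cnj f0)\<bar> \<le> V * cmod f0"
      using abs_Re_le_cmod order_trans by blast
    then have "\<bar>\<alpha> * Re (cinner g coupling * cnj f0)\<bar> \<le> \<bar>\<alpha>\<bar> * (V * cmod f0)"
      unfolding abs_mult by (intro mult_left_mono) auto
    then show ?thesis
      by (simp add: algebra_simps abs_le_iff)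
  qed
  moreover have "0 \<le> e * (cmod f0)\<^sup>2 - 2 * cmod f0 * (\<bar>\<alpha>\<bar> * V) + 3 / 4 * W"
    by (rule quadratic_form_nonneg[OF c e]) (use V in \<open>simp add: power_mult_distrib\<close>)
  ultimately show ?thesis
    using two one by (simp add: algebra_simps)
qed

section \<open>The quadratic form of the Hamiltonian\<close>

lemma dom_spin_boson_iff:
  "((f0, f1, f2), (g0, g1, g2)) \<in> dom_op (spin_boson \<epsilon> lam \<omega> \<alpha>) \<longleftrightarrow>
    f1 \<in> domain1 \<omega> \<and> f2 \<in> domain2 \<omega> \<and> g1 \<in> domain1 \<omega> \<and> g2 \<in> domain2 \<omega>"
  by (auto simp: dom_op_def spin_boson_def in_fock2_domain_iff)

lemma app_spin_boson:
  assumes "f1 \<in> domain1 \<omega>" "f2 \<in> domain2 \<omega>" "g1 \<in> domain1 \<omega>" "g2 \<in> domain2 \<omega>"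
  shows "app_op (spin_boson \<epsilon> lam \<omega> \<alpha>) ((f0, f1, f2), (g0, g1, g2)) =
    ((of_real \<epsilon> * f0 + of_real \<alpha> * cinner g1 coupling,
      energy1 \<epsilon> f1 + (of_real \<alpha> * g0) *\<^sub>C coupling + of_real \<alpha> *\<^sub>C annihilate g2,
      energy2 \<epsilon> f2 + of_real \<alpha> *\<^sub>C create g1),
     (of_real (- \<epsilon>) * g0 + of_real \<alpha> * cinner f1 coupling,
      energy1 (- \<epsilon>) g1 + (of_real \<alpha> * f0) *\<^sub>C coupling + of_real \<alpha> *\<^sub>C annihilate f2,
      energy2 (- \<epsilon>) g2 + of_real \<alpha> *\<^sub>C create f1))"
  using assms by (simp add: app_op_def spin_boson_def spin_boson_component_eq del: spin_boson_component.simps)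

lemma symmetric_operator_spin_boson: "symmetric_operator (spin_boson \<epsilon> lam \<omega> \<alpha>)"
proof
  let ?A = "spin_boson \<epsilon> lam \<omega> \<alpha>"
  show "0 \<in> dom_op ?A"
    by (simp add: zero_prod_def dom_spin_boson_iff zero_in_domains)
  fix f g :: "'a state" and c :: complex
  obtain f0 f1 f2 f0' f1' f2' where f: "f = ((f0, f1, f2), (f0', f1', f2'))"
    by (metis prod_cases6 surj_pair)
  obtain g0 g1 g2 g0' g1' g2' where g: "g = ((g0, g1, g2), (g0', g1', g2'))"
    by (metis prod_cases6 surj_pair)
  assume "f \<in> dom_op ?A" "g \<in> dom_op ?A"
  note d = this[unfolded f g dom_spin_boson_iff]
  show "c *\<^sub>C f + g \<in> dom_op ?A"
    using d by (simp add: f g scaleC_prod_def dom_spin_boson_iff energy1_linear energy2_linear)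
  show "app_op ?A (c *\<^sub>C f + g) = c *\<^sub>C app_op ?A f + app_op ?A g"
    using d by (simp add: f g scaleC_prod_def app_spin_boson energy1_linear energy2_linear
        annihilate_linear create_linear scaleC_complex_def cinner_add_left cinner_scaleC_left)
      (simp add: scaleC_add_right scaleC_add_left scaleC_scaleC algebra_simps)
  have c: "cinner coupling h = cnj (cinner h coupling)" for h
    by (rule cinner_commute)
  show "cinner (app_op ?A f) g = cinner f (app_op ?A g)"
    using d by (simp add: f g app_spin_boson cinner_prod_def cinner_add_left cinner_add_right
        cinner_scaleC_left cinner_scaleC_right energy1_symmetric energy2_symmetric
        cinner_annihilate cinner_create cinner_complex_def c algebra_simps)
qed

lemma Re_cinner_energy1:
  assumes "g \<in> domain1 \<omega>"
  shows "Re (cinner (energy1 c g) g) = c * Re (cinner g g) + Re (cinner (energy1 0 g) g)"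
    and "AE k in lebesgue. m \<le> \<omega> k \<Longrightarrow> m * Re (cinner g g) \<le> Re (cinner (energy1 0 g) g)"
proof -
  let ?g = "rep_L2 g"
  have eq: "of_real (c + \<omega> k) * ?g k * cnj (?g k) = of_real (c * (cmod (?g k))\<^sup>2 + \<omega> k * (cmod (?g k))\<^sup>2)" for c k
    by (simp add: mult.assoc complex_norm_square[symmetric] del: of_real_add)
      (simp add: algebra_simps)
  have i: "integrable lebesgue (\<lambda>k. (cmod (?g k))\<^sup>2)"
    using square_integrable_rep_L2[of g] by (simp add: square_integrable_def del: square_integrable_rep_L2)
  have i2: "integrable lebesgue (\<lambda>k. \<omega> k * (cmod (?g k))\<^sup>2)"
    using integrable_Re[OF integrable_mult_cnj[OF domain1_rep[OF assms, of 0] square_integrable_rep_L2[of g]]]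
    unfolding eq by simp
  have *: "Re (cinner (energy1 c g) g) = c * (\<integral>k. (cmod (?g k))\<^sup>2 \<partial>lebesgue) + (\<integral>k. \<omega> k * (cmod (?g k))\<^sup>2 \<partial>lebesgue)" for c
    unfolding cinner_energy1[OF assms] eq integral_complex_of_real using i i2 by simp
  show "Re (cinner (energy1 c g) g) = c * Re (cinner g g) + Re (cinner (energy1 0 g) g)"
    unfolding * cinner_L2_self by simp
  assume m: "AE k in lebesgue. m \<le> \<omega> k"
  have "m * Re (cinner g g) = (\<integral>k. m * (cmod (?g k))\<^sup>2 \<partial>lebesgue)"
    by (simp add: cinner_L2_self)
  also have "\<dots> \<le> (\<integral>k. \<omega> k * (cmod (?g k))\<^sup>2 \<partial>lebesgue)"
    using i i2 m by (intro integral_mono_AE) (auto intro: mult_right_mono elim!: eventually_mono)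
  finally show "m * Re (cinner g g) \<le> Re (cinner (energy1 0 g) g)"
    unfolding * by simp
qed

lemma Re_cinner_energy2:
  assumes "g \<in> domain2 \<omega>"
  shows "Re (cinner (energy2 c g) g) = c * Re (cinner g g) + Re (cinner (energy2 0 g) g)"
    and "AE k in lebesgue. m \<le> \<omega> k \<Longrightarrow> 2 * m * Re (cinner g g) \<le> Re (cinner (energy2 0 g) g)"
proof -
  let ?g = "rep_L2_sym g"
  let ?w = "\<lambda>z. \<omega> (fst z) + \<omega> (snd z)"
  have eq: "of_real (c + \<omega> (fst z) + \<omega> (snd z)) * ?g z * cnj (?g z)
    = of_real (c * (cmod (?g z))\<^sup>2 + ?w z * (cmod (?g z))\<^sup>2)" for c z
    by (simp add: mult.assoc complex_norm_square[symmetric] del: of_real_add)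
      (simp add: algebra_simps)
  have i: "integrable lebesgue (\<lambda>k. (cmod (?g k))\<^sup>2)"
    using square_integrable_rep_L2_sym[of g] by (simp add: square_integrable_def del: square_integrable_rep_L2_sym)
  have i2: "integrable lebesgue (\<lambda>z. ?w z * (cmod (?g z))\<^sup>2)"
    using integrable_Re[OF integrable_mult_cnj[OF domain2_rep[OF assms, of 0] square_integrable_rep_L2_sym[of g]]]
    unfolding eq by simp
  have *: "Re (cinner (energy2 c g) g) = 1 / 2 * (c * (\<integral>k. (cmod (?g k))\<^sup>2 \<partial>lebesgue) + (\<integral>z. ?w z * (cmod (?g z))\<^sup>2 \<partial>lebesgue))" for c
    unfolding cinner_energy2[OF assms] eq integral_complex_of_real using i i2 by simp
  show "Re (cinner (energy2 c g) g) = c * Re (cinner g g) + Re (cinner (energy2 0 g) g)"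
    unfolding * cinner_L2_sym_self by (simp add: algebra_simps)
  assume m: "AE k in lebesgue. m \<le> \<omega> k"
  have ae: "AE z in lebesgue. 2 * m \<le> ?w z"
    using AE_lebesgue_fst_snd(1)[OF m] AE_lebesgue_fst_snd(2)[OF m] by eventually_elim simp
  have "2 * m * Re (cinner g g) = 1 / 2 * (\<integral>k. 2 * m * (cmod (?g k))\<^sup>2 \<partial>lebesgue)"
    by (simp add: cinner_L2_sym_self)
  also have "\<dots> \<le> 1 / 2 * (\<integral>z. ?w z * (cmod (?g z))\<^sup>2 \<partial>lebesgue)"
    using i i2 ae by (intro mult_left_mono integral_mono_AE) (auto intro: mult_right_mono elim!: eventually_mono)
  finally show "2 * m * Re (cinner g g) \<le> Re (cinner (energy2 0 g) g)"
    unfolding * by simp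
qed

text \<open>\<open>H\<close> splits into two blocks, coupling \<open>f\<^sub>0\<close> and \<open>f\<^sub>2\<close> of one spin to \<open>f\<^sub>1\<close> of the other one.\<close>

definition block_form :: "real \<Rightarrow> real \<Rightarrow> complex \<Rightarrow> 'a L2 \<Rightarrow> 'a L2_sym \<Rightarrow> real" where
  "block_form \<epsilon> \<alpha> f0 f1 f2 = \<epsilon> * (cmod f0)\<^sup>2 + 2 * \<alpha> * Re (cinner f1 coupling * cnj f0)
    + Re (cinner (energy1 (- \<epsilon>) f1) f1) + Re (cinner (energy2 \<epsilon> f2) f2) + 2 * \<alpha> * Re (cinner f2 (create f1))"

definition block_norm :: "complex \<Rightarrow> 'a L2 \<Rightarrow> 'a L2_sym \<Rightarrow> real" where
  "block_norm f0 f1 f2 = (cmod f0)\<^sup>2 + Re (cinner f1 f1) + Re (cinner f2 f2)"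

lemma Re_cinner_state:
  "Re (cinner ((f0, f1, f2), (g0, g1, g2)) ((f0, f1, f2), (g0, g1, g2)))
    = block_norm f0 g1 f2 + block_norm g0 f1 g2"
  unfolding block_norm_def cmod_power2
  by (simp add: cinner_prod_def cinner_complex_def power2_eq_square)

lemma Re_cinner_spin_boson:
  assumes "f1 \<in> domain1 \<omega>" "f2 \<in> domain2 \<omega>" "g1 \<in> domain1 \<omega>" "g2 \<in> domain2 \<omega>"
  shows "Re (cinner (app_op (spin_boson \<epsilon> lam \<omega> \<alpha>) ((f0, f1, f2), (g0, g1, g2))) ((f0, f1, f2), (g0, g1, g2)))
    = block_form \<epsilon> \<alpha> f0 g1 f2 + block_form (- \<epsilon>) \<alpha> g0 f1 g2"
proof -
  have c: "cinner coupling h = cnj (cinner h coupling)" for h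
    by (rule cinner_commute)
  have cr: "cinner (create h) f = cnj (cinner f (create h))" for h f
    by (rule cinner_commute)
  show ?thesis
    unfolding block_form_def cmod_power2
    using assms by (simp add: app_spin_boson cinner_prod_def cinner_add_left cinner_scaleC_left
        cinner_annihilate cr cinner_complex_def c power2_eq_square)
      (simp add: algebra_simps)
qed

text \<open>Expands the squared norm of \<open>x + \<alpha> y\<close>.\<close>

lemma Re_cinner_mult_ge: "- Re (cinner x x) - \<alpha>\<^sup>2 * Re (cinner y y) \<le> 2 * \<alpha> * Re (cinner x y)"
  for x :: "'h :: complex_inner"
proof -
  have "0 \<le> Re (cinner (x + of_real \<alpha> *\<^sub>C y) (x + of_real \<alpha> *\<^sub>C y))"
    by (rule cinner_ge_zero)
  then show ?thesis
    using Re_cinner_commute[of x y]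
    by (simp add: cinner_add_left cinner_add_right cinner_scaleC_left cinner_scaleC_right
        power2_eq_square algebra_simps)
qed

lemma integral_norm_symm_le:
  assumes F: "square_integrable F" and G: "square_integrable G"
  shows "(\<integral>z. (cmod (symm F G z))\<^sup>2 \<partial>lebesgue)
    \<le> 4 * ((\<integral>k. (cmod (F k))\<^sup>2 \<partial>lebesgue) * (\<integral>k. (cmod (G k))\<^sup>2 \<partial>lebesgue))"
proof -
  have i: "integrable lebesgue (\<lambda>z. (cmod (F (fst z) * G (snd z)))\<^sup>2)"
    "integrable lebesgue (\<lambda>z. (cmod (G (fst z) * F (snd z)))\<^sup>2)"
    using square_integrable_tensor[OF F G] square_integrable_tensor[OF G F]
    by (simp_all only: square_integrable_def)
  have "(\<integral>z. (cmod (symm F G z))\<^sup>2 \<partial>lebesgue)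
    \<le> (\<integral>z. 2 * (cmod (F (fst z) * G (snd z)))\<^sup>2 + 2 * (cmod (G (fst z) * F (snd z)))\<^sup>2 \<partial>lebesgue)"
  proof (rule integral_mono)
    show "integrable lebesgue (\<lambda>z. (cmod (symm F G z))\<^sup>2)"
      using square_integrable_symm[OF F G] by (simp add: square_integrable_def)
    show "integrable lebesgue (\<lambda>z. 2 * (cmod (F (fst z) * G (snd z)))\<^sup>2 + 2 * (cmod (G (fst z) * F (snd z)))\<^sup>2)"
      by (intro Bochner_Integration.integrable_add integrable_mult_right i)
    fix z :: "'a \<times> 'a"
    have "(cmod (a + b))\<^sup>2 \<le> 2 * (cmod a)\<^sup>2 + 2 * (cmod b)\<^sup>2" for a b :: complex
      using power_mono[OF norm_triangle_ineq[of a b] norm_ge_zero, of 2] sum_squares_bound[of "cmod a" "cmod b"]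
      by (simp add: power2_sum)
    from this[of "F (fst z) * G (snd z)" "G (fst z) * F (snd z)"]
    show "(cmod (symm F G z))\<^sup>2 \<le> 2 * (cmod (F (fst z) * G (snd z)))\<^sup>2 + 2 * (cmod (G (fst z) * F (snd z)))\<^sup>2"
      by (simp add: symm_def mult.commute)
  qed
  also have "\<dots> = 4 * ((\<integral>k. (cmod (F k))\<^sup>2 \<partial>lebesgue) * (\<integral>k. (cmod (G k))\<^sup>2 \<partial>lebesgue))"
    using integral_tensor_norm_square[OF F G] integral_tensor_norm_square[OF G F] i
    by (simp add: norm_mult[symmetric] power_mult_distrib[symmetric])
  finally show ?thesis .
qed

text \<open>The factor \<open>2\<close> is the weight \<open>1 / 2\<close> of the inner product
  times the \<open>4\<close> in \<open>integral_norm_symm_le\<close>.\<close>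

lemma Re_cinner_create_le:
  "Re (cinner (create g) (create g)) \<le> 2 * Re (cinner coupling coupling) * Re (cinner g g)"
proof -
  note l = square_integrable_cnj_lam
  note s = square_integrable_symm[OF l square_integrable_rep_L2[of g]]
  have "Re (cinner (create g) (create g)) = 1 / 2 * (\<integral>z. (cmod (symm (\<lambda>k. cnj (lam k)) (rep_L2 g) z))\<^sup>2 \<partial>lebesgue)"
    unfolding create_def cinner_abs_L2_sym[OF s s ae_symmetric_symm ae_symmetric_symm] integral_mult_cnj_self
    by simp
  moreover have "Re (cinner coupling coupling) = (\<integral>k. (cmod (cnj (lam k)))\<^sup>2 \<partial>lebesgue)"
    unfolding coupling_def cinner_abs_L2[OF l l] integral_mult_cnj_self by simp
  moreover have "Re (cinner g g) = (\<integral>k. (cmod (rep_L2 g k))\<^sup>2 \<partial>lebesgue)"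
    by (simp add: cinner_L2_self)
  ultimately show ?thesis
    using integral_norm_symm_le[OF l square_integrable_rep_L2[of g]] by simp
qed

text \<open>Supplies the bound \<open>C\<close> for the spectral subspace argument. Both coupling
  terms are absorbed by \<open>Re_cinner_mult_ge\<close>, and \<open>\<omega> \<ge> 0\<close>
  disposes of the photon energies.\<close>

lemma spin_boson_semibounded:
  assumes f: "f \<in> dom_op (spin_boson \<epsilon> lam \<omega> \<alpha>)"
  shows "- (\<bar>\<epsilon>\<bar> + 1 + 2 * \<alpha>\<^sup>2 * Re (cinner coupling coupling)) * Re (cinner f f)
    \<le> Re (cinner (app_op (spin_boson \<epsilon> lam \<omega> \<alpha>) f) f)"
proof -
  define L where "L = Re (cinner coupling coupling)"
  have L: "L \<ge> 0"
    unfolding L_def by (rule cinner_ge_zero)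
  have nonneg: "AE k in lebesgue. 0 \<le> \<omega> k"
    using omega_nonneg by simp
  have block: "- (\<bar>\<epsilon>\<bar> + 1 + 2 * \<alpha>\<^sup>2 * L) * block_norm f0 g h \<le> block_form \<epsilon> \<alpha> f0 g h"
    if g: "g \<in> domain1 \<omega>" and h: "h \<in> domain2 \<omega>" for \<epsilon> f0 g h
  proof -
    have g0: "0 \<le> Re (cinner g g)" and h0: "0 \<le> Re (cinner h h)"
      by (rule cinner_ge_zero)+
    have "- Re (cinner g g) - \<alpha>\<^sup>2 * (L * (cmod f0)\<^sup>2) \<le> 2 * \<alpha> * Re (cinner g coupling * cnj f0)"
    proof -
      have "Re (cinner (f0 *\<^sub>C coupling) (f0 *\<^sub>C coupling)) = Re (cinner coupling coupling * (f0 * cnj f0))"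
        by (simp add: cinner_scaleC_left cinner_scaleC_right mult_ac)
      also have "\<dots> = L * (cmod f0)\<^sup>2"
        by (simp add: L_def complex_norm_square[symmetric])
      finally show ?thesis
        using Re_cinner_mult_ge[of g \<alpha> "f0 *\<^sub>C coupling"] by (simp add: cinner_scaleC_right mult.commute)
    qed
    moreover have "- Re (cinner h h) - \<alpha>\<^sup>2 * (2 * L * Re (cinner g g)) \<le> 2 * \<alpha> * Re (cinner h (create g))"
    proof -
      have "\<alpha>\<^sup>2 * Re (cinner (create g) (create g)) \<le> \<alpha>\<^sup>2 * (2 * L * Re (cinner g g))"
        unfolding L_def by (intro mult_left_mono Re_cinner_create_le) simp
      then show ?thesis
        using Re_cinner_mult_ge[of h \<alpha> "create g"] by linarith
    qed
    moreover have "- \<epsilon> * Re (cinner g g) \<le> Re (cinner (energy1 (- \<epsilon>) g) g)"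
      using Re_cinner_energy1(1)[OF g, of "- \<epsilon>"] Re_cinner_energy1(2)[OF g nonneg] by simp
    moreover have "\<epsilon> * Re (cinner h h) \<le> Re (cinner (energy2 \<epsilon> h) h)"
      using Re_cinner_energy2(1)[OF h, of \<epsilon>] Re_cinner_energy2(2)[OF h nonneg] by simp
    moreover have "- \<bar>\<epsilon>\<bar> * (cmod f0)\<^sup>2 \<le> \<epsilon> * (cmod f0)\<^sup>2" "- \<bar>\<epsilon>\<bar> * Re (cinner g g) \<le> - \<epsilon> * Re (cinner g g)"
      "- \<bar>\<epsilon>\<bar> * Re (cinner h h) \<le> \<epsilon> * Re (cinner h h)"
      using g0 h0 by (intro mult_right_mono; simp)+
    moreover have "0 \<le> \<alpha>\<^sup>2 * (L * (cmod f0)\<^sup>2)" "0 \<le> \<alpha>\<^sup>2 * (L * Re (cinner h h))" "0 \<le> (cmod f0)\<^sup>2"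
      using L h0 by simp_all
    moreover have "- (\<bar>\<epsilon>\<bar> + 1 + 2 * \<alpha>\<^sup>2 * L) * (x + y + z) = (- \<bar>\<epsilon>\<bar> * x) + (- \<bar>\<epsilon>\<bar> * y) + (- \<bar>\<epsilon>\<bar> * z)
      - x - y - z - 2 * (\<alpha>\<^sup>2 * (L * x)) - \<alpha>\<^sup>2 * (2 * L * y) - 2 * (\<alpha>\<^sup>2 * (L * z))" for x y z
      by (simp add: algebra_simps)
    ultimately show ?thesis
      unfolding block_form_def block_norm_def by (simp only:)
  qed
  obtain f0 f1 f2 g0 g1 g2 where feq: "f = ((f0, f1, f2), (g0, g1, g2))"
    by (metis prod_cases6 surj_pair)
  have d: "f1 \<in> domain1 \<omega>" "f2 \<in> domain2 \<omega>" "g1 \<in> domain1 \<omega>" "g2 \<in> domain2 \<omega>"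
    using f unfolding feq dom_spin_boson_iff by auto
  show ?thesis
    using block[OF d(3,2), of \<epsilon> f0] block[OF d(1,4), of "- \<epsilon>" g0]
    unfolding feq Re_cinner_spin_boson[OF d] Re_cinner_state L_def
    by (simp add: algebra_simps)
qed


section \<open>The ground state energy of the one-photon Hamiltonian\<close>

lemma lam_square_integrable: "integrable lebesgue (\<lambda>k. (cmod (lam k))\<^sup>2)"
  using lam by (simp add: square_integrable_def)

lemma integrable_lam_bounded:
  assumes "g \<in> borel_measurable lebesgue" "AE k in lebesgue. \<bar>g k\<bar> \<le> B"
  shows "integrable lebesgue (\<lambda>k. (cmod (lam k))\<^sup>2 * g k)"
proof (rule Bochner_Integration.integrable_bound)
  show "integrable lebesgue (\<lambda>k. (cmod (lam k))\<^sup>2 * B)"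
    using lam_square_integrable by simp
  show "AE k in lebesgue. norm ((cmod (lam k))\<^sup>2 * g k) \<le> norm ((cmod (lam k))\<^sup>2 * B)"
    using assms(2) by eventually_elim (auto simp: abs_mult intro!: mult_left_mono)
  show "(\<lambda>k. (cmod (lam k))\<^sup>2 * g k) \<in> borel_measurable lebesgue"
    using assms(1) by measurable
qed

lemma integrable_lam_resolvent:
  assumes "c > 0"
  shows "integrable lebesgue (\<lambda>k. (cmod (lam k))\<^sup>2 / (c + \<omega> k))"
proof -
  have "\<bar>1 / (c + \<omega> k)\<bar> \<le> 1 / c" for k
    using assms omega_nonneg[of k] by (simp add: frac_le)
  then show ?thesis
    using integrable_lam_bounded[of "\<lambda>k. 1 / (c + \<omega> k)" "1 / c"] by simp
qed

text \<open>Eliminating the photon component from the one-photon eigenvalue equation at energy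
  \<open>- y\<close> leaves this scalar equation. It is solved by the intermediate value theorem on
  an interval starting at \<open>\<epsilon>\<close>.\<close>

lemma one_photon_energy_exists:
  assumes "\<epsilon> > 0"
  shows "\<exists>y\<ge>\<epsilon>. y - \<epsilon> = \<alpha>\<^sup>2 * self_energy (y + \<epsilon>)"
proof -
  define J where "J = (\<lambda>y. \<integral>k. (cmod (lam k))\<^sup>2 / (y + \<epsilon> + \<omega> k) \<partial>lebesgue)"
  define N where "N = (\<integral>k. (cmod (lam k))\<^sup>2 \<partial>lebesgue)"
  have N: "N \<ge> 0"
    by (simp add: N_def)
  \<comment> \<open>For \<open>y \<ge> \<epsilon>\<close> all denominators are at least
    \<open>2 * \<epsilon>\<close>, so \<open>\<alpha>^2\<close> times the self-energy never exceeds
    \<open>\<alpha>^2 * N / (2 * \<epsilon>)\<close>; at \<open>b\<close> the left side has reached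
    this value.\<close>
  define b where "b = \<epsilon> + \<alpha>\<^sup>2 * N / (2 * \<epsilon>)"
  have b: "\<epsilon> \<le> b"
    using N assms by (simp add: b_def)
  have "continuous_on {\<epsilon>..b} J"
    unfolding continuous_on_sequentially
  proof (intro allI ballI impI)
    fix x a assume a: "a \<in> {\<epsilon>..b}" and x: "(\<forall>n. x n \<in> {\<epsilon>..b}) \<and> x \<longlonglongrightarrow> a"
    show "(J \<circ> x) \<longlonglongrightarrow> J a"
      unfolding comp_def J_def
    proof (rule integral_dominated_convergence)
      show "integrable lebesgue (\<lambda>k. (cmod (lam k))\<^sup>2 / \<epsilon>)"
        using lam_square_integrable by simp
      show "AE k in lebesgue. (\<lambda>n. (cmod (lam k))\<^sup>2 / (x n + \<epsilon> + \<omega> k)) \<longlonglongrightarrow> (cmod (lam k))\<^sup>2 / (a + \<epsilon> + \<omega> k)"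
      proof (rule AE_I2, intro tendsto_intros)
        fix k show "a + \<epsilon> + \<omega> k \<noteq> 0"
          using a assms omega_nonneg[of k] by auto
      qed (use x in auto)
      show "AE k in lebesgue. norm ((cmod (lam k))\<^sup>2 / (x n + \<epsilon> + \<omega> k)) \<le> (cmod (lam k))\<^sup>2 / \<epsilon>" for n
      proof (rule AE_I2)
        fix k
        have "\<epsilon> \<le> x n + \<epsilon> + \<omega> k"
          using spec[OF conjunct1[OF x], of n] assms omega_nonneg[of k] by (simp only: atLeastAtMost_iff) linarith
        then show "norm ((cmod (lam k))\<^sup>2 / (x n + \<epsilon> + \<omega> k)) \<le> (cmod (lam k))\<^sup>2 / \<epsilon>"
          using assms by (simp add: frac_le)
      qed
    qed measurable
  qed
  then have cont: "continuous_on {\<epsilon>..b} (\<lambda>y. y - \<epsilon> - \<alpha>\<^sup>2 * J y)"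
    by (intro continuous_intros)
  have J0: "0 \<le> J y" if "\<epsilon> \<le> y" for y
    unfolding J_def using that assms omega_nonneg by (intro integral_nonneg_AE AE_I2) (simp add: add_nonneg_nonneg)
  have "J b \<le> (\<integral>k. (cmod (lam k))\<^sup>2 / (2 * \<epsilon>) \<partial>lebesgue)"
    unfolding J_def
  proof (rule integral_mono)
    show "integrable lebesgue (\<lambda>k. (cmod (lam k))\<^sup>2 / (b + \<epsilon> + \<omega> k))"
      using b assms by (intro integrable_lam_resolvent) simp
    show "integrable lebesgue (\<lambda>k. (cmod (lam k))\<^sup>2 / (2 * \<epsilon>))"
      using lam_square_integrable by simp
    show "(cmod (lam k))\<^sup>2 / (b + \<epsilon> + \<omega> k) \<le> (cmod (lam k))\<^sup>2 / (2 * \<epsilon>)" for k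
      using b assms omega_nonneg[of k] by (intro divide_left_mono) auto
  qed
  then have "\<alpha>\<^sup>2 * J b \<le> \<alpha>\<^sup>2 * (N / (2 * \<epsilon>))"
    by (intro mult_left_mono) (simp_all add: N_def)
  then have "0 \<le> b - \<epsilon> - \<alpha>\<^sup>2 * J b"
    by (simp add: b_def)
  moreover have "\<epsilon> - \<epsilon> - \<alpha>\<^sup>2 * J \<epsilon> \<le> 0"
    using J0[of \<epsilon>] by simp
  ultimately obtain y where "\<epsilon> \<le> y" "y - \<epsilon> - \<alpha>\<^sup>2 * J y = 0"
    using IVT'[of "\<lambda>y. y - \<epsilon> - \<alpha>\<^sup>2 * J y" \<epsilon> 0 b] b cont by auto
  then show ?thesis
    by (intro exI[of _ y]) (simp add: J_def)
qed

section \<open>The form bound in codimension two\<close>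

text \<open>Orthogonality to this vector is the hypothesis \<open>orth\<close> of
  \<open>block_form_nonneg\<close>. For \<open>c = y + \<epsilon>\<close> it is, up to the factor
  \<open>- \<alpha>\<close>, the photon component of the one-photon ground state.\<close>

definition resolvent_coupling :: "real \<Rightarrow> 'a L2" where
  "resolvent_coupling c = abs_L2 (\<lambda>k. cnj (lam k) / of_real (c + \<omega> k))"

lemma square_integrable_resolvent_coupling:
  assumes m: "AE k in lebesgue. m \<le> \<omega> k" and c: "c + m > 0"
  shows "square_integrable (\<lambda>k. cnj (lam k) / of_real (c + \<omega> k))"
proof -
  have "AE k in lebesgue. cmod (1 / of_real (c + \<omega> k)) \<le> 1 / (c + m)"
    using m by eventually_elim
      (use c in \<open>auto simp: norm_divide frac_le simp del: of_real_add\<close>)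
  from square_integrable_bounded_mult[OF square_integrable_cnj_lam _ this]
  show ?thesis
    by simp
qed

lemma cinner_resolvent_coupling:
  assumes "AE k in lebesgue. m \<le> \<omega> k" "c + m > 0"
  shows "cinner g (resolvent_coupling c) = (\<integral>k. lam k * rep_L2 g k / of_real (c + \<omega> k) \<partial>lebesgue)"
  using cinner_abs_L2[OF square_integrable_rep_L2[of g] square_integrable_resolvent_coupling[OF assms]]
  by (simp add: resolvent_coupling_def mult.commute)

text \<open>\<open>block_form_nonneg\<close> for the form shifted by \<open>y - m\<close>: its
  constant \<open>c\<close> becomes \<open>c + m\<close>, so that its denominators read
  \<open>c + \<omega>\<close>, and \<open>d\<close>, \<open>e\<close> become
  \<open>y - \<epsilon>\<close>, \<open>c - m\<close>. The condition
  \<open>4 * m \<le> c + m\<close> says that this \<open>e\<close> is at least half of the new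
  constant.\<close>

lemma block_form_ge:
  assumes g: "g \<in> domain1 \<omega>" and h: "h \<in> domain2 \<omega>"
    and m: "AE k in lebesgue. m \<le> \<omega> k" and c: "c = \<epsilon> + y" "c + m > 0" "4 * m \<le> c + m"
    and d: "\<alpha>\<^sup>2 * self_energy c \<le> y - \<epsilon>"
    and small: "\<alpha>\<^sup>2 * (\<integral>k. (cmod (lam k))\<^sup>2 * ((\<omega> k - m) / (c + \<omega> k)\<^sup>2) \<partial>lebesgue) \<le> (c + m) / 4"
    and orth: "cinner g (resolvent_coupling c) = 0"
  shows "(m - y) * block_norm f0 g h \<le> block_form \<epsilon> \<alpha> f0 g h"
proof -
  have eq: "c + m + (\<omega> k - m) = c + \<omega> k" for k
    by simp
  have "0 \<le> (c - m) * (cmod f0)\<^sup>2 + 2 * \<alpha> * Re (cinner g coupling * cnj f0)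
    + Re (cinner (energy1 (y - \<epsilon> - m) g) g)
    + Re (cinner (energy2 (c + m - 2 * m) h) h) + 2 * \<alpha> * Re (cinner h (create g))"
  proof (rule block_form_nonneg[OF g h m c(2), unfolded eq])
    show "(\<integral>k. lam k * rep_L2 g k / of_real (c + \<omega> k) \<partial>lebesgue) = 0"
      using orth cinner_resolvent_coupling[OF m c(2)] by simp
    show "(c + m) / 2 \<le> c - m"
      using c(3) by simp
  qed (fact d small)+
  then show ?thesis
    unfolding block_form_def block_norm_def
    using Re_cinner_energy1(1)[OF g, of "y - \<epsilon> - m"] Re_cinner_energy1(1)[OF g, of "- \<epsilon>"]
      Re_cinner_energy2(1)[OF h, of "c + m - 2 * m"] Re_cinner_energy2(1)[OF h, of \<epsilon>]
    by (simp add: c(1) algebra_simps)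
qed

text \<open>With \<open>w = \<omega> - m \<ge> 0\<close> the fraction is bounded by
  \<open>1\<close>, which gives the majorant \<open>|lam|^2\<close>, and by \<open>w / c\<close>,
  which gives pointwise convergence. No decay of \<open>lam\<close> beyond square integrability is
  available.\<close>

lemma coupling_defect_tendsto_0:
  assumes m: "AE k in lebesgue. m \<le> \<omega> k"
  shows "((\<lambda>c. \<integral>k. (cmod (lam k))\<^sup>2 * (c * (\<omega> k - m) / (c + (\<omega> k - m))\<^sup>2) \<partial>lebesgue) \<longlongrightarrow> 0) at_top"
proof -
  have "((\<lambda>c. \<integral>k. (cmod (lam k))\<^sup>2 * (c * (\<omega> k - m) / (c + (\<omega> k - m))\<^sup>2) \<partial>lebesgue)
    \<longlongrightarrow> (\<integral>k. 0 \<partial>(lebesgue :: 'a measure))) at_top"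
  proof (rule integral_dominated_convergence_at_top)
    show "integrable lebesgue (\<lambda>k. (cmod (lam k))\<^sup>2)"
      by (rule lam_square_integrable)
    show "\<forall>\<^sub>F c in at_top. AE k in lebesgue.
      norm ((cmod (lam k))\<^sup>2 * (c * (\<omega> k - m) / (c + (\<omega> k - m))\<^sup>2)) \<le> (cmod (lam k))\<^sup>2"
      using eventually_gt_at_top[of 0]
    proof eventually_elim
      case (elim c)
      show ?case
        using m
      proof eventually_elim
        case (elim k)
        let ?w = "\<omega> k - m"
        have "c * ?w \<le> (c + ?w)\<^sup>2"
          using \<open>c > 0\<close> elim zero_le_power2[of ?w] zero_le_power2[of c] mult_nonneg_nonneg[of c ?w]
          unfolding power2_sum by linarith
        moreover have "0 \<le> c * ?w"
          using \<open>c > 0\<close> elim by simp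
        moreover have "0 < (c + ?w)\<^sup>2"
          using \<open>c > 0\<close> elim by simp
        ultimately have le: "c * ?w / (c + ?w)\<^sup>2 \<le> 1" and ge: "0 \<le> c * ?w / (c + ?w)\<^sup>2"
          by simp_all
        have "norm ((cmod (lam k))\<^sup>2 * (c * ?w / (c + ?w)\<^sup>2)) = (cmod (lam k))\<^sup>2 * (c * ?w / (c + ?w)\<^sup>2)"
          unfolding real_norm_def by (rule abs_of_nonneg, rule mult_nonneg_nonneg[OF _ ge]) simp
        also have "\<dots> \<le> (cmod (lam k))\<^sup>2 * 1"
          by (rule mult_left_mono[OF le]) simp
        finally show ?case
          by simp
      qed
    qed
    show "AE k in lebesgue. ((\<lambda>c. (cmod (lam k))\<^sup>2 * (c * (\<omega> k - m) / (c + (\<omega> k - m))\<^sup>2)) \<longlongrightarrow> 0) at_top"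
      using m
    proof eventually_elim
      case (elim k)
      define w where "w = \<omega> k - m"
      have w: "w \<ge> 0"
        using elim by (simp add: w_def)
      have lim: "((\<lambda>c. w / c) \<longlongrightarrow> 0) at_top"
        by (rule tendsto_divide_0[OF tendsto_const filterlim_at_top_imp_at_infinity[OF filterlim_ident]])
      have ge: "\<forall>\<^sub>F c in at_top. 0 \<le> c * w / (c + w)\<^sup>2"
        using eventually_gt_at_top[of 0] by eventually_elim (use w in simp)
      have le: "\<forall>\<^sub>F c in at_top. c * w / (c + w)\<^sup>2 \<le> w / c"
        using eventually_gt_at_top[of 0]
      proof eventually_elim
        case (elim c)
        have "c * w / (c + w)\<^sup>2 \<le> c * w / c\<^sup>2"
          using elim w by (intro divide_left_mono power_mono) auto
        then show ?case
          using elim by (simp add: power2_eq_square)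
      qed
      have "((\<lambda>c. c * w / (c + w)\<^sup>2) \<longlongrightarrow> 0) at_top"
        by (rule tendsto_sandwich[OF ge le tendsto_const lim])
      then show ?case
        unfolding w_def[symmetric] by (rule tendsto_mult_right_zero)
    qed
  qed measurable
  then show ?thesis
    by simp
qed

text \<open>Without coupling the form is diagonal and \<open>y = \<epsilon>\<close>. One-photon
  energies are at least \<open>m - \<epsilon>\<close>, and so are two-photon energies, as
  \<open>2 * m - \<epsilon> \<ge> m - \<epsilon>\<close>. Only the vacua can lie lower, and the two
  test vectors remove them.\<close>

lemma spin_boson_codim_two_bound_uncoupled:
  assumes lam0: "AE k in lebesgue. lam k = 0" and "\<epsilon> \<ge> 0"
    and m: "AE k in lebesgue. m \<le> \<omega> k" "m \<ge> 0"
    and f: "f \<in> dom_op (spin_boson \<epsilon> lam \<omega> \<alpha>)"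
    and p: "cinner f ((1, 0, 0), (0, 0, 0)) = 0" and q: "cinner f ((0, 0, 0), (1, 0, 0)) = 0"
  shows "(m - \<epsilon>) * Re (cinner f f) \<le> Re (cinner (app_op (spin_boson \<epsilon> lam \<omega> \<alpha>) f) f)"
proof -
  have create0: "create g = 0" for g
    unfolding create_def abs_L2_sym_zero[symmetric]
  proof (rule abs_L2_sym_cong[OF square_integrable_zero ae_symmetric_zero])
    show "AE z in lebesgue. symm (\<lambda>k. cnj (lam k)) (rep_L2 g) z = 0"
      using AE_lebesgue_fst_snd(1)[OF lam0] AE_lebesgue_fst_snd(2)[OF lam0]
      by eventually_elim (simp add: symm_def)
  qed
  have block: "(m - \<epsilon>) * block_norm 0 g h \<le> block_form s \<alpha> 0 g h"
    if g: "g \<in> domain1 \<omega>" and h: "h \<in> domain2 \<omega>" and s: "\<bar>s\<bar> \<le> \<epsilon>" for g h s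
  proof -
    have g0: "0 \<le> Re (cinner g g)" and h0: "0 \<le> Re (cinner h h)"
      by (rule cinner_ge_zero)+
    have "(m - \<epsilon>) * Re (cinner g g) \<le> (m - s) * Re (cinner g g)"
      "(m - \<epsilon>) * Re (cinner h h) \<le> (2 * m + s) * Re (cinner h h)"
      using s m(2) g0 h0 by (intro mult_right_mono; linarith)+
    moreover have "m * Re (cinner g g) - s * Re (cinner g g) \<le> Re (cinner (energy1 (- s) g) g)"
      using Re_cinner_energy1(1)[OF g, of "- s"] Re_cinner_energy1(2)[OF g m(1)] by simp
    moreover have "2 * m * Re (cinner h h) + s * Re (cinner h h) \<le> Re (cinner (energy2 s h) h)"
      using Re_cinner_energy2(1)[OF h, of s] Re_cinner_energy2(2)[OF h m(1)] by simp
    ultimately show ?thesis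
      unfolding block_form_def block_norm_def by (simp add: create0 algebra_simps)
  qed
  obtain f0 f1 f2 g0 g1 g2 where feq: "f = ((f0, f1, f2), (g0, g1, g2))"
    by (metis prod_cases6 surj_pair)
  have d: "f1 \<in> domain1 \<omega>" "f2 \<in> domain2 \<omega>" "g1 \<in> domain1 \<omega>" "g2 \<in> domain2 \<omega>"
    using f unfolding feq dom_spin_boson_iff by auto
  have 0: "f0 = 0" "g0 = 0"
    using p q by (simp_all add: feq cinner_prod_def cinner_complex_def)
  show ?thesis
    unfolding feq Re_cinner_spin_boson[OF d] Re_cinner_state distrib_left unfolding 0
    by (rule add_mono; rule block) (use d \<open>\<epsilon> \<ge> 0\<close> in auto)
qed

text \<open>The two blocks differ by the sign of \<open>\<epsilon>\<close>, hence the arguments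
  \<open>y + \<epsilon>\<close> and \<open>y - \<epsilon>\<close> of the test vectors. Each vector
  sits in the one-photon slot of its block, whose spin is opposite to that of the vacuum in the
  block.\<close>

lemma spin_boson_codim_two_bound_coupled:
  assumes lam0: "\<not> (AE k in lebesgue. lam k = 0)" and eps: "\<epsilon> > 0"
    and m: "AE k in lebesgue. m \<le> \<omega> k" "m \<ge> 0"
  shows "\<exists>\<alpha>0>0. \<forall>\<alpha>>\<alpha>0. \<forall>y\<ge>\<epsilon>. y - \<epsilon> = \<alpha>\<^sup>2 * self_energy (y + \<epsilon>) \<longrightarrow>
    (\<forall>f \<in> dom_op (spin_boson \<epsilon> lam \<omega> \<alpha>).
      cinner f ((0, 0, 0), (0, resolvent_coupling (y + \<epsilon>), 0)) = 0 \<longrightarrow>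
      cinner f ((0, resolvent_coupling (y - \<epsilon>), 0), (0, 0, 0)) = 0 \<longrightarrow>
      (m - y) * Re (cinner f f) \<le> Re (cinner (app_op (spin_boson \<epsilon> lam \<omega> \<alpha>) f) f))"
proof -
  define K where "K = self_energy 1"
  have Ki: "integrable lebesgue (\<lambda>k. (cmod (lam k))\<^sup>2 / (1 + \<omega> k))"
    by (rule integrable_lam_resolvent) simp
  have pos1: "1 + \<omega> k > 0" for k
    using omega_nonneg[of k] by simp
  have nn: "0 \<le> (cmod (lam k))\<^sup>2 / (1 + \<omega> k)" for k
    using pos1[of k] by simp
  have "K \<noteq> 0"
  proof
    assume "K = 0"
    then have "AE k in lebesgue. (cmod (lam k))\<^sup>2 / (1 + \<omega> k) = 0"
      using integral_nonneg_eq_0_iff_AE[OF Ki] nn by (simp add: K_def)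
    then have "AE k in lebesgue. lam k = 0"
      by eventually_elim (metis pos1 divide_eq_0_iff less_irrefl norm_eq_zero power_eq_0_iff)
    then show False
      using lam0 by simp
  qed
  moreover have "K \<ge> 0"
    unfolding K_def by (rule integral_nonneg_AE) (use nn in simp)
  ultimately have K: "K > 0"
    by simp
  define J where "J = (\<lambda>c. \<integral>k. (cmod (lam k))\<^sup>2 * (c * (\<omega> k - m) / (c + (\<omega> k - m))\<^sup>2) \<partial>lebesgue)"
  have "\<forall>\<^sub>F c in at_top. J c < K / 16"
    using coupling_defect_tendsto_0[OF m(1)] K unfolding J_def by (intro order_tendstoD(2)) auto
  then obtain c1 where c1: "\<And>c. c \<ge> c1 \<Longrightarrow> J c < K / 16"
    by (auto simp: eventually_at_top_linorder)
  \<comment> \<open>For \<open>t = \<alpha> * sqrt K\<close> the summands ensure in turn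
    \<open>t > 1\<close>, then \<open>y - \<epsilon> \<ge> t / 2\<close> once
    \<open>y + \<epsilon> \<ge> t\<close> is known, then \<open>t / 2 \<ge> c1\<close>, and finally
    \<open>t / 2 \<ge> 4 * m\<close>.\<close>
  define \<alpha>0 where "\<alpha>0 = (1 + 4 * \<epsilon> + 2 * \<bar>c1\<bar> + 8 * m) / sqrt K"
  have "\<alpha>0 > 0"
    unfolding \<alpha>0_def using K eps m by (intro divide_pos_pos) auto
  moreover
  {
    fix \<alpha> y f
    assume \<alpha>: "\<alpha> > \<alpha>0" and y: "y \<ge> \<epsilon>"
      and root: "y - \<epsilon> = \<alpha>\<^sup>2 * self_energy (y + \<epsilon>)"
      and f: "f \<in> dom_op (spin_boson \<epsilon> lam \<omega> \<alpha>)"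
      and p: "cinner f ((0, 0, 0), (0, resolvent_coupling (y + \<epsilon>), 0)) = 0"
      and q: "cinner f ((0, resolvent_coupling (y - \<epsilon>), 0), (0, 0, 0)) = 0"
    define t where "t = \<alpha> * sqrt K"
    have t: "t > 1 + 4 * \<epsilon> + 2 * \<bar>c1\<bar> + 8 * m"
      using \<alpha> K unfolding \<alpha>0_def t_def by (simp add: field_simps)
    have t2: "t\<^sup>2 = \<alpha>\<^sup>2 * K"
      using K by (simp add: t_def power_mult_distrib)
    have t1: "t > 1"
      using t eps m(2) by linarith
    \<comment> \<open>The linear growth of \<open>y\<close> in \<open>\<alpha>\<close>. From
      \<open>y + \<epsilon> + \<omega> \<le> (1 + \<omega>) * r\<close> the self-energy is at least
      \<open>K / r\<close>, so the root equation gives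
      \<open>t^2 \<le> (y - \<epsilon>) * r \<le> r^2\<close>. As \<open>t > 1\<close>, the maximum
      \<open>r\<close> is attained by \<open>y + \<epsilon>\<close>.\<close>
    have yt: "y + \<epsilon> \<ge> t"
    proof -
      define r where "r = max 1 (y + \<epsilon>)"
      have r: "r \<ge> 1" "r \<ge> y + \<epsilon>"
        by (auto simp: r_def)
      have "K / r = (\<integral>k. (cmod (lam k))\<^sup>2 / (1 + \<omega> k) / r \<partial>lebesgue)"
        unfolding K_def by (rule integral_divide_zero[symmetric])
      also have "\<dots> \<le> self_energy (y + \<epsilon>)"
      proof (rule integral_mono)
        show "integrable lebesgue (\<lambda>k. (cmod (lam k))\<^sup>2 / (1 + \<omega> k) / r)"
          by (rule integrable_divide_zero) (rule Ki)
        show "integrable lebesgue (\<lambda>k. (cmod (lam k))\<^sup>2 / (y + \<epsilon> + \<omega> k))"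
          using y eps by (intro integrable_lam_resolvent) simp
        fix k
        have "\<omega> k * 1 \<le> \<omega> k * r"
          using r omega_nonneg[of k] by (intro mult_left_mono) auto
        then have "y + \<epsilon> + \<omega> k \<le> (1 + \<omega> k) * r"
          using r by (simp add: algebra_simps)
        moreover have "0 < y + \<epsilon> + \<omega> k"
          using y eps omega_nonneg[of k] by linarith
        ultimately have "(cmod (lam k))\<^sup>2 / ((1 + \<omega> k) * r) \<le> (cmod (lam k))\<^sup>2 / (y + \<epsilon> + \<omega> k)"
          using r pos1[of k] by (intro divide_left_mono mult_pos_pos) auto
        then show "(cmod (lam k))\<^sup>2 / (1 + \<omega> k) / r \<le> (cmod (lam k))\<^sup>2 / (y + \<epsilon> + \<omega> k)"
          by simp
      qed
      finally have "\<alpha>\<^sup>2 * (K / r) \<le> y - \<epsilon>"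
        unfolding root by (intro mult_left_mono) auto
      then have le: "t\<^sup>2 \<le> (y - \<epsilon>) * r"
        using r by (simp add: t2 field_simps)
      have "(y - \<epsilon>) * r \<le> r * r"
        using r eps by (intro mult_right_mono) auto
      then have "t\<^sup>2 \<le> r\<^sup>2"
        using le by (simp add: power2_eq_square)
      then have "t \<le> r"
        by (rule power2_le_imp_le) (use r in simp)
      then show ?thesis
        using t1 by (auto simp: r_def split: if_splits)
    qed
    have ylow: "y - \<epsilon> \<ge> t / 2"
      using yt t m(2) by linarith
    have y\<epsilon>: "y - \<epsilon> > 0"
      using ylow t1 by linarith
    \<comment> \<open>\<open>c'\<close> times the integral is \<open>J c'\<close>, below
      \<open>K / 16\<close>, and \<open>\<alpha>^2 * K / 16 = (t / 2)^2 / 4 \<le> c'^2 / 4\<close>.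
      The \<open>16\<close> thus combines the allowed quarter with the loss from knowing only
      \<open>c \<ge> t / 2\<close>.\<close>
    have small: "\<alpha>\<^sup>2 * (\<integral>k. (cmod (lam k))\<^sup>2 * ((\<omega> k - m) / (c + \<omega> k)\<^sup>2) \<partial>lebesgue) \<le> (c + m) / 4"
      if c: "c \<ge> t / 2" for c
    proof -
      let ?I = "\<integral>k. (cmod (lam k))\<^sup>2 * ((\<omega> k - m) / (c + \<omega> k)\<^sup>2) \<partial>lebesgue"
      define c' where "c' = c + m"
      have c': "c' \<ge> t / 2" "c' \<ge> c1" "c' > 0"
        using c t m(2) eps by (auto simp: c'_def)
      have "J c' = (\<integral>k. c' * ((cmod (lam k))\<^sup>2 * ((\<omega> k - m) / (c + \<omega> k)\<^sup>2)) \<partial>lebesgue)"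
        unfolding J_def by (intro Bochner_Integration.integral_cong) (auto simp: c'_def)
      also have "\<dots> = c' * ?I"
        by (rule Bochner_Integration.integral_mult_right_zero)
      finally have "c' * ?I < K / 16"
        using c1[OF c'(2)] by simp
      then have "\<alpha>\<^sup>2 * (c' * ?I) \<le> \<alpha>\<^sup>2 * (K / 16)"
        by (intro mult_left_mono) auto
      also have "\<dots> = (t / 2)\<^sup>2 / 4"
        by (simp add: t2 power_divide)
      also have "\<dots> \<le> c'\<^sup>2 / 4"
        using c'(1) t1 by (intro divide_right_mono power_mono) auto
      finally have "c' * (\<alpha>\<^sup>2 * ?I) \<le> c' * (c' / 4)"
        by (simp add: power2_eq_square mult.left_commute)
      then show ?thesis
        using c'(3) unfolding c'_def[symmetric] by simp
    qed
    have d1: "\<alpha>\<^sup>2 * self_energy (y + \<epsilon>) \<le> y - \<epsilon>"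
      using root by simp
    have gen: "1 / A \<le> p / q * (1 / B)" if "q * B \<le> p * A" "A > 0" "B > 0" "q > 0" for A B p q :: real
      using that by (simp add: field_simps)
    \<comment> \<open>Passing from \<open>y + \<epsilon>\<close> to \<open>y - \<epsilon>\<close>
      increases the self-energy at most by the factor
      \<open>(y + \<epsilon>) / (y - \<epsilon>)\<close>. This is exactly what turns the root
      equation into the bound required in the block with \<open>- \<epsilon>\<close>.\<close>
    have d2: "\<alpha>\<^sup>2 * self_energy (y - \<epsilon>) \<le> y - (- \<epsilon>)"
    proof -
      have "self_energy (y - \<epsilon>)
        \<le> (\<integral>k. (y + \<epsilon>) / (y - \<epsilon>) * ((cmod (lam k))\<^sup>2 / (y + \<epsilon> + \<omega> k)) \<partial>lebesgue)"
      proof (rule integral_mono)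
        show "integrable lebesgue (\<lambda>k. (cmod (lam k))\<^sup>2 / (y - \<epsilon> + \<omega> k))"
          by (rule integrable_lam_resolvent[OF y\<epsilon>])
        show "integrable lebesgue (\<lambda>k. (y + \<epsilon>) / (y - \<epsilon>) * ((cmod (lam k))\<^sup>2 / (y + \<epsilon> + \<omega> k)))"
          using y eps by (intro integrable_mult_right integrable_lam_resolvent) simp
        fix k
        have w: "\<omega> k \<ge> 0"
          by (rule omega_nonneg)
        have pos: "0 < y - \<epsilon> + \<omega> k" "0 < y + \<epsilon> + \<omega> k" "0 < y + \<epsilon>"
          using y\<epsilon> eps w by linarith+
        have "(y - \<epsilon>) * \<omega> k \<le> (y + \<epsilon>) * \<omega> k"
          using eps w by (intro mult_right_mono) auto
        then have "(y - \<epsilon>) * (y + \<epsilon> + \<omega> k) \<le> (y + \<epsilon>) * (y - \<epsilon> + \<omega> k)"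
          by (simp add: algebra_simps)
        then have "1 / (y - \<epsilon> + \<omega> k) \<le> (y + \<epsilon>) / (y - \<epsilon>) * (1 / (y + \<epsilon> + \<omega> k))"
          by (rule gen[OF _ pos(1,2) y\<epsilon>])
        then have "(cmod (lam k))\<^sup>2 * (1 / (y - \<epsilon> + \<omega> k)) \<le> (cmod (lam k))\<^sup>2 * ((y + \<epsilon>) / (y - \<epsilon>) * (1 / (y + \<epsilon> + \<omega> k)))"
          by (rule mult_left_mono) simp
        then show "(cmod (lam k))\<^sup>2 / (y - \<epsilon> + \<omega> k) \<le> (y + \<epsilon>) / (y - \<epsilon>) * ((cmod (lam k))\<^sup>2 / (y + \<epsilon> + \<omega> k))"
          by (simp add: mult.commute)
      qed
      then have "\<alpha>\<^sup>2 * self_energy (y - \<epsilon>)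
        \<le> \<alpha>\<^sup>2 * ((y + \<epsilon>) / (y - \<epsilon>) * self_energy (y + \<epsilon>))"
        unfolding Bochner_Integration.integral_mult_right_zero by (rule mult_left_mono) simp
      also have "\<dots> = (y + \<epsilon>) / (y - \<epsilon>) * (y - \<epsilon>)"
        by (subst root) simp
      also have "\<dots> = y - (- \<epsilon>)"
        using y\<epsilon> by simp
      finally show ?thesis .
    qed
    obtain f0 f1 f2 g0 g1 g2 where feq: "f = ((f0, f1, f2), (g0, g1, g2))"
      by (metis prod_cases6 surj_pair)
    have d: "f1 \<in> domain1 \<omega>" "f2 \<in> domain2 \<omega>" "g1 \<in> domain1 \<omega>" "g2 \<in> domain2 \<omega>"
      using f unfolding feq dom_spin_boson_iff by auto
    have o: "cinner g1 (resolvent_coupling (y + \<epsilon>)) = 0" "cinner f1 (resolvent_coupling (y - \<epsilon>)) = 0"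
      using p q by (simp_all add: feq cinner_prod_def cinner_complex_def)
    have "(m - y) * block_norm f0 g1 f2 \<le> block_form \<epsilon> \<alpha> f0 g1 f2"
    proof (rule block_form_ge[OF d(3,2) m(1) _ _ _ d1 small o(1)])
      show "y + \<epsilon> + m > 0" "4 * m \<le> y + \<epsilon> + m" "t / 2 \<le> y + \<epsilon>"
        using yt t t1 m(2) eps by linarith+
    qed simp
    moreover have "(m - y) * block_norm g0 f1 g2 \<le> block_form (- \<epsilon>) \<alpha> g0 f1 g2"
    proof (rule block_form_ge[OF d(1,4) m(1) _ _ _ d2 small o(2)])
      show "y - \<epsilon> + m > 0" "4 * m \<le> y - \<epsilon> + m" "t / 2 \<le> y - \<epsilon>"
        using ylow t t1 m(2) eps by linarith+
    qed simp
    ultimately have "(m - y) * Re (cinner f f) \<le> Re (cinner (app_op (spin_boson \<epsilon> lam \<omega> \<alpha>) f) f)"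
      unfolding feq Re_cinner_spin_boson[OF d] Re_cinner_state distrib_left by (rule add_mono)
  }
  ultimately show ?thesis
    by blast
qed

end

section \<open>The bottom of the essential spectrum\<close>

lemma nonnull_UN:
  assumes "S \<notin> null_sets lebesgue" "S = (\<Union>n :: nat. A n)"
  obtains n where "A n \<notin> null_sets lebesgue"
  using assms null_sets_UN[of A lebesgue] by blast

lemma nonnull_Diff_null:
  "S \<notin> null_sets lebesgue \<Longrightarrow> N \<in> null_sets lebesgue \<Longrightarrow> S - N \<notin> null_sets lebesgue"
  by (metis Un_Diff_cancel2 completion.complete2 null_sets.Un sup_ge1)

lemma nonnull_subset:
  "S \<notin> null_sets lebesgue \<Longrightarrow> S \<subseteq> T \<Longrightarrow> T \<notin> null_sets lebesgue"
  using completion.complete2 by blast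

text \<open>The set is the countable union of its parts with gap \<open>1 / (i + 1)\<close>, so one
  of these is not null.\<close>

lemma nonnull_strict_superlevel:
  fixes f :: "'a :: euclidean_space \<Rightarrow> real"
  assumes "{k \<in> S. x < f k} \<notin> null_sets lebesgue"
  obtains \<eta> where "\<eta> > 0" "{k \<in> S. x + \<eta> \<le> f k} \<notin> null_sets lebesgue"
proof -
  have pos: "0 < inverse (real (Suc i))" for i
    by simp
  have "{k \<in> S. x < f k} = (\<Union>i. {k \<in> S. x + inverse (real (Suc i)) \<le> f k})"
  proof (intro equalityI subsetI)
    fix k assume k: "k \<in> {k \<in> S. x < f k}"
    then obtain i where "inverse (real (Suc i)) < f k - x"
      using reals_Archimedean[of "f k - x"] by auto
    then show "k \<in> (\<Union>i. {k \<in> S. x + inverse (real (Suc i)) \<le> f k})"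
      using k by (intro UN_I[of i]) auto
  next
    fix k assume "k \<in> (\<Union>i. {k \<in> S. x + inverse (real (Suc i)) \<le> f k})"
    then obtain i where "k \<in> S" "x + inverse (real (Suc i)) \<le> f k"
      by blast
    then show "k \<in> {k \<in> S. x < f k}"
      using pos[of i] less_le_trans[of x "x + inverse (real (Suc i))" "f k"] by (simp del: of_nat_Suc)
  qed
  then obtain i where "{k \<in> S. x + inverse (real (Suc i)) \<le> f k} \<notin> null_sets lebesgue"
    by (rule nonnull_UN[OF assms])
  then show thesis
    by (rule that[OF pos])
qed

text \<open>The witness is the supremum of all \<open>t\<close> whose sublevel set is null. These
  \<open>t\<close> include \<open>B\<close>, and they are bounded because the sublevel sets exhaust
  \<open>S\<close>. That the supremum itself still has a null sublevel set follows from
  \<open>nonnull_strict_superlevel\<close> for \<open>- f\<close>.\<close>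

lemma essential_infimum_on:
  fixes f :: "'a :: euclidean_space \<Rightarrow> real"
  assumes f [measurable]: "f \<in> borel_measurable lebesgue" and S [measurable]: "S \<in> sets lebesgue"
    and S_pos: "S \<notin> null_sets lebesgue" and B: "\<And>k. k \<in> S \<Longrightarrow> B \<le> f k"
  shows "\<exists>x. {k \<in> S. f k < x} \<in> null_sets lebesgue \<and>
    (\<forall>t>x. {k \<in> S. f k < t} \<notin> null_sets lebesgue)"
proof -
  have meas: "{k \<in> S. f k < t} \<in> sets lebesgue" for t
    by measurable
  define T where "T = {t. {k \<in> S. f k < t} \<in> null_sets lebesgue}"
  have down: "s \<in> T" if "t \<in> T" "s \<le> t" for s t
  proof -
    have "{k \<in> S. f k < s} \<subseteq> {k \<in> S. f k < t}"
      using that(2) by auto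
    then show ?thesis
      using that(1) meas unfolding T_def by (auto intro: null_sets_subset)
  qed
  have "{k \<in> S. f k < B} = {}"
    using B by fastforce
  then have "B \<in> T"
    unfolding T_def mem_Collect_eq by (simp only: null_sets.empty_sets)
  have "\<exists>n. real n \<notin> T"
  proof (rule ccontr)
    assume "\<not> (\<exists>n. real n \<notin> T)"
    then have "(\<Union>n :: nat. {k \<in> S. f k < real n}) \<in> null_sets lebesgue"
      unfolding T_def by (intro null_sets_UN) auto
    moreover have "(\<Union>n :: nat. {k \<in> S. f k < real n}) = S"
      using reals_Archimedean2 by auto
    ultimately show False
      using S_pos by simp
  qed
  then obtain n :: nat where n: "real n \<notin> T" ..
  have "bdd_above T"
  proof (rule bdd_aboveI)
    fix t assume "t \<in> T"
    then show "t \<le> real n"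
      using n down[of t "real n"] by (cases "t \<le> real n") auto
  qed
  show ?thesis
  proof (intro exI[of _ "Sup T"] conjI allI impI)
    show "{k \<in> S. f k < Sup T} \<in> null_sets lebesgue"
    proof (rule ccontr)
      assume "\<not> {k \<in> S. f k < Sup T} \<in> null_sets lebesgue"
      then have "{k \<in> S. - Sup T < - f k} \<notin> null_sets lebesgue"
        by simp
      then obtain \<eta> where \<eta>: "\<eta> > 0" "{k \<in> S. - Sup T + \<eta> \<le> - f k} \<notin> null_sets lebesgue"
        by (rule nonnull_strict_superlevel)
      have "Sup T - \<eta> < Sup T"
        using \<eta>(1) by simp
      then obtain t where t: "t \<in> T" "Sup T - \<eta> < t"
        using \<open>B \<in> T\<close> \<open>bdd_above T\<close> by (subst (asm) less_cSup_iff) auto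
      have "{k \<in> S. - Sup T + \<eta> \<le> - f k} \<subseteq> {k \<in> S. f k < t}"
        using t(2) by auto
      then show False
        using nonnull_subset[OF \<eta>(2)] t(1) by (simp add: T_def)
    qed
    show "{k \<in> S. f k < t} \<notin> null_sets lebesgue" if "Sup T < t" for t
      using cSup_upper[OF _ \<open>bdd_above T\<close>, of t] that by (auto simp: T_def)
  qed
qed

text \<open>Lebesgue measure has no atoms. The cut is made by a hyperplane
  \<open>k \<bullet> b = x + \<eta>\<close> slightly above the essential infimum \<open>x\<close> of
  the coordinate. Mass below it exists by the choice of \<open>x\<close>, and mass above it because
  the hyperplane at \<open>x\<close> is null. Restricting to \<open>- n \<le> k \<bullet> b\<close>
  makes the essential infimum finite.\<close>

lemma nonnull_split:
  fixes S :: "'a :: euclidean_space set"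
  assumes S: "S \<in> sets lebesgue" "S \<notin> null_sets lebesgue"
  obtains S1 S2 where "S1 \<in> sets lebesgue" "S2 \<in> sets lebesgue" "S1 \<subseteq> S" "S2 \<subseteq> S" "S1 \<inter> S2 = {}"
    "S1 \<notin> null_sets lebesgue" "S2 \<notin> null_sets lebesgue"
proof -
  obtain b :: 'a where b: "b \<in> Basis"
    using nonempty_Basis by blast
  note [measurable] = S(1)
  have b_measurable [measurable]: "(\<lambda>k. k \<bullet> b) \<in> borel_measurable lebesgue"
    by (intro measurable_completion) measurable
  have "\<exists>n. - real n \<le> k \<bullet> b" for k
    using reals_Archimedean2[of "- (k \<bullet> b)"] by (metis less_imp_le minus_le_iff)
  then have "S = (\<Union>n :: nat. {k \<in> S. - real n \<le> k \<bullet> b})"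
    by auto
  then obtain n :: nat where n: "{k \<in> S. - real n \<le> k \<bullet> b} \<notin> null_sets lebesgue"
    by (rule nonnull_UN[OF S(2)])
  define S' where "S' = {k \<in> S. - real n \<le> k \<bullet> b}"
  have S' [measurable]: "S' \<in> sets lebesgue"
    unfolding S'_def by measurable
  obtain x where x: "{k \<in> S'. k \<bullet> b < x} \<in> null_sets lebesgue"
    "\<And>t. x < t \<Longrightarrow> {k \<in> S'. k \<bullet> b < t} \<notin> null_sets lebesgue"
    using essential_infimum_on[OF b_measurable S' n[folded S'_def], of "- real n"] by (auto simp: S'_def)
  have "{k. k \<bullet> b = x} \<in> null_sets lebesgue"
    using negligible_standard_hyperplane[OF b] by (simp add: negligible_iff_null_sets)
  then have "S' - ({k \<in> S'. k \<bullet> b < x} \<union> {k. k \<bullet> b = x}) \<notin> null_sets lebesgue"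
    using x(1) n by (intro nonnull_Diff_null) (auto simp: S'_def)
  moreover have "S' - ({k \<in> S'. k \<bullet> b < x} \<union> {k. k \<bullet> b = x}) = {k \<in> S'. x < k \<bullet> b}"
    by auto
  ultimately have "{k \<in> S'. x < k \<bullet> b} \<notin> null_sets lebesgue"
    by (simp only: not_False_eq_True)
  then obtain \<eta> where \<eta>: "\<eta> > 0" "{k \<in> S'. x + \<eta> \<le> k \<bullet> b} \<notin> null_sets lebesgue"
    by (rule nonnull_strict_superlevel)
  show thesis
  proof (rule that[of "{k \<in> S'. k \<bullet> b < x + \<eta>}" "{k \<in> S'. x + \<eta> \<le> k \<bullet> b}"])
    show "{k \<in> S'. k \<bullet> b < x + \<eta>} \<in> sets lebesgue"
      "{k \<in> S'. x + \<eta> \<le> k \<bullet> b} \<in> sets lebesgue"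
      by measurable
    show "{k \<in> S'. k \<bullet> b < x + \<eta>} \<notin> null_sets lebesgue"
      by (rule x(2)) (simp add: \<eta>(1))
    show "{k \<in> S'. x + \<eta> \<le> k \<bullet> b} \<notin> null_sets lebesgue"
      by (rule \<eta>(2))
    show "{k \<in> S'. k \<bullet> b < x + \<eta>} \<subseteq> S" "{k \<in> S'. x + \<eta> \<le> k \<bullet> b} \<subseteq> S"
      unfolding S'_def by blast+
    show "{k \<in> S'. k \<bullet> b < x + \<eta>} \<inter> {k \<in> S'. x + \<eta> \<le> k \<bullet> b} = {}"
      by force
  qed
qed

text \<open>Induction on the constraints: two disjoint non-null parts of \<open>S\<close> carry one
  solution each of the old constraints, and a suitable combination of them meets the new one.
  Disjoint supports prevent the combination from vanishing.\<close>

lemma exists_supported_orthogonal: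
  fixes G :: "'a :: euclidean_space L2 set"
  assumes "finite G" "S \<in> sets lebesgue" "S \<notin> null_sets lebesgue"
  shows "\<exists>F. square_integrable F \<and> (\<forall>k. k \<notin> S \<longrightarrow> F k = 0) \<and> abs_L2 F \<noteq> 0 \<and>
    (\<forall>g\<in>G. cinner (abs_L2 F) g = 0)"
  using assms
proof (induction G arbitrary: S rule: finite_induct)
  case empty
  \<comment> \<open>Cutting \<open>S\<close> down to a ball makes its indicator function square
    integrable.\<close>
  have "\<exists>n. norm k \<le> real n" for k :: 'a
    by (rule real_arch_simple)
  then have "S = (\<Union>n :: nat. S \<inter> cball 0 (real n))"
    by auto
  then obtain n :: nat where n: "S \<inter> cball 0 (real n) \<notin> null_sets lebesgue"
    by (rule nonnull_UN[OF empty(2)])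
  let ?S = "S \<inter> cball 0 (real n)"
  have S: "?S \<in> sets lebesgue"
    using empty(1) by auto
  have "emeasure lebesgue ?S \<le> emeasure lebesgue (cball (0 :: 'a) (real n))"
    by (rule emeasure_mono) auto
  also have "\<dots> < \<infinity>"
    using lmeasurable_cball[of "0 :: 'a" "real n"] by (simp add: fmeasurable_def)
  finally have fin: "emeasure lebesgue ?S < \<infinity>" .
  let ?F = "indicator ?S :: 'a \<Rightarrow> complex"
  have "(\<lambda>x. (cmod (?F x))\<^sup>2) = indicator ?S"
    by (auto simp: indicator_def)
  then have F: "square_integrable ?F"
    using S fin by (simp add: square_integrable_def)
  have "abs_L2 ?F \<noteq> 0"
  proof
    assume "abs_L2 ?F = 0"
    then have "AE k in lebesgue. ?F k = 0"
      using integral_mult_cnj_eq_0_iff[OF F] cinner_abs_L2[OF F F] by (simp add: cinner_eq_zero_iff)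
    then have "AE k in lebesgue. k \<notin> ?S"
      by eventually_elim (simp add: indicator_def split: if_splits)
    then have "?S \<in> null_sets lebesgue"
      by (subst completion.null_sets_iff_AE) simp
    then show False
      using n by simp
  qed
  then show ?case
    using F by (intro exI[of _ ?F]) auto
next
  case (insert g G)
  obtain S1 S2 where S: "S1 \<in> sets lebesgue" "S2 \<in> sets lebesgue" "S1 \<subseteq> S" "S2 \<subseteq> S" "S1 \<inter> S2 = {}"
    "S1 \<notin> null_sets lebesgue" "S2 \<notin> null_sets lebesgue"
    by (rule nonnull_split[OF insert.prems])
  obtain F1 where F1: "square_integrable F1" "\<And>k. k \<notin> S1 \<Longrightarrow> F1 k = 0" "abs_L2 F1 \<noteq> 0"
    "\<And>g. g \<in> G \<Longrightarrow> cinner (abs_L2 F1) g = 0"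
    using insert.IH[OF S(1,6)] by auto
  obtain F2 where F2: "square_integrable F2" "\<And>k. k \<notin> S2 \<Longrightarrow> F2 k = 0" "abs_L2 F2 \<noteq> 0"
    "\<And>g. g \<in> G \<Longrightarrow> cinner (abs_L2 F2) g = 0"
    using insert.IH[OF S(2,7)] by auto
  show ?case
  proof (cases "cinner (abs_L2 F1) g = 0")
    case True
    then show ?thesis
      using F1 S(3) by (intro exI[of _ F1]) auto
  next
    case False
    define c where "c = - cinner (abs_L2 F2) g / cinner (abs_L2 F1) g"
    let ?F = "\<lambda>k. F2 k + c * F1 k"
    have F: "square_integrable ?F"
      by (intro square_integrable_add square_integrable_scale F1 F2)
    have eq: "abs_L2 ?F = abs_L2 F2 + c *\<^sub>C abs_L2 F1"
      by (simp add: abs_L2_scaleC abs_L2_add F1 F2 square_integrable_scale)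
    have "abs_L2 ?F \<noteq> 0"
    proof
      assume "abs_L2 ?F = 0"
      then have "AE k in lebesgue. ?F k = 0"
        using integral_mult_cnj_eq_0_iff[OF F] cinner_abs_L2[OF F F] by (simp add: cinner_eq_zero_iff)
      then have "AE k in lebesgue. F2 k = 0"
      proof eventually_elim
        case (elim k)
        then show ?case
          using S(5) F1(2)[of k] F2(2)[of k] by (cases "k \<in> S1"; cases "k \<in> S2") auto
      qed
      then have "abs_L2 F2 = 0"
        using abs_L2_cong[OF square_integrable_zero, of F2] by (simp add: abs_L2_zero)
      then show False
        using F2(3) by simp
    qed
    moreover have "cinner (abs_L2 ?F) h = 0" if "h \<in> insert g G" for h
      unfolding eq cinner_add_left cinner_scaleC_left using that False F1(4) F2(4) by (auto simp: c_def)
    moreover have "F2 k + c * F1 k = 0" if "k \<notin> S" for k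
      using F1(2)[of k] F2(2)[of k] S(3,4) that by fastforce
    ultimately show ?thesis
      using F by (intro exI[of _ ?F]) auto
  qed
qed

section \<open>Approximate eigenvectors obtained by attaching a photon\<close>

locale one_photon_bound_state = boson_field +
  fixes \<epsilon> \<alpha> y :: real
  assumes eps_pos: "\<epsilon> > 0" and y_ge: "y \<ge> \<epsilon>"
    and y_root: "y - \<epsilon> = \<alpha>\<^sup>2 * self_energy (y + \<epsilon>)"
begin

abbreviation H :: "'a state operator" where
  "H \<equiv> spin_boson \<epsilon> lam \<omega> \<alpha>"

text \<open>The pair \<open>(1, v)\<close> is the ground state of the one-photon Hamiltonian, with energy \<open>-y\<close>; the
  vector \<open>attach F\<close> adds a second photon with wave function \<open>F\<close> to it.\<close>

definition v :: "'a \<Rightarrow> complex" where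
  "v k = - of_real \<alpha> * (cnj (lam k) / of_real (y + \<epsilon> + \<omega> k))"

definition attach :: "('a \<Rightarrow> complex) \<Rightarrow> 'a state" where
  "attach F = ((0, 0, abs_L2_sym (symm F v)), (0, abs_L2 F, 0))"

lemma denominator_pos: "y + \<epsilon> + \<omega> k > 0"
  using eps_pos y_ge omega_nonneg[of k] by linarith

text \<open>The photon component of the one-photon eigenvalue equation at energy
  \<open>- y\<close>.\<close>

lemma v_eq: "of_real (y + \<epsilon> + \<omega> k) * v k = - of_real \<alpha> * cnj (lam k)"
proof -
  have "complex_of_real (y + \<epsilon> + \<omega> k) \<noteq> 0"
    using denominator_pos[of k] by (simp only: of_real_eq_0_iff)
  then show ?thesis
    by (simp add: v_def del: of_real_add)
qed

lemma square_integrable_v: "square_integrable v"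
  unfolding v_def[abs_def]
  by (rule square_integrable_scale, rule square_integrable_resolvent_coupling[of 0])
    (use omega_nonneg eps_pos y_ge in auto)

text \<open>Although \<open>\<omega>\<close> is unbounded, solving \<open>v_eq\<close> for
  \<open>\<omega> v\<close> exhibits it as a combination of \<open>cnj lam\<close> and
  \<open>v\<close>.\<close>

lemma square_integrable_omega_v: "square_integrable (\<lambda>k. of_real (\<omega> k) * v k)"
proof -
  have "(\<lambda>k. of_real (\<omega> k) * v k)
    = (\<lambda>k. - of_real \<alpha> * cnj (lam k) + of_real (- (y + \<epsilon>)) * v k)"
  proof
    fix k show "of_real (\<omega> k) * v k = - of_real \<alpha> * cnj (lam k) + of_real (- (y + \<epsilon>)) * v k"
      unfolding v_eq[symmetric] by (simp add: algebra_simps)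
  qed
  then show ?thesis
    by (simp only:) (intro square_integrable_add square_integrable_scale square_integrable_cnj_lam square_integrable_v)
qed

text \<open>The vacuum component of the same eigenvalue equation; the choice of \<open>y\<close> as
  a root enters here.\<close>

lemma integral_v_lam: "of_real \<alpha> * (\<integral>q. v q * lam q \<partial>lebesgue) = of_real (\<epsilon> - y)"
proof -
  have "v q * lam q = - of_real \<alpha> * of_real ((cmod (lam q))\<^sup>2 / (y + \<epsilon> + \<omega> q))" for q
    unfolding v_def of_real_divide complex_norm_square by (simp add: mult_ac)
  then have "(\<integral>q. v q * lam q \<partial>lebesgue)
    = - of_real \<alpha> * of_real (self_energy (y + \<epsilon>))"
    by (simp only: Bochner_Integration.integral_mult_right_zero integral_complex_of_real)
  then have "of_real \<alpha> * (\<integral>q. v q * lam q \<partial>lebesgue)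
    = of_real (- (\<alpha>\<^sup>2 * self_energy (y + \<epsilon>)))"
    by (simp add: power2_eq_square)
  then show ?thesis
    unfolding y_root[symmetric] by simp
qed

lemma attach_add:
  assumes "square_integrable F" "square_integrable G"
  shows "attach F + attach G = attach (\<lambda>k. F k + G k)"
proof -
  have "symm (\<lambda>k. F k + G k) v = (\<lambda>z. symm F v z + symm G v z)"
    by (auto simp: symm_def algebra_simps)
  then show ?thesis
    by (simp add: attach_def abs_L2_add abs_L2_sym_add assms square_integrable_symm
        square_integrable_v ae_symmetric_symm)
qed

lemma attach_scaleC:
  assumes "square_integrable F"
  shows "c *\<^sub>C attach F = attach (\<lambda>k. c * F k)"
proof -
  have "symm (\<lambda>k. c * F k) v = (\<lambda>z. c * symm F v z)"
    by (auto simp: symm_def algebra_simps)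
  then show ?thesis
    by (simp add: attach_def scaleC_prod_def scaleC_complex_def abs_L2_scaleC abs_L2_sym_scaleC assms
        square_integrable_symm square_integrable_v ae_symmetric_symm)
qed

lemma attach_zero: "attach (\<lambda>k. 0) = 0"
  by (simp add: attach_def symm_def abs_L2_zero abs_L2_sym_zero zero_prod_def)

lemma attach_in_dom:
  assumes F: "square_integrable F" and wF: "square_integrable (\<lambda>k. of_real (\<omega> k) * F k)"
  shows "abs_L2 F \<in> domain1 \<omega>" "abs_L2_sym (symm F v) \<in> domain2 \<omega>" "attach F \<in> dom_op H"
proof -
  show 1: "abs_L2 F \<in> domain1 \<omega>"
    using abs_L2_in_domain1_iff[OF F] wF by simp
  have "(\<lambda>z. of_real (\<omega> (fst z) + \<omega> (snd z)) * symm F v z)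
    = (\<lambda>z. symm (\<lambda>k. of_real (\<omega> k) * F k) v z + symm F (\<lambda>k. of_real (\<omega> k) * v k) z)"
    by (auto simp: symm_def algebra_simps)
  then show 2: "abs_L2_sym (symm F v) \<in> domain2 \<omega>"
    using abs_L2_sym_in_domain2_iff[OF square_integrable_symm[OF F square_integrable_v] ae_symmetric_symm]
    by (simp only:) (intro square_integrable_add square_integrable_symm F wF square_integrable_v square_integrable_omega_v)
  show "attach F \<in> dom_op H"
    using 1 2 by (simp add: attach_def dom_spin_boson_iff zero_in_domains)
qed

text \<open>Orthogonality to \<open>coupling\<close> removes the vacuum amplitude and the term in
  which the attached photon is annihilated. Annihilating the photon of \<open>v\<close> contributes
  \<open>\<epsilon> - y\<close> by \<open>integral_v_lam\<close>, and in the two-photon component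
  \<open>v_eq\<close> cancels the creation term.\<close>

lemma app_attach:
  assumes F: "square_integrable F" and wF: "square_integrable (\<lambda>k. of_real (\<omega> k) * F k)"
    and orth: "cinner (abs_L2 F) coupling = 0"
  shows "app_op H (attach F) = attach (\<lambda>k. of_real (\<omega> k - y) * F k)"
proof -
  note dom = attach_in_dom[OF F wF]
  note v = square_integrable_v
  have e0: "energy1 c 0 = 0" "energy2 c 0 = 0" "annihilate 0 = 0" "create 0 = 0" for c
    using energy1_linear(2)[OF zero_in_domains(1,1), of c 1] energy2_linear(2)[OF zero_in_domains(2,2), of c 1]
      annihilate_linear[of 1 0 0] create_linear[of 1 0 0] by (simp_all add: scaleC_one)
  have int0: "(\<integral>q. F q * lam q \<partial>lebesgue) = 0"
    using orth cinner_abs_L2[OF F square_integrable_cnj_lam] by (simp add: coupling_def)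
  have s: "square_integrable (\<lambda>k. of_real (- \<epsilon> + \<omega> k) * F k)"
    by (rule square_integrable_energy1[OF F wF])
  have "annihilate (abs_L2_sym (symm F v)) = abs_L2 (\<lambda>k. \<integral>q. symm F v (k, q) * lam q \<partial>lebesgue)"
    by (rule annihilate_abs[OF square_integrable_symm[OF F v] ae_symmetric_symm])
  also have "(\<lambda>k. \<integral>q. symm F v (k, q) * lam q \<partial>lebesgue) = (\<lambda>k. (\<integral>q. v q * lam q \<partial>lebesgue) * F k)"
  proof
    fix k
    have "(\<integral>q. symm F v (k, q) * lam q \<partial>lebesgue) = (\<integral>q. F k * (v q * lam q) + v k * (F q * lam q) \<partial>lebesgue)"
      by (rule Bochner_Integration.integral_cong) (auto simp: symm_def algebra_simps)
    also have "\<dots> = F k * (\<integral>q. v q * lam q \<partial>lebesgue) + v k * (\<integral>q. F q * lam q \<partial>lebesgue)"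
      using integrable_mult_square_integrable[OF v lam] integrable_mult_square_integrable[OF F lam] by simp
    finally show "(\<integral>q. symm F v (k, q) * lam q \<partial>lebesgue) = (\<integral>q. v q * lam q \<partial>lebesgue) * F k"
      by (simp add: int0)
  qed
  finally have ann: "of_real \<alpha> *\<^sub>C annihilate (abs_L2_sym (symm F v)) = abs_L2 (\<lambda>k. of_real (\<epsilon> - y) * F k)"
    by (simp add: abs_L2_scaleC square_integrable_scale F mult.assoc[symmetric] integral_v_lam del: of_real_diff)
  have c1: "energy1 (- \<epsilon>) (abs_L2 F) + of_real \<alpha> *\<^sub>C annihilate (abs_L2_sym (symm F v))
    = abs_L2 (\<lambda>k. of_real (\<omega> k - y) * F k)"
    unfolding ann energy1_abs[OF F dom(1)]
    by (subst abs_L2_add[OF s square_integrable_scale[OF F]]) (simp add: algebra_simps)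
  have eq: "of_real (\<epsilon> + \<omega> (fst z) + \<omega> (snd z)) * symm F v z
      + of_real \<alpha> * symm (\<lambda>k. cnj (lam k)) F z
    = symm (\<lambda>k. of_real (\<omega> k - y) * F k) v z" for z
  proof -
    have l: "of_real \<alpha> * cnj (lam k) = - (of_real (y + \<epsilon> + \<omega> k) * v k)" for k
      unfolding v_eq by simp
    have eq: "of_real \<alpha> * symm (\<lambda>k. cnj (lam k)) F z = (of_real \<alpha> * cnj (lam (fst z))) * F (snd z)
      + (of_real \<alpha> * cnj (lam (snd z))) * F (fst z)"
      by (simp add: symm_def algebra_simps)
    show ?thesis
      unfolding eq l by (simp add: symm_def algebra_simps)
  qed
  have c2: "energy2 \<epsilon> (abs_L2_sym (symm F v)) + of_real \<alpha> *\<^sub>C create (abs_L2 F)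
    = abs_L2_sym (symm (\<lambda>k. of_real (\<omega> k - y) * F k) v)"
  proof -
    have m: "square_integrable (\<lambda>z. of_real (\<epsilon> + \<omega> (fst z) + \<omega> (snd z)) * symm F v z)"
      by (rule square_integrable_energy2[OF square_integrable_symm[OF F v]])
        (use dom(2) abs_L2_sym_in_domain2_iff[OF square_integrable_symm[OF F v] ae_symmetric_symm] in simp)
    have l: "square_integrable (symm (\<lambda>k. cnj (lam k)) F)"
      by (rule square_integrable_symm[OF square_integrable_cnj_lam F])
    show ?thesis
      unfolding energy2_abs[OF square_integrable_symm[OF F v] ae_symmetric_symm dom(2)] create_abs[OF F]
        abs_L2_sym_scaleC[OF l ae_symmetric_symm]
        abs_L2_sym_add[OF m square_integrable_scale[OF l] ae_symmetric_energy2[OF ae_symmetric_symm] ae_symmetric_scale[OF ae_symmetric_symm]]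
        eq ..
  qed
  show ?thesis
    unfolding attach_def app_spin_boson[OF zero_in_domains(1) dom(2) dom(1) zero_in_domains(2)]
    using c1 c2 orth by (simp add: e0)
qed

lemma app_attach_diff:
  assumes F: "square_integrable F" and wF: "square_integrable (\<lambda>k. of_real (\<omega> k) * F k)"
    and orth: "cinner (abs_L2 F) coupling = 0"
  shows "app_op H (attach F) - of_real (x - y) *\<^sub>C attach F = attach (\<lambda>k. of_real (\<omega> k - x) * F k)"
proof -
  have s: "square_integrable (\<lambda>k. of_real (\<omega> k - y) * F k)"
    using square_integrable_energy1[OF F wF, of "- y"] by (simp add: add.commute)
  have "app_op H (attach F) - of_real (x - y) *\<^sub>C attach F
    = app_op H (attach F) + (- of_real (x - y)) *\<^sub>C attach F"
    by (simp add: complex_vector.scale_minus_left del: of_real_diff)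
  also have "\<dots> = attach (\<lambda>k. of_real (\<omega> k - y) * F k + (- of_real (x - y)) * F k)"
    unfolding app_attach[OF F wF orth] attach_scaleC[OF F]
    by (rule attach_add[OF s square_integrable_scale[OF F]])
  also have "\<dots> = attach (\<lambda>k. of_real (\<omega> k - x) * F k)"
    by (intro arg_cong[where f = attach] ext) (simp add: algebra_simps)
  finally show ?thesis .
qed

text \<open>\<open>attach\<close> changes norms by bounded factors: the one-photon component alone
  gives the lower bound, \<open>integral_norm_symm_le\<close> the upper one.\<close>

lemma hnorm_attach:
  assumes F: "square_integrable F"
  shows "(hnorm (attach F))\<^sup>2 \<le> (1 + 2 * (\<integral>k. (cmod (v k))\<^sup>2 \<partial>lebesgue)) * (\<integral>k. (cmod (F k))\<^sup>2 \<partial>lebesgue)"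
    and "(\<integral>k. (cmod (F k))\<^sup>2 \<partial>lebesgue) \<le> (hnorm (attach F))\<^sup>2"
proof -
  have s: "square_integrable (symm F v)"
    by (rule square_integrable_symm[OF F square_integrable_v])
  have "(hnorm (attach F))\<^sup>2 = Re (cinner (attach F) (attach F))"
    by (simp add: hnorm_def cinner_ge_zero)
  also have "\<dots> = 1 / 2 * (\<integral>z. (cmod (symm F v z))\<^sup>2 \<partial>lebesgue) + (\<integral>k. (cmod (F k))\<^sup>2 \<partial>lebesgue)"
    by (simp add: attach_def cinner_prod_def cinner_abs_L2[OF F F]
        cinner_abs_L2_sym[OF s s ae_symmetric_symm ae_symmetric_symm] integral_mult_cnj_self)
  finally have eq: "(hnorm (attach F))\<^sup>2 = 1 / 2 * (\<integral>z. (cmod (symm F v z))\<^sup>2 \<partial>lebesgue) + (\<integral>k. (cmod (F k))\<^sup>2 \<partial>lebesgue)" .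
  show "(\<integral>k. (cmod (F k))\<^sup>2 \<partial>lebesgue) \<le> (hnorm (attach F))\<^sup>2"
    unfolding eq by simp
  show "(hnorm (attach F))\<^sup>2 \<le> (1 + 2 * (\<integral>k. (cmod (v k))\<^sup>2 \<partial>lebesgue)) * (\<integral>k. (cmod (F k))\<^sup>2 \<partial>lebesgue)"
    unfolding eq using integral_norm_symm_le[OF F square_integrable_v] by (simp add: algebra_simps)
qed

lemma square_integrable_omega_supported:
  assumes F: "square_integrable F" and supp: "\<And>k. F k \<noteq> 0 \<Longrightarrow> \<omega> k \<le> M"
  shows "square_integrable (\<lambda>k. of_real (\<omega> k) * F k)"
proof -
  have "square_integrable (\<lambda>k. of_real (min (\<omega> k) \<bar>M\<bar>) * F k)"
    by (rule square_integrable_bounded_mult[OF F, of _ "\<bar>M\<bar>"]) (use omega_nonneg in auto)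
  also have "(\<lambda>k. of_real (min (\<omega> k) \<bar>M\<bar>) * F k) = (\<lambda>k. of_real (\<omega> k) * F k)"
  proof
    fix k show "of_real (min (\<omega> k) \<bar>M\<bar>) * F k = of_real (\<omega> k) * F k"
      using supp[of k] by (cases "F k = 0") (auto simp: min_def)
  qed
  finally show ?thesis .
qed

text \<open>A photon concentrated where \<open>\<omega>\<close> is close to \<open>x\<close> yields
  an approximate eigenvector at \<open>x - y\<close>, which violates the a priori bound in
  \<open>resolvent_set\<close>.\<close>

lemma essential_value_in_spectrum:
  assumes x: "\<And>\<delta>. \<delta> > 0 \<Longrightarrow> {k. \<bar>\<omega> k - x\<bar> < \<delta>} \<notin> null_sets lebesgue"
  shows "of_real (x - y) \<in> op_spectrum H"
proof -
  have "of_real (x - y) \<notin> resolvent_set H"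
  proof
    assume "of_real (x - y) \<in> resolvent_set H"
    then obtain C where C: "\<And>f. f \<in> dom_op H \<Longrightarrow> hnorm f \<le> C * hnorm (app_op H f - of_real (x - y) *\<^sub>C f)"
      by (auto simp: resolvent_set_def)
    define V where "V = 1 + 2 * (\<integral>k. (cmod (v k))\<^sup>2 \<partial>lebesgue)"
    have V: "V \<ge> 1"
      by (simp add: V_def)
    \<comment> \<open>Chosen so that the resolvent bound would give
      \<open>N \<le> C^2 * V * \<delta>^2 * N < N\<close>.\<close>
    define \<delta> where "\<delta> = 1 / sqrt (2 * (1 + C\<^sup>2 * V))"
    have CV: "0 \<le> C\<^sup>2 * V"
      using V by simp
    have \<delta>: "\<delta> > 0"
      unfolding \<delta>_def using CV by (simp add: add_pos_nonneg)
    have \<delta>2: "C\<^sup>2 * V * \<delta>\<^sup>2 < 1"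
      unfolding \<delta>_def power_divide using CV by (simp add: field_simps)
    let ?S = "{k. \<bar>\<omega> k - x\<bar> < \<delta>}"
    have "?S = {k \<in> space lebesgue. \<bar>\<omega> k - x\<bar> < \<delta>}"
      by simp
    also have "\<dots> \<in> sets lebesgue"
      by measurable
    finally have "?S \<in> sets lebesgue" .
    then obtain F where F: "square_integrable F" "\<And>k. k \<notin> ?S \<Longrightarrow> F k = 0" "abs_L2 F \<noteq> 0"
      "cinner (abs_L2 F) coupling = 0"
      using exists_supported_orthogonal[of "{coupling}" ?S] x[OF \<delta>] by auto
    have wF: "square_integrable (\<lambda>k. of_real (\<omega> k) * F k)"
      by (rule square_integrable_omega_supported[OF F(1), of "x + \<delta>"]) (use F(2) in \<open>force simp: abs_if split: if_splits\<close>)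
    define N where "N = (\<integral>k. (cmod (F k))\<^sup>2 \<partial>lebesgue)"
    have "cinner (abs_L2 F) (abs_L2 F) = of_real N"
      by (simp add: cinner_abs_L2 F(1) integral_mult_cnj_self N_def)
    then have "N \<noteq> 0"
      using F(3) by (auto simp: cinner_eq_zero_iff)
    moreover have "N \<ge> 0"
      by (simp add: N_def)
    ultimately have N: "N > 0"
      by simp
    let ?F = "\<lambda>k. of_real (\<omega> k - x) * F k"
    have sF: "square_integrable ?F"
      using square_integrable_energy1[OF F(1) wF, of "- x"] by (simp add: add.commute)
    have "(\<integral>k. (cmod (?F k))\<^sup>2 \<partial>lebesgue) \<le> (\<integral>k. \<delta>\<^sup>2 * (cmod (F k))\<^sup>2 \<partial>lebesgue)"
    proof (rule integral_mono)
      show "integrable lebesgue (\<lambda>k. (cmod (?F k))\<^sup>2)" "integrable lebesgue (\<lambda>k. \<delta>\<^sup>2 * (cmod (F k))\<^sup>2)"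
        using sF F(1) by (simp_all add: square_integrable_def del: of_real_diff)
      fix k
      show "(cmod (?F k))\<^sup>2 \<le> \<delta>\<^sup>2 * (cmod (F k))\<^sup>2"
      proof (cases "k \<in> ?S")
        case True
        then have "\<bar>\<omega> k - x\<bar>\<^sup>2 \<le> \<delta>\<^sup>2"
          by (intro power_mono) auto
        then show ?thesis
          unfolding norm_mult norm_of_real power_mult_distrib by (rule mult_right_mono) simp
      qed (use F(2) in simp)
    qed
    then have small: "(\<integral>k. (cmod (?F k))\<^sup>2 \<partial>lebesgue) \<le> \<delta>\<^sup>2 * N"
      by (simp add: N_def)
    have "N \<le> (hnorm (attach F))\<^sup>2"
      unfolding N_def by (rule hnorm_attach(2)[OF F(1)])
    also have "\<dots> \<le> (C * hnorm (attach ?F))\<^sup>2"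
      using C[OF attach_in_dom(3)[OF F(1) wF]] unfolding app_attach_diff[OF F(1) wF F(4)]
      by (rule power_mono) (simp add: hnorm_def cinner_ge_zero)
    also have "\<dots> = C\<^sup>2 * (hnorm (attach ?F))\<^sup>2"
      by (rule power_mult_distrib)
    also have "\<dots> \<le> C\<^sup>2 * (V * (\<delta>\<^sup>2 * N))"
    proof (rule mult_left_mono)
      have "(hnorm (attach ?F))\<^sup>2 \<le> V * (\<integral>k. (cmod (?F k))\<^sup>2 \<partial>lebesgue)"
        unfolding V_def by (rule hnorm_attach(1)[OF sF])
      also have "\<dots> \<le> V * (\<delta>\<^sup>2 * N)"
        using small V by (intro mult_left_mono) auto
      finally show "(hnorm (attach ?F))\<^sup>2 \<le> V * (\<delta>\<^sup>2 * N)" .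
    qed simp
    also have "\<dots> = (C\<^sup>2 * V * \<delta>\<^sup>2) * N"
      by (simp add: mult_ac)
    also have "\<dots> < 1 * N"
      by (rule mult_strict_right_mono[OF \<delta>2 N])
    finally show False
      by simp
  qed
  then show ?thesis
    by (simp add: op_spectrum_def)
qed

text \<open>A photon supported where \<open>\<omega> = m\<close> gives an exact eigenvector. For a
  finite set \<open>B\<close> it can be chosen orthogonal to the spin \<open>-1\<close> one-photon
  components of all members of \<open>B\<close>; were it in the span of \<open>B\<close>, it would
  be orthogonal to itself.\<close>

lemma infinite_eigenspace:
  assumes m: "{k. \<omega> k = m} \<notin> null_sets lebesgue"
  shows "cdim (eigenspace H (of_real (m - y))) = \<infinity>"
proof -
  have False if B: "finite B" "eigenspace H (of_real (m - y)) \<subseteq> complex_vector.span B" for B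
  proof -
    define pr :: "'a state \<Rightarrow> 'a L2" where "pr = (\<lambda>f. fst (snd (snd f)))"
    let ?S = "{k. \<omega> k = m}"
    have "?S = {k \<in> space lebesgue. \<omega> k = m}"
      by simp
    also have "\<dots> \<in> sets lebesgue"
      by measurable
    finally have "?S \<in> sets lebesgue" .
    then obtain F where F: "square_integrable F" "\<And>k. k \<notin> ?S \<Longrightarrow> F k = 0" "abs_L2 F \<noteq> 0"
      "\<And>g. g \<in> insert coupling (pr ` B) \<Longrightarrow> cinner (abs_L2 F) g = 0"
      using exists_supported_orthogonal[of "insert coupling (pr ` B)" ?S] B(1) m by auto
    have wF: "square_integrable (\<lambda>k. of_real (\<omega> k) * F k)"
      by (rule square_integrable_omega_supported[OF F(1), of m]) (use F(2) in force)
    have "app_op H (attach F) - of_real (m - y) *\<^sub>C attach F = attach (\<lambda>k. 0)"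
      unfolding app_attach_diff[OF F(1) wF F(4)[OF insertI1]]
      by (intro arg_cong[where f = attach] ext) (use F(2) in force)
    then have "attach F \<in> eigenspace H (of_real (m - y))"
      using attach_in_dom(3)[OF F(1) wF] by (simp add: eigenspace_def attach_zero del: of_real_diff)
    then have "attach F \<in> complex_vector.span B"
      using B(2) by blast
    moreover have "B \<subseteq> {f. cinner (abs_L2 F) (pr f) = 0}"
      using F(4) by blast
    moreover have "complex_vector.subspace {f. cinner (abs_L2 F) (pr f) = 0}"
      unfolding complex_vector.subspace_def
      by (auto simp: pr_def scaleC_prod_def cinner_add_right cinner_scaleC_right)
    ultimately have "cinner (abs_L2 F) (pr (attach F)) = 0"
      using complex_vector.span_minimal by blast
    then show False
      using F(3) by (simp add: pr_def attach_def cinner_eq_zero_iff)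
  qed
  then show ?thesis
    unfolding cdim_def by auto
qed

text \<open>A point of the spectrum is not discrete if its multiplicity is infinite or if it is not
  isolated. The first happens when \<open>\<omega> = m\<close> on a non-null set, the second when
  that set is null.\<close>

lemma ess_bottom_le:
  assumes m: "{k. \<omega> k < m} \<in> null_sets lebesgue" "\<And>t. m < t \<Longrightarrow> {k. \<omega> k < t} \<notin> null_sets lebesgue"
  shows "ess_bottom H \<le> ereal (m - y)"
proof -
  have spec: "of_real (m - y) \<in> op_spectrum H"
  proof (rule essential_value_in_spectrum)
    fix \<delta> :: real assume "\<delta> > 0"
    then have "{k. \<omega> k < m + \<delta>} - {k. \<omega> k < m} \<notin> null_sets lebesgue"
      by (intro nonnull_Diff_null m) simp
    moreover have "{k. \<omega> k < m + \<delta>} - {k. \<omega> k < m} \<subseteq> {k. \<bar>\<omega> k - m\<bar> < \<delta>}"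
      by auto
    ultimately show "{k. \<bar>\<omega> k - m\<bar> < \<delta>} \<notin> null_sets lebesgue"
      by (rule nonnull_subset)
  qed
  have "of_real (m - y) \<notin> discrete_spectrum H"
  proof (cases "{k. \<omega> k = m} \<in> null_sets lebesgue")
    case False
    then show ?thesis
      using infinite_eigenspace by (simp add: discrete_spectrum_def del: of_real_diff)
  next
    case True
    \<comment> \<open>Values of \<open>\<omega>\<close> between \<open>m\<close> and
      \<open>m + e\<close> then still fill a non-null set. The essential infimum \<open>x\<close>
      over a part of it bounded away from \<open>m\<close> is a new essential value, so
      \<open>x - y\<close> is in the spectrum.\<close>
    have "\<exists>x. m < x \<and> x < m + e \<and> of_real (x - y) \<in> op_spectrum H" if e: "e > 0" for e
    proof -
      have "{k. \<omega> k < m + e} - ({k. \<omega> k < m} \<union> {k. \<omega> k = m}) \<notin> null_sets lebesgue"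
        using True m e by (intro nonnull_Diff_null null_sets.Un) auto
      moreover have "{k. \<omega> k < m + e} - ({k. \<omega> k < m} \<union> {k. \<omega> k = m}) = {k \<in> {k. \<omega> k < m + e}. m < \<omega> k}"
        by auto
      ultimately have "{k \<in> {k. \<omega> k < m + e}. m < \<omega> k} \<notin> null_sets lebesgue"
        by (simp only: not_False_eq_True)
      then obtain \<eta> where \<eta>: "\<eta> > 0" "{k \<in> {k. \<omega> k < m + e}. m + \<eta> \<le> \<omega> k} \<notin> null_sets lebesgue"
        by (rule nonnull_strict_superlevel)
      define S where "S = {k \<in> {k. \<omega> k < m + e}. m + \<eta> \<le> \<omega> k}"
      have "S = {k \<in> space lebesgue. \<omega> k < m + e \<and> m + \<eta> \<le> \<omega> k}"
        by (simp add: S_def)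
      also have "\<dots> \<in> sets lebesgue"
        by measurable
      finally have S: "S \<in> sets lebesgue" "S \<notin> null_sets lebesgue"
        using \<eta>(2) by (simp_all only: S_def not_False_eq_True)
      obtain x where x: "{k \<in> S. \<omega> k < x} \<in> null_sets lebesgue"
        "\<And>t. x < t \<Longrightarrow> {k \<in> S. \<omega> k < t} \<notin> null_sets lebesgue"
        using essential_infimum_on[OF omega_measurable S omega_nonneg] by blast
      have "m + \<eta> \<le> x"
      proof (rule ccontr)
        assume "\<not> m + \<eta> \<le> x"
        then have "{k \<in> S. \<omega> k < m + \<eta>} \<notin> null_sets lebesgue"
          by (intro x) simp
        moreover have "{k \<in> S. \<omega> k < m + \<eta>} = {}"
          by (auto simp: S_def)
        ultimately show False
          by (simp only: null_sets.empty_sets not_True_eq_False)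
      qed
      then have "m < x"
        using \<eta>(1) by linarith
      moreover have "x < m + e"
      proof (rule ccontr)
        assume "\<not> x < m + e"
        then have "{k \<in> S. \<omega> k < x} = S"
          by (auto simp: S_def)
        then show False
          using x(1) S(2) by simp
      qed
      moreover have "of_real (x - y) \<in> op_spectrum H"
      proof (rule essential_value_in_spectrum)
        fix \<delta> :: real assume "\<delta> > 0"
        then have "{k \<in> S. \<omega> k < x + \<delta>} - {k \<in> S. \<omega> k < x} \<notin> null_sets lebesgue"
          by (intro nonnull_Diff_null x) simp
        moreover have "{k \<in> S. \<omega> k < x + \<delta>} - {k \<in> S. \<omega> k < x} \<subseteq> {k. \<bar>\<omega> k - x\<bar> < \<delta>}"
          by auto
        ultimately show "{k. \<bar>\<omega> k - x\<bar> < \<delta>} \<notin> null_sets lebesgue"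
          by (rule nonnull_subset)
      qed
      ultimately show ?thesis
        by blast
    qed
    note near = this
    have "\<not> of_real (m - y) isolated_in op_spectrum H"
    proof
      assume "of_real (m - y) isolated_in op_spectrum H"
      then obtain e where e: "e > 0"
        "\<And>z. z \<in> op_spectrum H \<Longrightarrow> dist (of_real (m - y)) z < e \<Longrightarrow> z = of_real (m - y)"
        unfolding isolated_in_dist_Ex_iff by blast
      obtain x where x: "m < x" "x < m + e" "of_real (x - y) \<in> op_spectrum H"
        using near[OF e(1)] by blast
      have "dist (complex_of_real (m - y)) (of_real (x - y)) < e"
        using x by (simp add: dist_of_real dist_real_def del: of_real_diff)
      then have "complex_of_real (x - y) = of_real (m - y)"
        by (rule e(2)[OF x(3)])
      then show False
        using x(1) by (simp only: of_real_eq_iff)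
    qed
    then show ?thesis
      by (simp add: discrete_spectrum_def del: of_real_diff)
  qed
  then have "of_real (m - y) \<in> essential_spectrum H"
    using spec by (simp add: essential_spectrum_def del: of_real_diff)
  then show ?thesis
    unfolding ess_bottom_def by (intro INF_lower) (simp del: of_real_diff)
qed

end

theorem theorem1:
  fixes \<epsilon> :: real and lam :: "real ^ 'd \<Rightarrow> complex" and \<omega> :: "real ^ 'd \<Rightarrow> real"
  assumes "\<epsilon> > 0"
    and "square_integrable lam"
    and "\<And>k. \<omega> k \<ge> 0"
    and "\<not> bounded (range \<omega>)"
    and "AE k in lebesgue. isCont \<omega> k"
    and "Inf (range \<omega>) = 0"
  shows "\<exists>\<alpha>0 > 0. \<forall>\<alpha> > \<alpha>0.
    num_bound_states (spin_boson \<epsilon> lam \<omega> \<alpha>) \<le> 2 \<and>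
    (\<forall>E. spectral_measure_of (spin_boson \<epsilon> lam \<omega> \<alpha>) E \<longrightarrow>
       cdim (range (E {x. ereal x < ess_bottom (spin_boson \<epsilon> lam \<omega> \<alpha>)})) \<le> 2)"
proof -
  interpret boson_field lam \<omega>
    by unfold_locales (use assms AE_isCont_imp_lebesgue_measurable in auto)
  have "(UNIV :: (real ^ 'd) set) \<notin> null_sets lebesgue"
    by (simp add: null_sets_def)
  then obtain m where m: "{k. \<omega> k < m} \<in> null_sets lebesgue"
    "\<And>t. m < t \<Longrightarrow> {k. \<omega> k < t} \<notin> null_sets lebesgue"
    using essential_infimum_on[OF omega_measurable _ _ omega_nonneg, of UNIV] by auto
  have "m \<ge> 0"
  proof (rule ccontr)
    assume "\<not> m \<ge> 0"
    then have "{k. \<omega> k < 0} \<notin> null_sets lebesgue"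
      by (intro m) simp
    moreover have "{k. \<omega> k < 0} = {}"
      using omega_nonneg by (simp add: not_less)
    ultimately show False
      by (simp only: null_sets.empty_sets not_True_eq_False)
  qed
  have mAE: "AE k in lebesgue. m \<le> \<omega> k"
    using AE_not_in[OF m(1)] by eventually_elim simp
  \<comment> \<open>Both counts, by multiplicities and by the spectral subspace, use the same data:
    a root \<open>y\<close> and two test vectors.\<close>
  have conclude: "num_bound_states (spin_boson \<epsilon> lam \<omega> \<alpha>) \<le> 2 \<and>
    (\<forall>E. spectral_measure_of (spin_boson \<epsilon> lam \<omega> \<alpha>) E \<longrightarrow>
       cdim (range (E {x. ereal x < ess_bottom (spin_boson \<epsilon> lam \<omega> \<alpha>)})) \<le> 2)"
    if y: "y \<ge> \<epsilon>" "y - \<epsilon> = \<alpha>\<^sup>2 * self_energy (y + \<epsilon>)"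
      and bound: "\<And>f. f \<in> dom_op (spin_boson \<epsilon> lam \<omega> \<alpha>) \<Longrightarrow> cinner f p = 0 \<Longrightarrow> cinner f q = 0 \<Longrightarrow>
        (m - y) * Re (cinner f f) \<le> Re (cinner (app_op (spin_boson \<epsilon> lam \<omega> \<alpha>) f) f)"
    for \<alpha> y p q
  proof -
    interpret one_photon_bound_state lam \<omega> \<epsilon> \<alpha> y
      by unfold_locales (use assms(1) y in auto)
    interpret symmetric_operator H
      by (rule symmetric_operator_spin_boson)
    note ess = ess_bottom_le[OF m]
    show ?thesis
      using num_bound_states_le_2[OF ess bound]
        cdim_spectral_subspace_le_2[OF _ spin_boson_semibounded bound ess]
      by blast
  qed
  show ?thesis
  proof (cases "AE k in lebesgue. lam k = 0")
    case True
    show ?thesis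
    proof (intro exI[of _ 1] conjI allI impI)
      fix \<alpha> :: real
      \<comment> \<open>Without coupling the self-energy vanishes and \<open>y = \<epsilon>\<close>
        is the root.\<close>
      have "AE k in lebesgue. (cmod (lam k))\<^sup>2 / (\<epsilon> + \<epsilon> + \<omega> k) = 0"
        using True by eventually_elim simp
      then have "self_energy (\<epsilon> + \<epsilon>) = 0"
        by (rule integral_eq_zero_AE)
      then have root: "\<epsilon> - \<epsilon> = \<alpha>\<^sup>2 * self_energy (\<epsilon> + \<epsilon>)"
        by simp
      note c = conclude[OF order_refl root
          spin_boson_codim_two_bound_uncoupled[OF True less_imp_le[OF assms(1)] mAE \<open>m \<ge> 0\<close>]]
      show "num_bound_states (spin_boson \<epsilon> lam \<omega> \<alpha>) \<le> 2"
        using c by blast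
      fix E assume "spectral_measure_of (spin_boson \<epsilon> lam \<omega> \<alpha>) E"
      then show "cdim (range (E {x. ereal x < ess_bottom (spin_boson \<epsilon> lam \<omega> \<alpha>)})) \<le> 2"
        using c by blast
    qed simp
  next
    case False
    obtain \<alpha>0 where \<alpha>0: "\<alpha>0 > 0" and bound: "\<And>\<alpha> y f. \<lbrakk>\<alpha> > \<alpha>0; y \<ge> \<epsilon>;
      y - \<epsilon> = \<alpha>\<^sup>2 * self_energy (y + \<epsilon>);
      f \<in> dom_op (spin_boson \<epsilon> lam \<omega> \<alpha>);
      cinner f ((0, 0, 0), (0, resolvent_coupling (y + \<epsilon>), 0)) = 0;
      cinner f ((0, resolvent_coupling (y - \<epsilon>), 0), (0, 0, 0)) = 0\<rbrakk> \<Longrightarrow>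
      (m - y) * Re (cinner f f) \<le> Re (cinner (app_op (spin_boson \<epsilon> lam \<omega> \<alpha>) f) f)"
      using spin_boson_codim_two_bound_coupled[OF False assms(1) mAE \<open>m \<ge> 0\<close>] by blast
    show ?thesis
    proof (intro exI[of _ \<alpha>0] conjI[OF \<alpha>0] allI impI)
      fix \<alpha> assume \<alpha>: "\<alpha> > \<alpha>0"
      obtain y where y: "y \<ge> \<epsilon>" "y - \<epsilon> = \<alpha>\<^sup>2 * self_energy (y + \<epsilon>)"
        using one_photon_energy_exists[OF assms(1), of \<alpha>] by blast
      show "num_bound_states (spin_boson \<epsilon> lam \<omega> \<alpha>) \<le> 2 \<and>
        (\<forall>E. spectral_measure_of (spin_boson \<epsilon> lam \<omega> \<alpha>) E \<longrightarrow>
           cdim (range (E {x. ereal x < ess_bottom (spin_boson \<epsilon> lam \<omega> \<alpha>)})) \<le> 2)"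
        by (rule conclude[OF y bound[OF \<alpha> y]])
    qed
  qed
qed

end
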